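(* Let $s=(k-1)d+2$. There is an algorithm that, given a CGIS instance consisting of a $k$-partite $d$-clause graph $(G,\lambda)$ over $X$, runs in time $O(\min\{d!(s-1)^d d|V(G)|,\ d|V(G)|^2\})$ and outputs an equivalent CGIS instance consisting of a $k$-partite $d$-clause graph over $X$ in which every part has at most $d!(s-1)^d-1$ vertices (so the output has size at most $dk\,d!(s-1)^d$).
   Context: For a variable set $X$ let $\mathcal{C}^d_X$ be the set of all clauses (sets of literals, no literal together with its negation) with exactly $d$ distinct literals over $X$. Two clauses clash if they contain a pair of opposite literals. A $k$-partite $d$-clause graph over $X$ is $(G,\lambda)$ with $G$ undirected, $V(G)=V_1\uplus\dots\uplus V_k$, $\lambda\colon V(G)\to\mathcal{C}^d_X$ injective on each $V_i$, and $u\in V_i$, $v\in V_j$ adjacent iff $i\ne j$ and $\lambda(u),\lambda(v)$ clash. CGIS: given such $(G,\lambda)$, decide whether there is an independent set $S$ with $|S\cap V_i|=1$ for all $i\in[k]$. Two instances are equivalent if both are yes-instances or both are no-instances.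
   Formalization: Assumes k≥1 and excludes d=0 and k=d=1, where d!(s-1)^d-1=0 would force all parts empty, so a yes-instance (e.g. one vertex when k=d=1) has no equivalent output; the time bound has an added +1 that matters only for empty V(G). *)

theory Defs
  imports Main "HOL-Library.Disjoint_Sets"
begin

section \<open>Clauses\<close>

datatype 'x literal = Pos 'x | Neg 'x

fun var_of :: "'x literal \<Rightarrow> 'x" where
  "var_of (Pos x) = x"
| "var_of (Neg x) = x"

fun opposite :: "'x literal \<Rightarrow> 'x literal" where
  "opposite (Pos x) = Neg x"
| "opposite (Neg x) = Pos x"

type_synonym 'x clause = "'x literal set"

definition clauses :: "nat \<Rightarrow> 'x set \<Rightarrow> 'x clause set" where
  "clauses d X = {c. finite c \<and> card c = d \<and> var_of ` c \<subseteq> X \<and> (\<forall>l\<in>c. opposite l \<notin> c)}"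

definition clash :: "'x clause \<Rightarrow> 'x clause \<Rightarrow> bool" where
  "clash c c' \<longleftrightarrow> (\<exists>l\<in>c. opposite l \<in> c')"


section \<open>Partite clause graphs and CGIS\<close>

record ('v, 'x) clause_graph =
  verts :: "'v set"
  edges :: "'v set set"
  part :: "nat \<Rightarrow> 'v set"
  label :: "'v \<Rightarrow> 'x clause"

text \<open>Parts may be empty, and vertices of different parts may carry the same clause.\<close>

definition partite_clause_graph ::
    "nat \<Rightarrow> nat \<Rightarrow> 'x set \<Rightarrow> ('v, 'x) clause_graph \<Rightarrow> bool" where
  "partite_clause_graph k d X G \<longleftrightarrow>
     finite (verts G) \<and>
     edges G \<subseteq> {{u, v} |u v. u \<in> verts G \<and> v \<in> verts G \<and> u \<noteq> v} \<and>
     verts G = (\<Union>i\<in>{1..k}. part G i) \<and>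
     disjoint_family_on (part G) {1..k} \<and>
     (\<forall>v\<in>verts G. label G v \<in> clauses d X) \<and>
     (\<forall>i\<in>{1..k}. inj_on (label G) (part G i)) \<and>
     (\<forall>i\<in>{1..k}. \<forall>j\<in>{1..k}. \<forall>u\<in>part G i. \<forall>v\<in>part G j.
        {u, v} \<in> edges G \<longleftrightarrow> i \<noteq> j \<and> clash (label G u) (label G v))"

definition independent_set :: "('v, 'x) clause_graph \<Rightarrow> 'v set \<Rightarrow> bool" where
  "independent_set G S \<longleftrightarrow> S \<subseteq> verts G \<and> (\<forall>u\<in>S. \<forall>v\<in>S. {u, v} \<notin> edges G)"

definition CGIS :: "nat \<Rightarrow> ('v, 'x) clause_graph \<Rightarrow> bool" where
  "CGIS k G \<longleftrightarrow> (\<exists>S. independent_set G S \<and> (\<forall>i\<in>{1..k}. card (S \<inter> part G i) = 1))"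

definition equivalent_instances ::
    "nat \<Rightarrow> ('v, 'x) clause_graph \<Rightarrow> ('w, 'y) clause_graph \<Rightarrow> bool" where
  "equivalent_instances k G H \<longleftrightarrow> (CGIS k G \<longleftrightarrow> CGIS k H)"

text \<open>The size of an instance is its number of literal occurrences; the edges are not counted,
  since they are determined by the labels and the parts.\<close>

definition instance_size :: "('v, 'x) clause_graph \<Rightarrow> nat" where
  "instance_size G = (\<Sum>v\<in>verts G. card (label G v))"


section \<open>Random access machine programs\<close>

text \<open>
  The machine model is a unit-cost RAM, presented as a structured language. A state consists of
  registers and of arrays, all of them holding natural numbers and all indexed by natural
  numbers; a program mentions only finitely many registers and arrays, and arrays allow
  computed indices (indirect addressing). The only arithmetic operations are addition and
  truncated subtraction: unit-cost multiplication would allow numbers of exponential length to be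
  built in polynomial time. Every operation, memory access, test and assignment costs one step.
\<close>

type_synonym state = "(nat \<Rightarrow> nat) \<times> (nat \<Rightarrow> nat \<Rightarrow> nat)"

datatype expr =
    Num nat
  | Reg nat
  | Arr nat expr
  | Plus expr expr
  | Minus expr expr

fun expr_val :: "expr \<Rightarrow> state \<Rightarrow> nat" where
  "expr_val (Num n) s = n"
| "expr_val (Reg r) s = fst s r"
| "expr_val (Arr a e) s = snd s a (expr_val e s)"
| "expr_val (Plus e f) s = expr_val e s + expr_val f s"
| "expr_val (Minus e f) s = expr_val e s - expr_val f s"

fun expr_cost :: "expr \<Rightarrow> nat" where
  "expr_cost (Num n) = 1"
| "expr_cost (Reg r) = 1"
| "expr_cost (Arr a e) = 1 + expr_cost e"
| "expr_cost (Plus e f) = 1 + expr_cost e + expr_cost f"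
| "expr_cost (Minus e f) = 1 + expr_cost e + expr_cost f"

text \<open>The tests of conditionals and loops are of the form \<open>e < f\<close>.\<close>

datatype com =
    Assign nat expr
  | Store nat expr expr
  | Seq com com
  | IfLess expr expr com com
  | WhileLess expr expr com

text \<open>\<open>exec P s t s'\<close>: started in state \<open>s\<close>, the program \<open>P\<close> halts after \<open>t\<close> steps in state \<open>s'\<close>.\<close>

inductive exec :: "com \<Rightarrow> state \<Rightarrow> nat \<Rightarrow> state \<Rightarrow> bool" where
  Assign: "exec (Assign r e) s (1 + expr_cost e) ((fst s)(r := expr_val e s), snd s)"
| Store: "exec (Store a e f) s (1 + expr_cost e + expr_cost f)
    (fst s, (snd s)(a := (snd s a)(expr_val e s := expr_val f s)))"
| Seq: "\<lbrakk>exec P s t s'; exec Q s' t' s''\<rbrakk> \<Longrightarrow> exec (Seq P Q) s (t + t') s''"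
| If_True: "\<lbrakk>expr_val e s < expr_val f s; exec P s t s'\<rbrakk>
    \<Longrightarrow> exec (IfLess e f P Q) s (1 + expr_cost e + expr_cost f + t) s'"
| If_False: "\<lbrakk>\<not> expr_val e s < expr_val f s; exec Q s t s'\<rbrakk>
    \<Longrightarrow> exec (IfLess e f P Q) s (1 + expr_cost e + expr_cost f + t) s'"
| While_True: "\<lbrakk>expr_val e s < expr_val f s; exec P s t s'; exec (WhileLess e f P) s' t' s''\<rbrakk>
    \<Longrightarrow> exec (WhileLess e f P) s (1 + expr_cost e + expr_cost f + t + t') s''"
| While_False: "\<not> expr_val e s < expr_val f s
    \<Longrightarrow> exec (WhileLess e f P) s (1 + expr_cost e + expr_cost f) s"

inductive_cases exec_AssignE: "exec (Assign r e) s t s'"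
inductive_cases exec_StoreE: "exec (Store a e f) s t s'"
inductive_cases exec_SeqE: "exec (Seq P Q) s t s'"
inductive_cases exec_IfE: "exec (IfLess e f P Q) s t s'"
inductive_cases exec_WhileE: "exec (WhileLess e f P) s t s'"

text \<open>Programs are deterministic, so the existence of a halting run describes the only run.\<close>

lemma exec_deterministic:
  "exec P s t s' \<Longrightarrow> exec P s u s'' \<Longrightarrow> t = u \<and> s' = s''"
proof (induction arbitrary: u s'' rule: exec.induct)
  case (Assign r e s)
  from Assign show ?case by (rule exec_AssignE) simp
next
  case (Store a e f s)
  from Store show ?case by (rule exec_StoreE) simp
next
  case (Seq P s t s' Q t' r)
  from Seq.prems obtain u1 u2 q
    where "exec P s u1 q" "exec Q q u2 s''" "u = u1 + u2" by (rule exec_SeqE)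
  with Seq.IH show ?case by blast
next
  case (If_True e s f P t s' Q)
  from If_True.prems obtain u1
    where "exec P s u1 s''" "u = 1 + expr_cost e + expr_cost f + u1"
    by (rule exec_IfE) (use If_True.hyps in simp_all)
  with If_True.IH show ?case by blast
next
  case (If_False e s f Q t s' P)
  from If_False.prems obtain u1
    where "exec Q s u1 s''" "u = 1 + expr_cost e + expr_cost f + u1"
    by (rule exec_IfE) (use If_False.hyps in simp_all)
  with If_False.IH show ?case by blast
next
  case (While_True e s f P t s' t' r)
  from While_True.prems obtain u1 u2 q
    where "exec P s u1 q" "exec (WhileLess e f P) q u2 s''"
      "u = 1 + expr_cost e + expr_cost f + u1 + u2"
    by (rule exec_WhileE) (use While_True.hyps in simp_all)
  with While_True.IH show ?case by blast
next
  case (While_False e s f P)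
  from While_False.prems show ?case
    by (rule exec_WhileE) (use While_False.hyps in simp_all)
qed

text \<open>A word is passed in array 0 with its length in register 0, both for input and for output.
  Initially all other memory cells are 0.\<close>

definition input_state :: "nat list \<Rightarrow> state" where
  "input_state w = ((\<lambda>_. 0)(0 := length w),
     (\<lambda>a i. if a = 0 \<and> i < length w then w ! i else 0))"

definition computes_in :: "com \<Rightarrow> nat list \<Rightarrow> nat list \<Rightarrow> nat \<Rightarrow> bool" where
  "computes_in P w w' t \<longleftrightarrow> (\<exists>s. exec P (input_state w) t s \<and>
     fst s 0 = length w' \<and> (\<forall>i<length w'. snd s 0 i = w' ! i))"


section \<open>Encoding of instances\<close>

fun literal_code :: "nat literal \<Rightarrow> nat" where
  "literal_code (Pos x) = 2 * x"
| "literal_code (Neg x) = 2 * x + 1"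

text \<open>An instance is written as \<open>k\<close>, \<open>d\<close> and the number of vertices, followed for each vertex by
  the index of its part and the codes of the \<open>d\<close> literals of its clause. The vertices and the
  literals of each clause may be listed in any order.\<close>

definition encodes :: "nat \<Rightarrow> nat \<Rightarrow> ('v, nat) clause_graph \<Rightarrow> nat list \<Rightarrow> bool" where
  "encodes k d G w \<longleftrightarrow> (\<exists>vs p ls.
     distinct vs \<and> set vs = verts G \<and>
     (\<forall>v\<in>verts G. p v \<in> {1..k} \<and> v \<in> part G (p v)) \<and>
     (\<forall>v\<in>verts G. distinct (ls v) \<and> set (ls v) = label G v) \<and>
     w = k # d # length vs # concat (map (\<lambda>v. p v # map literal_code (ls v)) vs))"

end

(*
  If fewer than D vertices are given, every part is small enough and the input is returned; deciding
  n < D only takes time O(d * n), since the product D is abandoned as soon as it exceeds n.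

  Otherwise put m = (k - 1) * d + 1, which exceeds the number of literals that k - 1 clauses can
  block.  Each part is turned into a tree of sunflowers.  A node has a core C and at most m petals:
  kept clauses that contain C and are disjoint outside C.  A new clause c starts at the root (C = {}).
  Whenever it meets a petal of the current node in a literal l outside C, it descends to the child
  of that petal and literal, with core C plus l; if it meets no petal, it becomes a petal itself,
  unless there are already m of them.  In that case c may be dropped: a choice in the other parts
  that leaves c available does not block C, so it misses one of the m disjoint petals.

  If the root gets m petals, the part has a choice left whatever is chosen in the other parts.  Such
  a free part is replaced by a copy of a part that is not free (or by a single clause, if all parts
  are free); the copied choice clashes with no other, since a clause does not clash with itself.  A
  part that is not free has at most m - 1 petals at the root, and this missing petal
  pays for the bound D - 1 on the size of the tree.
*)

theory Submission
  imports Defs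
begin

section \<open>Sunflower trees\<close>

text \<open>A kept clause is never removed, so the reason for dropping a clause stays valid until
  the end. Clauses can therefore be inserted in input order, with no search for sunflowers in a
  finished family.

  The constant \<open>D\<close> is the deepest level at full branching: a petal over a core of size
  d - r has r literals left to branch on and every child has m petals, so the levels multiply to d!
  m^d. The upper levels have to fit below \<open>D\<close> as well, which is where the missing root
  petal comes in.

  Free parts cannot simply be cut down to the m petals of their root: for d = 1 one has D = m, so m
  petals already exceed D - 1. They cannot be deleted either, because the output must have k parts,
  and an empty part would make it a no-instance. Hence the copies.

  For the running time, a tree is searched only while its root is not full, hence while it has fewer
  than \<open>D\<close> clauses, so that an insertion costs O(d D). Reading the whole input once per
  part is affordable because k <= m <= D.\<close>

definition represents :: "nat \<Rightarrow> 'a set set \<Rightarrow> 'a set set \<Rightarrow> bool" where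
  "represents m F K \<longleftrightarrow>
     (\<forall>c\<in>F. \<forall>Y. finite Y \<and> card Y < m \<and> c \<inter> Y = {} \<longrightarrow> (\<exists>c'\<in>K. c' \<inter> Y = {}))"

text \<open>A tree is stored in an array: clause \<open>b\<close> occupies \<open>d\<close> consecutive cells after the cell
  \<open>root\<close>, and the address of its literal number \<open>x\<close> serves as the identifier of the child node that
  belongs to this petal and literal.\<close>

definition adr :: "nat \<Rightarrow> nat \<Rightarrow> nat \<Rightarrow> nat \<Rightarrow> nat" where
  "adr d root b x = root + 1 + b * d + x"

lemma adr_inject:
  assumes "x < d" "x' < d" "adr d root b x = adr d root b' x'"
  shows "b = b' \<and> x = x'"
proof -
  have eq: "b * d + x = b' * d + x'" using assms(3) by (simp add: adr_def)
  have "b = (b * d + x) div d" "b' = (b' * d + x') div d" using assms(1,2) by simp_all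
  with eq show ?thesis by auto
qed

lemma adr_cover:
  assumes "root < a" "a < root + 1 + q * d"
  obtains b x where "b < q" "x < d" "a = adr d root b x"
proof
  have "d > 0" using assms by (cases d) auto
  then show "(a - root - 1) mod d < d" by simp
  have "a - root - 1 < q * d" using assms by auto
  then show "(a - root - 1) div d < q" by (simp add: less_mult_imp_div_less)
  show "a = adr d root ((a - root - 1) div d) ((a - root - 1) mod d)"
    using assms(1) by (simp add: adr_def)
qed

lemma adr_less:
  assumes "b < b'" "x < d"
  shows "adr d root b x < adr d root b' x'"
proof -
  have "b * d + x < Suc b * d" using assms(2) by simp
  also have "\<dots> \<le> b' * d" using assms(1) by (intro mult_le_mono1) simp
  finally show ?thesis by (simp add: adr_def)
qed

lemma adr_bound:
  assumes "b < q" "x < d"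
  shows "adr d root b x < root + 1 + q * d"
  using adr_less[OF assms, of root 0] by (simp add: adr_def)

lemma le_fact_power: "m \<le> fact r * m ^ Suc r" for m :: nat
proof (cases m)
  case (Suc m')
  then have "1 \<le> fact r * m ^ r" by (simp add: Suc_le_eq)
  then have "m * 1 \<le> m * (fact r * m ^ r)" by (rule mult_le_mono2)
  then show ?thesis by (simp add: algebra_simps)
qed simp

text \<open>\<open>K\<close> lists the kept clauses in the order of insertion, \<open>N\<close> the nodes whose petals they are.\<close>

locale petal_tree =
  fixes d m root :: nat and K :: "'a list list" and N :: "nat list" and core :: "nat \<Rightarrow> 'a set"
  assumes len: "length N = length K"
    and core_root: "core root = {}"
    and clause: "b < length K \<Longrightarrow> length (K ! b) = d \<and> distinct (K ! b)"
    and core_sub: "b < length K \<Longrightarrow> core (N ! b) \<subseteq> set (K ! b)"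
    and core_adr: "b < length K \<Longrightarrow> x < d \<Longrightarrow>
      core (adr d root b x) = insert (K ! b ! x) (core (N ! b))"
    and node: "b < length K \<Longrightarrow> N ! b = root \<or>
      (\<exists>b'<b. \<exists>x<d. N ! b = adr d root b' x \<and> K ! b' ! x \<notin> core (N ! b'))"
    and petals: "b < length K \<Longrightarrow> b' < length K \<Longrightarrow> b \<noteq> b' \<Longrightarrow> N ! b = N ! b' \<Longrightarrow>
      set (K ! b) \<inter> set (K ! b') \<subseteq> core (N ! b)"
    and few: "card {b. b < length K \<and> N ! b = i} \<le> m"
    and dist: "distinct (map set K)"
begin

text \<open>A node other than the root is named by a cell of an earlier clause, and addresses grow
  with the index of the clause. So a node precedes all cells of its petals, which is why one forward
  pass can follow the whole descent.\<close>

lemma node_bounds: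
  assumes "b < length K"
  shows "root \<le> N ! b \<and> N ! b < adr d root b x"
proof (cases "N ! b = root")
  case True then show ?thesis by (simp add: adr_def)
next
  case False
  then obtain b' y where "b' < b" "y < d" "N ! b = adr d root b' y" using node[OF assms] by auto
  then show ?thesis using adr_less[of b' b y d root x] by (simp add: adr_def)
qed

text \<open>If every petal at \<open>i\<close> met \<open>Y\<close>, picking a common literal for
  each would be injective: two petals share core literals only, and \<open>Y\<close> avoids the
  core. Then \<open>Y\<close> would have at least m elements.\<close>

lemma full_node:
  assumes "m \<le> card {b. b < length K \<and> N ! b = i}" "finite Y" "card Y < m" "core i \<inter> Y = {}"
  shows "\<exists>b<length K. set (K ! b) \<inter> Y = {}"
proof (rule ccontr)
  assume *: "\<not> ?thesis"
  let ?B = "{b. b < length K \<and> N ! b = i}"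
  have "\<forall>b\<in>?B. \<exists>y. y \<in> set (K ! b) \<inter> Y" using * by auto
  then obtain f where f: "\<And>b. b \<in> ?B \<Longrightarrow> f b \<in> set (K ! b) \<inter> Y" by metis
  have "inj_on f ?B"
  proof (rule inj_onI, rule ccontr)
    fix b b' assume b: "b \<in> ?B" "b' \<in> ?B" "f b = f b'" "b \<noteq> b'"
    then have "f b \<in> core i" using f[OF b(1)] f[OF b(2)] petals[of b b'] by auto
    then show False using f[OF b(1)] assms(4) by auto
  qed
  moreover have "f ` ?B \<subseteq> Y" using f by auto
  ultimately have "card ?B \<le> card Y" using assms(2) by (rule card_inj_on_le)
  then show False using assms by simp
qed

section \<open>Counting the clauses of a subtree\<close>

inductive below :: "nat \<Rightarrow> nat \<Rightarrow> bool" where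
  own: "b < length K \<Longrightarrow> N ! b = i \<Longrightarrow> below i b"
| child: "b' < length K \<Longrightarrow> N ! b' = i \<Longrightarrow> x < d \<Longrightarrow> K ! b' ! x \<notin> core i \<Longrightarrow>
    below (adr d root b' x) b \<Longrightarrow> below i b"

lemma below_less: "below i b \<Longrightarrow> b < length K"
  by (induction rule: below.induct) auto

text \<open>The rules of \<open>below\<close> prepend a step at the top, as the recurrence for
  subtree sizes requires. Reaching a clause from the root requires a step appended at the
  bottom.\<close>

lemma below_child:
  "below i b' \<Longrightarrow> b < length K \<Longrightarrow> x < d \<Longrightarrow> N ! b = adr d root b' x \<Longrightarrow>
    K ! b' ! x \<notin> core (N ! b') \<Longrightarrow> below i b"
proof (induction rule: below.induct)
  case (own b' i)
  have "below (N ! b) b" using own(3) by (rule below.own) simp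
  then show ?case using own below.child[of b' i x b] by simp
next
  case (child b'' i x' b')
  then show ?case using below.child[of b'' i x' b] by simp
qed

lemma below_root: "b < length K \<Longrightarrow> below root b"
proof (induction b rule: less_induct)
  case (less b)
  from node[OF less.prems] show ?case
  proof
    assume "N ! b = root" then show ?thesis using less.prems by (metis below.own)
  next
    assume "\<exists>b'<b. \<exists>x<d. N ! b = adr d root b' x \<and> K ! b' ! x \<notin> core (N ! b')"
    then obtain b' x where *: "b' < b" "x < d" "N ! b = adr d root b' x" "K ! b' ! x \<notin> core (N ! b')"
      by blast
    then have "below root b'" using less by simp
    then show ?thesis using less.prems *(2-4) by (rule below_child)
  qed
qed

lemma core_child:
  assumes "b < length K" "x < d" "K ! b ! x \<notin> core (N ! b)"
  shows "finite (core (N ! b))" "core (adr d root b x) \<subseteq> set (K ! b)"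
    "card (core (adr d root b x)) = Suc (card (core (N ! b)))"
proof -
  show fin: "finite (core (N ! b))" using core_sub[OF assms(1)] finite_subset by blast
  show "core (adr d root b x) \<subseteq> set (K ! b)"
    using core_adr[OF assms(1,2)] core_sub[OF assms(1)] clause[OF assms(1)] assms(2) by auto
  show "card (core (adr d root b x)) = Suc (card (core (N ! b)))"
    using core_adr[OF assms(1,2)] assms(3) fin by simp
qed

lemma card_free_positions:
  assumes "b < length K" "card (core (N ! b)) + r = d"
  shows "card {x. x < d \<and> K ! b ! x \<notin> core (N ! b)} = r"
proof -
  let ?P = "{x. x < d \<and> K ! b ! x \<notin> core (N ! b)}"
  have inj: "inj_on (\<lambda>x. K ! b ! x) ?P"
    using clause[OF assms(1)] by (intro inj_on_nth) simp_all
  have image: "(\<lambda>x. K ! b ! x) ` ?P = set (K ! b) - core (N ! b)"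
    using clause[OF assms(1)] unfolding set_conv_nth by blast
  have "card ?P = card (set (K ! b) - core (N ! b))"
    using card_image[OF inj] unfolding image by (rule sym)
  also have "\<dots> = card (set (K ! b)) - card (core (N ! b))"
    using core_sub[OF assms(1)] by (intro card_Diff_subset) (auto intro: finite_subset)
  also have "card (set (K ! b)) = d" using clause[OF assms(1)] by (simp add: distinct_card)
  finally show ?thesis unfolding assms(2)[symmetric] by simp
qed

text \<open>A petal over a core of size d - (r + 1) leaves exactly r + 1 literals to branch on. The
  number \<open>c\<close> of petals is a parameter because the root is later counted with m - 1
  instead of m.\<close>

lemma card_below_step:
  assumes "card (core i) + Suc r = d" "card {b. b < length K \<and> N ! b = i} \<le> c"
    and T: "\<And>b x. b < length K \<Longrightarrow> N ! b = i \<Longrightarrow> x < d \<Longrightarrow> K ! b ! x \<notin> core i \<Longrightarrow>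
      card {b'. below (adr d root b x) b'} \<le> T"
  shows "card {b. below i b} \<le> c + c * Suc r * T"
proof -
  let ?B = "{b. b < length K \<and> N ! b = i}"
  let ?P = "\<lambda>b. {x. x < d \<and> K ! b ! x \<notin> core i}"
  let ?U = "\<Union>b\<in>?B. \<Union>x\<in>?P b. {b'. below (adr d root b x) b'}"
  have "{b. below i b} \<subseteq> ?B \<union> ?U"
  proof
    fix b assume "b \<in> {b. below i b}"
    then have "below i b" by simp
    then show "b \<in> ?B \<union> ?U" by cases auto
  qed
  moreover have "?B \<union> ?U \<subseteq> {..<length K}" using below_less by auto
  then have "finite (?B \<union> ?U)" by (rule finite_subset) simp
  ultimately have "card {b. below i b} \<le> card (?B \<union> ?U)" by (rule card_mono[rotated])
  also have "\<dots> \<le> card ?B + card ?U" by (rule card_Un_le)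
  also have "card ?U \<le> (\<Sum>b\<in>?B. card (\<Union>x\<in>?P b. {b'. below (adr d root b x) b'}))"
    by (rule card_UN_le) simp
  also have "\<dots> \<le> (\<Sum>b\<in>?B. \<Sum>x\<in>?P b. card {b'. below (adr d root b x) b'})"
    by (intro sum_mono card_UN_le) simp
  also have "\<dots> \<le> (\<Sum>b\<in>?B. \<Sum>x\<in>?P b. T)" using T by (intro sum_mono) auto
  also have "\<dots> = (\<Sum>b\<in>?B. Suc r * T)"
    using card_free_positions[of _ "Suc r"] assms(1) by (intro sum.cong) auto
  also have "\<dots> = card ?B * (Suc r * T)" by simp
  also have "\<dots> \<le> c * (Suc r * T)" using assms(2) by (intro mult_le_mono1)
  finally show ?thesis using assms(2) by (simp add: algebra_simps)
qed

text \<open>With \<open>T r\<close> for the largest subtree below a core of size \<open>d - r\<close>, the recurrence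
  \<open>T (r + 1) \<le> m + m * (r + 1) * T r\<close> only yields a bound of the form \<open>T r \<le> fact r * m ^ r\<close> after
  multiplication by \<open>(m - 1) / m\<close>.\<close>

lemma card_below:
  assumes "b < length K" "x < d" "K ! b ! x \<notin> core (N ! b)" "card (core (adr d root b x)) + r = d"
    and "m = Suc m'"
  shows "m' * card {b'. below (adr d root b x) b'} + m \<le> fact r * m ^ Suc r"
  using assms(1-4)
proof (induction r arbitrary: b x)
  case 0
  let ?i = "adr d root b x"
  \<comment> \<open>For r = 0 the core of the child is already the whole petal. A clause stored
    there would have the same literals, hence would be clause \<open>b\<close> itself, but the node
    of \<open>b\<close> lies before its own cells.\<close>
  have ci: "core ?i = set (K ! b)"
    using core_child(2)[OF 0(1-3)] 0 clause[OF 0(1)] by (simp add: card_subset_eq distinct_card)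
  have "\<not> below ?i b'" for b'
  proof
    assume "below ?i b'"
    then have "\<exists>b''<length K. N ! b'' = ?i" by cases auto
    then obtain b'' where b'': "b'' < length K" "N ! b'' = ?i" by blast
    then have "set (K ! b) \<subseteq> set (K ! b'')" using core_sub[OF b''(1)] ci by simp
    then have "set (K ! b) = set (K ! b'')"
      using clause[OF 0(1)] clause[OF b''(1)] by (simp add: card_subset_eq distinct_card)
    then have "b = b''" using dist 0(1) b''(1) by (auto simp: distinct_conv_nth)
    then show False using node_bounds[OF b''(1), of x] b''(2) by simp
  qed
  then show ?case by simp
next
  case (Suc r)
  let ?i = "adr d root b x" let ?f = "fact r :: nat"
  \<comment> \<open>The inserted 0 is the value for a node without petals; the inequality for
    \<open>T\<close> is then \<open>le_fact_power\<close>.\<close>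
  define T where "T = Max (insert 0 ((\<lambda>(b, x). card {b'. below (adr d root b x) b'}) `
     {(b, x). b < length K \<and> N ! b = ?i \<and> x < d \<and> K ! b ! x \<notin> core ?i}))"
  have fin: "finite {(b, x). b < length K \<and> N ! b = ?i \<and> x < d \<and> K ! b ! x \<notin> core ?i}"
    by (rule finite_subset[of _ "{..<length K} \<times> {..<d}"]) auto
  have "m' * T + m \<le> ?f * m ^ Suc r"
  proof -
    have "T = 0 \<or> (\<exists>b x. b < length K \<and> N ! b = ?i \<and> x < d \<and> K ! b ! x \<notin> core ?i \<and>
       T = card {b'. below (adr d root b x) b'})"
      using Max_in[of "insert 0 ((\<lambda>(b, x). card {b'. below (adr d root b x) b'}) `
        {(b, x). b < length K \<and> N ! b = ?i \<and> x < d \<and> K ! b ! x \<notin> core ?i})"] fin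
      unfolding T_def by auto
    then show ?thesis
    proof
      assume "T = 0" then show ?thesis using le_fact_power[of m r] by simp
    next
      assume "\<exists>b x. b < length K \<and> N ! b = ?i \<and> x < d \<and> K ! b ! x \<notin> core ?i \<and>
       T = card {b'. below (adr d root b x) b'}"
      then obtain b' y where *: "b' < length K" "N ! b' = ?i" "y < d" "K ! b' ! y \<notin> core ?i"
        "T = card {b''. below (adr d root b' y) b''}" by blast
      then have "card (core (adr d root b' y)) + r = d"
        using core_child(3)[of b' y] Suc.prems(4) by simp
      then show ?thesis using Suc.IH[of b' y] * by simp
    qed
  qed
  moreover have "card {b'. below ?i b'} \<le> m + m * Suc r * T"
  proof (rule card_below_step[OF Suc.prems(4) few])
    fix b' y assume "b' < length K" "N ! b' = ?i" "y < d" "K ! b' ! y \<notin> core ?i"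
    then show "card {b''. below (adr d root b' y) b''} \<le> T"
      unfolding T_def using fin by (intro Max_ge) auto
  qed
  \<comment> \<open>The induction hypothesis bounds m' T + m rather than m' T, so m (r + 1) m is
    added on both sides. It is at least m' m + m, which absorbs the petals of the node and leaves
    the summand m that the claim needs.\<close>
  ultimately have "m' * card {b'. below ?i b'} + m * Suc r * m
      \<le> m' * (m + m * Suc r * T) + m * Suc r * m"
    by (intro add_mono mult_le_mono) auto
  also have "\<dots> = m' * m + m * Suc r * (m' * T + m)" by (simp add: algebra_simps)
  also have "\<dots> \<le> m' * m + m * Suc r * (?f * m ^ Suc r)"
    using \<open>m' * T + m \<le> _\<close> by (intro add_mono mult_le_mono) auto
  also have "\<dots> = m' * m + fact (Suc r) * m ^ Suc (Suc r)" by (simp add: algebra_simps)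
  finally have "m' * card {b'. below ?i b'} + m * Suc r * m \<le> m' * m + fact (Suc r) * m ^ Suc (Suc r)" .
  moreover have "m * Suc r * m \<ge> m' * m + m" using assms(5) by (simp add: algebra_simps)
  ultimately show ?case by simp
qed

text \<open>With at most m' = m - 1 petals, the root has at most m' d subtrees, which supplies
  exactly the factor m' carried by \<open>card_below\<close>. The total is at most m' + d (m' T) <=
  m' + d! m^d - d m, and m' < m <= d m.\<close>

lemma length_less:
  assumes "1 \<le> d" "card {b. b < length K \<and> N ! b = root} < m"
  shows "length K < fact d * m ^ d"
proof -
  obtain r where r: "d = Suc r" using assms(1) by (cases d) auto
  obtain m' where m': "m = Suc m'" using assms(2) by (cases m) auto
  let ?f = "fact r :: nat"
  have root_le: "card {b. b < length K \<and> N ! b = root} \<le> m'" using assms(2) m' by simp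
  have T: "m' * card {b'. below (adr d root b x) b'} + m \<le> ?f * m ^ Suc r"
    if "b < length K" "N ! b = root" "x < d" "K ! b ! x \<notin> core root" for b x
    using card_below[of b x r m'] that core_child(3)[of b x] core_root m' r by simp
  have "length K = card {b. below root b}"
    using below_root below_less by (metis Collect_cong card_Collect_less_nat)
  also have "\<dots> < fact d * m ^ d"
  \<comment> \<open>The bound \<open>T\<close> below is a quotient by m'. For m' = 0 the root has no
    petals and the tree is empty.\<close>
  proof (cases "m' = 0")
    case True
    have "{b. below root b} = {}"
    proof -
      have "{b. b < length K \<and> N ! b = root} = {}" using root_le True by (simp add: card_eq_0_iff)
      then have "\<not> (b < length K \<and> N ! b = root)" for b by blast
      then have "\<not> below root b" for b by (auto elim: below.cases)
      then show ?thesis by simp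
    qed
    then show ?thesis using m' by simp
  next
    case False
    define T where "T = (?f * m ^ Suc r - m) div m'"
    have "card {b. below root b} \<le> m' + m' * Suc r * T"
    proof (rule card_below_step)
      fix b x assume "b < length K" "N ! b = root" "x < d" "K ! b ! x \<notin> core root"
      from T[OF this] have "m' * card {b'. below (adr d root b x) b'} \<le> ?f * m ^ Suc r - m" by simp
      then show "card {b'. below (adr d root b x) b'} \<le> T"
        unfolding T_def using False by (simp add: less_eq_div_iff_mult_less_eq mult.commute)
    qed (use core_root r root_le in auto)
    moreover have "m' * T \<le> ?f * m ^ Suc r - m" unfolding T_def by simp
    then have "Suc r * (m' * T) \<le> Suc r * (?f * m ^ Suc r - m)" by (rule mult_le_mono2)
    moreover have "Suc r * (?f * m ^ Suc r - m) = fact d * m ^ d - Suc r * m"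
      using r by (simp add: algebra_simps)
    moreover have "Suc r * m \<ge> m" by simp
    moreover have "Suc r * m \<le> fact d * m ^ d"
    proof -
      have "Suc r * m \<le> Suc r * (?f * m ^ Suc r)"
        using le_fact_power[of m r] by (rule mult_le_mono2)
      then show ?thesis using r by (simp add: algebra_simps)
    qed
    ultimately show ?thesis using m' by (simp add: mult.commute mult.left_commute)
  qed
  finally show ?thesis .
qed

end

section \<open>Inserting a clause into a tree\<close>

context petal_tree
begin

text \<open>The state of an insertion before address \<open>a\<close> is read: \<open>R\<close> is the rest of the clause \<open>c\<close>
  outside the core of the current node.  Petals of a node are stored behind the literal that
  identifies the node, so a single pass over the array suffices.\<close>

definition descent :: "'a list \<Rightarrow> nat \<Rightarrow> nat \<Rightarrow> 'a set \<Rightarrow> bool" where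
  "descent c a cur R \<longleftrightarrow> core cur \<union> R = set c \<and> core cur \<inter> R = {} \<and> root \<le> cur \<and> cur < a \<and>
     (cur = root \<or> (\<exists>b<length K. \<exists>x<d. cur = adr d root b x \<and> K ! b ! x \<notin> core (N ! b))) \<and>
     (\<forall>b<length K. \<forall>x<d. N ! b = cur \<and> adr d root b x < a \<longrightarrow> K ! b ! x \<notin> R)"

lemma descent_start: "descent c (Suc root) root (set c)"
  by (auto simp: descent_def core_root adr_def)

lemma descent_miss:
  assumes "descent c (adr d root b x) cur R" "b < length K" "x < d"
    and "\<not> (N ! b = cur \<and> K ! b ! x \<in> R)"
  shows "descent c (Suc (adr d root b x)) cur R"
proof -
  have "K ! b' ! x' \<notin> R"
    if "b' < length K" "x' < d" "N ! b' = cur" "adr d root b' x' < Suc (adr d root b x)" for b' x'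
  proof (cases "adr d root b' x' = adr d root b x")
    case True
    then show ?thesis using adr_inject[OF that(2) assms(3)] assms(4) that by auto
  next
    case False
    then show ?thesis using assms(1) that unfolding descent_def by auto
  qed
  then show ?thesis using assms(1) unfolding descent_def by auto
qed

text \<open>The child is named by the address just read, and by \<open>node_bounds\<close> its
  petals lie behind that address. So no petal of the new node has been passed over, and nothing has
  to be read again.\<close>

lemma descent_hit:
  assumes "descent c (adr d root b x) cur R" "b < length K" "x < d"
    and "N ! b = cur" "K ! b ! x \<in> R"
  shows "descent c (Suc (adr d root b x)) (adr d root b x) (R - {K ! b ! x})"
proof -
  let ?a = "adr d root b x"
  have c: "core ?a = insert (K ! b ! x) (core cur)" using core_adr[OF assms(2,3)] assms(4) by simp
  have 1: "core ?a \<union> (R - {K ! b ! x}) = set c" "core ?a \<inter> (R - {K ! b ! x}) = {}"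
    using assms(1,5) unfolding descent_def c by auto
  have 2: "K ! b ! x \<notin> core (N ! b)" using assms unfolding descent_def by auto
  have 3: "N ! b' \<noteq> ?a" if "b' < length K" "adr d root b' x' < Suc ?a" for b' x'
    using node_bounds[OF that(1), of x'] that(2) by auto
  show ?thesis unfolding descent_def using 1 2 3 assms(2,3) by (auto simp: adr_def)
qed

text \<open>At the end of the pass every literal of every petal of \<open>cur\<close> has been
  compared with \<open>R\<close>, so these petals meet \<open>c\<close> inside the core only. The
  new clause uses fresh addresses, which leaves the rest of the tree unchanged.\<close>

lemma append_clause:
  assumes des: "descent c (root + 1 + length K * d) cur R"
    and c: "length c = d" "distinct c" "set c \<notin> set ` set K"
    and "card {b. b < length K \<and> N ! b = cur} < m"
  shows "\<exists>core'. petal_tree d m root (K @ [c]) (N @ [cur]) core'"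
proof -
  let ?K = "K @ [c]" and ?N = "N @ [cur]" and ?q = "length K" and ?e = "root + 1 + length K * d"
  \<comment> \<open>The cells of \<open>c\<close> are also the names of its possible children, so
    cores are redefined from \<open>?e\<close> on. All nodes in use, \<open>cur\<close> included,
    lie below \<open>?e\<close>.\<close>
  obtain core' where old: "\<And>i. i < ?e \<Longrightarrow> core' i = core i"
    and new: "\<And>x. core' (adr d root ?q x) = insert (c ! x) (core cur)"
  proof
    let ?core = "\<lambda>i. if ?e \<le> i then insert (c ! (i - ?e)) (core cur) else core i"
    show "?core i = core i" if "i < ?e" for i using that by simp
    show "?core (adr d root ?q x) = insert (c ! x) (core cur)" for x by (simp add: adr_def)
  qed
  have cur: "cur < ?e" "core cur \<subseteq> set c" using des by (auto simp: descent_def)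
  have Nb: "N ! b < ?e" if "b < ?q" for b
  proof -
    have "b * d \<le> ?q * d" using that by (intro mult_le_mono1) simp
    then show ?thesis using node_bounds[OF that, of 0] unfolding adr_def by linarith
  qed
  have disj: "set (K ! b) \<inter> set c \<subseteq> core cur" if "b < ?q" "N ! b = cur" for b
  proof
    fix y assume y: "y \<in> set (K ! b) \<inter> set c"
    have "length (K ! b) = d" using clause[OF that(1)] by simp
    with y obtain x where x: "x < d" "y = K ! b ! x" by (auto simp: in_set_conv_nth)
    have "y \<notin> R" using des that x adr_bound[OF that(1) x(1), of root] unfolding descent_def by auto
    then show "y \<in> core cur" using y des unfolding descent_def by auto
  qed
  have nth: "?K ! b = (if b < ?q then K ! b else c)" "?N ! b = (if b < ?q then N ! b else cur)"
    if "b < Suc ?q" for b using that len by (auto simp: nth_append)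
  have "petal_tree d m root ?K ?N core'"
  proof
    show "length ?N = length ?K" using len by simp
    show "core' root = {}" using core_root old by simp
  next
    fix b assume "b < length ?K"
    then have b: "b < Suc ?q" by simp
    show "length (?K ! b) = d \<and> distinct (?K ! b)" using clause c nth[OF b] by simp
    show "core' (?N ! b) \<subseteq> set (?K ! b)"
      using nth[OF b] core_sub[of b] cur old[OF cur(1)] old[OF Nb] by (cases "b < ?q") simp_all
    show "?N ! b = root \<or> (\<exists>b'<b. \<exists>x<d. ?N ! b = adr d root b' x \<and> ?K ! b' ! x \<notin> core' (?N ! b'))"
    proof (cases "b < ?q")
      case True
      from node[OF True] show ?thesis
      proof
        assume "N ! b = root" then show ?thesis using nth[OF b] True by simp
      next
        assume "\<exists>b'<b. \<exists>x<d. N ! b = adr d root b' x \<and> K ! b' ! x \<notin> core (N ! b')"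
        then obtain b' x where *: "b' < b" "x < d" "N ! b = adr d root b' x"
          "K ! b' ! x \<notin> core (N ! b')" by blast
        then have "b' < ?q" using True by simp
        then have "?N ! b = adr d root b' x \<and> ?K ! b' ! x \<notin> core' (?N ! b')"
          using * True nth[OF b] nth[of b'] old[OF Nb] by simp
        then show ?thesis using * by blast
      qed
    next
      case False
      then have bq: "b = ?q" using b by simp
      have "cur = root \<or> (\<exists>b<?q. \<exists>x<d. cur = adr d root b x \<and> K ! b ! x \<notin> core (N ! b))"
        using des unfolding descent_def by blast
      then show ?thesis
      proof
        assume "cur = root" then show ?thesis using nth[OF b] bq by simp
      next
        assume "\<exists>b<?q. \<exists>x<d. cur = adr d root b x \<and> K ! b ! x \<notin> core (N ! b)"
        then obtain b' x where *: "b' < ?q" "x < d" "cur = adr d root b' x"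
          "K ! b' ! x \<notin> core (N ! b')" by blast
        then have "?N ! b = adr d root b' x \<and> ?K ! b' ! x \<notin> core' (?N ! b')"
          using bq nth[OF b] nth[of b'] old[OF Nb] by simp
        then show ?thesis using * bq by blast
      qed
    qed
    fix b' assume "b' < length ?K" and ne: "b \<noteq> b'" and eq: "?N ! b = ?N ! b'"
    then have b': "b' < Suc ?q" by simp
    show "set (?K ! b) \<inter> set (?K ! b') \<subseteq> core' (?N ! b)"
    proof (cases "b < ?q")
      case bT: True
      then have co: "core' (?N ! b) = core (N ! b)" using nth[OF b] old[OF Nb[OF bT]] by simp
      show ?thesis
      proof (cases "b' < ?q")
        case True then show ?thesis unfolding co using petals[OF bT True ne] eq nth[OF b] nth[OF b'] bT by simp
      next
        case False then show ?thesis unfolding co using disj[OF bT] eq nth[OF b] nth[OF b'] bT by simp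
      qed
    next
      case False
      then have "b' < ?q" using b b' ne by simp
      then show ?thesis using disj[of b'] eq nth[OF b] nth[OF b'] False old[OF cur(1)] by auto
    qed
  next
    fix b x assume "b < length ?K" and x: "x < d"
    then have b: "b < Suc ?q" by simp
    show "core' (adr d root b x) = insert (?K ! b ! x) (core' (?N ! b))"
    proof (cases "b < ?q")
      case True
      then show ?thesis
        using nth[OF b] core_adr[OF True x] old[OF Nb[OF True]] old[OF adr_bound[OF True x]] by simp
    next
      case False
      then have "b = ?q" using b by simp
      then show ?thesis using nth[OF b] old[OF cur(1)] new by simp
    qed
  next
    fix i
    have "{b. b < length ?K \<and> ?N ! b = i} \<subseteq>
      {b. b < ?q \<and> N ! b = i} \<union> (if i = cur then {?q} else {})"
      using nth by (auto split: if_splits)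
    then have "card {b. b < length ?K \<and> ?N ! b = i} \<le>
      card ({b. b < ?q \<and> N ! b = i} \<union> (if i = cur then {?q} else {}))"
      by (intro card_mono) auto
    also have "\<dots> \<le> card {b. b < ?q \<and> N ! b = i} + card (if i = cur then {?q} else {})"
      by (rule card_Un_le)
    also have "\<dots> \<le> m" using assms(5) few[of i] by auto
    finally show "card {b. b < length ?K \<and> ?N ! b = i} \<le> m" .
  next
    show "distinct (map set ?K)" using dist c by simp
  qed
  then show ?thesis by blast
qed

end

lemma petal_tree_Nil: "petal_tree d m root [] [] (\<lambda>_. {})"
  by unfold_locales auto

section \<open>Weakest preconditions\<close>

definition wp :: "com \<Rightarrow> state \<Rightarrow> (nat \<Rightarrow> state \<Rightarrow> bool) \<Rightarrow> bool" where
  "wp P s Q \<longleftrightarrow> (\<exists>t s'. exec P s t s' \<and> Q t s')"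

lemma wp_mono: "wp P s Q \<Longrightarrow> (\<And>t s'. Q t s' \<Longrightarrow> R t s') \<Longrightarrow> wp P s R"
  unfolding wp_def by blast

text \<open>Determinism makes this an equivalence, so it can be used as a rewrite rule that executes
  straight-line code.\<close>

lemma wp_exec: "exec P s t s' \<Longrightarrow> wp P s Q \<longleftrightarrow> Q t s'"
  unfolding wp_def using exec_deterministic by blast

lemmas wp_Assign [simp] = wp_exec [OF exec.Assign]
lemmas wp_Store [simp] = wp_exec [OF exec.Store]

lemma wp_Seq [simp]:
  "wp (Seq P P') s Q \<longleftrightarrow> wp P s (\<lambda>t s'. wp P' s' (\<lambda>t' s''. Q (t + t') s''))"
  unfolding wp_def by (blast intro: exec.Seq elim: exec_SeqE)

lemma exec_IfLess_iff:
  "exec (IfLess e f P P') s t s' \<longleftrightarrow>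
    (\<exists>t'. t = 1 + expr_cost e + expr_cost f + t' \<and>
      exec (if expr_val e s < expr_val f s then P else P') s t' s')"
  (is "?L \<longleftrightarrow> ?R")
proof
  assume ?L then show ?R by (rule exec_IfE) auto
next
  assume ?R
  then obtain t' where t: "t = 1 + expr_cost e + expr_cost f + t'"
    and "exec (if expr_val e s < expr_val f s then P else P') s t' s'" by blast
  then show ?L unfolding t
    by (cases "expr_val e s < expr_val f s") (simp_all only: exec.If_True exec.If_False if_True if_False simp_thms)
qed

lemma wp_IfLess [simp]:
  "wp (IfLess e f P P') s Q \<longleftrightarrow> wp (if expr_val e s < expr_val f s then P else P') s
     (\<lambda>t. Q (1 + expr_cost e + expr_cost f + t))"
  unfolding wp_def exec_IfLess_iff by blast

lemma wp_While:
  assumes "I 0 s"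
    and "\<And>j s. j < N \<Longrightarrow> I j s \<Longrightarrow>
      expr_val e s < expr_val f s \<and> wp P s (\<lambda>t s'. t + (1 + expr_cost e + expr_cost f) \<le> B j \<and> I (Suc j) s')"
    and "\<And>s. I N s \<Longrightarrow> \<not> expr_val e s < expr_val f s"
  shows "wp (WhileLess e f P) s (\<lambda>t s'. t \<le> (\<Sum>j<N. B j) + (1 + expr_cost e + expr_cost f) \<and> I N s')"
proof -
  have "\<exists>t s'. exec (WhileLess e f P) s t s' \<and>
      t \<le> (\<Sum>j\<in>{j..<N}. B j) + (1 + expr_cost e + expr_cost f) \<and> I N s'"
    if "j \<le> N" "I j s" for j s
    using that
  proof (induction j arbitrary: s rule: inc_induct)
    case base
    then show ?case using exec.While_False[of e s f P] assms(3) by fastforce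
  next
    case (step j)
    from assms(2)[OF step(2,4)] obtain t s' where
      *: "expr_val e s < expr_val f s" "exec P s t s'" "t + (1 + expr_cost e + expr_cost f) \<le> B j"
        "I (Suc j) s'" unfolding wp_def by blast
    from step.IH[OF *(4)] obtain t' s'' where
      **: "exec (WhileLess e f P) s' t' s''" "I N s''"
        "t' \<le> (\<Sum>j\<in>{Suc j..<N}. B j) + (1 + expr_cost e + expr_cost f)" by blast
    have "(\<Sum>j\<in>{j..<N}. B j) = B j + (\<Sum>j\<in>{Suc j..<N}. B j)"
      using step(2) by (simp add: sum.atLeast_Suc_lessThan)
    then show ?case using exec.While_True[OF *(1,2) **(1)] * ** by fastforce
  qed
  from this[of 0 s] assms(1) show ?thesis unfolding wp_def by (simp add: lessThan_atLeast0)
qed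

section \<open>The kernelization program\<close>

text \<open>
  Registers: 0 output length, 1 \<open>k\<close>, 2 \<open>d\<close>, 3 number of vertices, 4 \<open>m\<close>, 5 \<open>D\<close>, 6--9 auxiliary,
  10 first free address, 11 time stamp of the marks, 12 current part, 13 and 14 root and end of the
  part that replaces the free parts, 15 current root, 16 address of the current vertex in the input,
  17 number of vertices read, 18 current node, 19 read position, 20 number of vertices written,
  21 end of the range to be copied.

  Arrays: 0 input and output, 1 literals of the kept clauses, 2 their nodes, 3 number of petals of
  each node, 4 marks of the literals outside the core (marked if equal to the time stamp, so that
  marks need not be cleared), 5 and 6 root and end of the tree of each part.
\<close>

abbreviation (input) skip :: com where "skip \<equiv> Assign 9 (Num 0)"

text \<open>Register 16 points at the part index of the vertex and the literals start one cell
  later, so the counter is increased before the access.\<close>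

definition mark_clause :: com where
  "mark_clause = WhileLess (Reg 6) (Reg 2)
     (Seq (Assign 6 (Plus (Reg 6) (Num 1)))
          (Store 4 (Arr 0 (Plus (Reg 16) (Reg 6))) (Reg 11)))"

lemma wp_mark_clause:
  assumes "fst s 6 = 0"
  shows "wp mark_clause s (\<lambda>t s'. t \<le> 14 * fst s 2 + 3 \<and> s' = ((fst s)(6 := fst s 2),
    (snd s)(4 := \<lambda>y. if \<exists>x<fst s 2. y = snd s 0 (fst s 16 + 1 + x) then fst s 11 else snd s 4 y)))"
proof -
  define I where "I = (\<lambda>j s'. s' = ((fst s)(6 := j),
    (snd s)(4 := \<lambda>y. if \<exists>x<j. y = snd s 0 (fst s 16 + 1 + x) then fst s 11 else snd s 4 y)))"
  have "wp mark_clause s (\<lambda>t s'. t \<le> (\<Sum>j<fst s 2. 14) + (1 + expr_cost (Reg 6) + expr_cost (Reg 2))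
      \<and> I (fst s 2) s')"
    unfolding mark_clause_def
  proof (rule wp_While)
    have "(fst s)(6 := 0) = fst s" using assms by (simp add: fun_upd_idem)
    then show "I 0 s" by (simp add: I_def)
  next
    fix j s' assume "j < fst s 2" "I j s'"
    then show "expr_val (Reg 6) s' < expr_val (Reg 2) s' \<and>
      wp (Seq (Assign 6 (Plus (Reg 6) (Num 1))) (Store 4 (Arr 0 (Plus (Reg 16) (Reg 6))) (Reg 11))) s'
       (\<lambda>t s''. t + (1 + expr_cost (Reg 6) + expr_cost (Reg 2)) \<le> 14 \<and> I (Suc j) s'')"
      by (auto simp: I_def fun_eq_iff less_Suc_eq)
  qed (simp add: I_def)
  then show ?thesis by (rule wp_mono) (simp add: I_def)
qed

text \<open>The node is stored beside each of the d literals instead of once per clause, since the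
  machine cannot divide an address by d to find its clause.\<close>

definition append_clause :: com where
  "append_clause = WhileLess (Reg 6) (Reg 2)
     (Seq (Assign 6 (Plus (Reg 6) (Num 1)))
     (Seq (Store 1 (Reg 10) (Arr 0 (Plus (Reg 16) (Reg 6))))
     (Seq (Store 2 (Reg 10) (Reg 18))
          (Assign 10 (Plus (Reg 10) (Num 1))))))"

lemma wp_append_clause:
  assumes "fst s 6 = 0"
  defines "e \<equiv> fst s 10"
  shows "wp append_clause s (\<lambda>t s'. t \<le> 20 * fst s 2 + 3 \<and>
    s' = ((fst s)(6 := fst s 2, 10 := e + fst s 2),
    (snd s)(1 := \<lambda>a. if e \<le> a \<and> a < e + fst s 2 then snd s 0 (fst s 16 + 1 + (a - e)) else snd s 1 a,
            2 := \<lambda>a. if e \<le> a \<and> a < e + fst s 2 then fst s 18 else snd s 2 a)))"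
proof -
  define I where "I = (\<lambda>j s'. s' = ((fst s)(6 := j, 10 := e + j),
    (snd s)(1 := \<lambda>a. if e \<le> a \<and> a < e + j then snd s 0 (fst s 16 + 1 + (a - e)) else snd s 1 a,
            2 := \<lambda>a. if e \<le> a \<and> a < e + j then fst s 18 else snd s 2 a)))"
  have "wp append_clause s (\<lambda>t s'. t \<le> (\<Sum>j<fst s 2. 20) + (1 + expr_cost (Reg 6) + expr_cost (Reg 2))
      \<and> I (fst s 2) s')"
    unfolding append_clause_def
  proof (rule wp_While)
    show "I 0 s" using assms by (auto simp: I_def prod_eq_iff fun_eq_iff)
  next
    fix j s' assume "j < fst s 2" "I j s'"
    then show "expr_val (Reg 6) s' < expr_val (Reg 2) s' \<and>
      wp (Seq (Assign 6 (Plus (Reg 6) (Num 1)))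
         (Seq (Store 1 (Reg 10) (Arr 0 (Plus (Reg 16) (Reg 6))))
         (Seq (Store 2 (Reg 10) (Reg 18)) (Assign 10 (Plus (Reg 10) (Num 1)))))) s'
       (\<lambda>t s''. t + (1 + expr_cost (Reg 6) + expr_cost (Reg 2)) \<le> 20 \<and> I (Suc j) s'')"
      by (auto simp: I_def fun_eq_iff less_Suc_eq)
  qed (simp add: I_def)
  then show ?thesis by (rule wp_mono) (simp add: I_def)
qed

text \<open>The first two tests together express equality of the stored node with the current one.
  No mark exceeds the time stamp, so the third test detects unmarked literals. Stamps are positive,
  so storing 0 removes a mark: the literal moves into the core, and the marks keep describing the
  rest \<open>R\<close> of the clause.\<close>

definition descend :: com where
  "descend = WhileLess (Reg 19) (Reg 10)
     (Seq (IfLess (Arr 2 (Reg 19)) (Reg 18) skip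
          (IfLess (Reg 18) (Arr 2 (Reg 19)) skip
          (IfLess (Arr 4 (Arr 1 (Reg 19))) (Reg 11) skip
            (Seq (Assign 18 (Reg 19)) (Store 4 (Arr 1 (Reg 19)) (Num 0))))))
          (Assign 19 (Plus (Reg 19) (Num 1))))"

lemma (in petal_tree) wp_descend:
  fixes s :: state and c :: "'a list" and code :: "'a \<Rightarrow> nat"
  assumes "inj code"
  assumes mem: "\<And>b x. b < length K \<Longrightarrow> x < d \<Longrightarrow>
      snd s 1 (adr d root b x) = code (K ! b ! x) \<and> snd s 2 (adr d root b x) = N ! b"
    and regs: "fst s 10 = root + 1 + length K * d" "fst s 18 = root" "fst s 19 = root + 1"
    and marks: "\<And>y. snd s 4 y \<le> fst s 11" "0 < fst s 11"
      "{y. snd s 4 y = fst s 11} = code ` set c"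
  shows "wp descend s (\<lambda>t s'. t \<le> 30 * (length K * d) + 3 \<and>
    (\<exists>x9 cur M. s' = ((fst s)(9 := x9, 18 := cur, 19 := root + 1 + length K * d), (snd s)(4 := M)) \<and>
      (\<forall>y. M y \<le> fst s 11) \<and> (\<exists>R. descent c (root + 1 + length K * d) cur R)))"
proof -
  define I where "I = (\<lambda>j s'. \<exists>x9 cur M R.
     s' = ((fst s)(9 := x9, 18 := cur, 19 := root + 1 + j), (snd s)(4 := M)) \<and>
      (\<forall>y. M y \<le> fst s 11) \<and> {y. M y = fst s 11} = code ` R \<and> descent c (root + 1 + j) cur R)"
  have "wp descend s (\<lambda>t s'. t \<le> (\<Sum>j<length K * d. 30) + (1 + expr_cost (Reg 19) + expr_cost (Reg 10))
      \<and> I (length K * d) s')"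
    unfolding descend_def
  proof (rule wp_While)
    have "s = ((fst s)(9 := fst s 9, 18 := root, 19 := root + 1 + 0), (snd s)(4 := snd s 4))"
      using regs by (simp add: prod_eq_iff fun_eq_iff)
    moreover have "descent c (root + 1 + 0) root (set c)" using descent_start by simp
    ultimately show "I 0 s" unfolding I_def using marks by blast
  next
    fix j s' assume j: "j < length K * d" and "I j s'"
    then obtain x9 cur M R where
      s': "s' = ((fst s)(9 := x9, 18 := cur, 19 := root + 1 + j), (snd s)(4 := M))"
      and M: "\<forall>y. M y \<le> fst s 11" "{y. M y = fst s 11} = code ` R"
      and des: "descent c (root + 1 + j) cur R" unfolding I_def by blast
    obtain b x where bx: "b < length K" "x < d" "root + 1 + j = adr d root b x"
      using adr_cover[of root "root + 1 + j" "length K" d] j by auto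
    let ?l = "K ! b ! x"
    have m: "snd s 1 (adr d root b x) = code ?l" "snd s 2 (adr d root b x) = N ! b"
      using mem[OF bx(1,2)] by auto
    have mark: "M (code ?l) < fst s 11 \<longleftrightarrow> ?l \<notin> R"
    proof -
      have "M (code ?l) = fst s 11 \<longleftrightarrow> code ?l \<in> code ` R" using M(2) by blast
      also have "\<dots> \<longleftrightarrow> ?l \<in> R" using \<open>inj code\<close> by (rule inj_image_mem_iff)
      finally show ?thesis using M(1) by (auto simp: less_le)
    qed
    have sj: "root + 1 + Suc j = Suc (adr d root b x)" using bx(3) by simp
    have miss: "I (Suc j) ((fst s)(9 := x9', 18 := cur, 19 := root + 1 + Suc j), (snd s)(4 := M))"
      if "\<not> (N ! b = cur \<and> ?l \<in> R)" for x9'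
      using descent_miss[OF des[unfolded bx(3)] bx(1,2) that] M unfolding I_def sj by blast
    have hit: "I (Suc j) ((fst s)(9 := x9, 18 := adr d root b x, 19 := root + 1 + Suc j),
        (snd s)(4 := M(code ?l := 0)))" if "N ! b = cur" "?l \<in> R"
    proof -
      have "{y. (M(code ?l := 0)) y = fst s 11} = code ` (R - {?l})"
        using M marks(2) \<open>inj code\<close> that by (auto simp: inj_def set_eq_iff image_iff)
      moreover have "\<forall>y. (M(code ?l := 0)) y \<le> fst s 11" using M by simp
      ultimately show ?thesis using descent_hit[OF des[unfolded bx(3)] bx(1,2) that]
        unfolding I_def sj by blast
    qed
    have upd: "f(18 := u, 9 := v) = f(9 := v, 18 := u)" for f :: "nat \<Rightarrow> nat" and u v
      by (rule fun_upd_twist) simp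
    show "expr_val (Reg 19) s' < expr_val (Reg 10) s' \<and>
      wp (Seq (IfLess (Arr 2 (Reg 19)) (Reg 18) skip
          (IfLess (Reg 18) (Arr 2 (Reg 19)) skip
          (IfLess (Arr 4 (Arr 1 (Reg 19))) (Reg 11) skip
            (Seq (Assign 18 (Reg 19)) (Store 4 (Arr 1 (Reg 19)) (Num 0))))))
          (Assign 19 (Plus (Reg 19) (Num 1)))) s'
       (\<lambda>t s''. t + (1 + expr_cost (Reg 19) + expr_cost (Reg 10)) \<le> 30 \<and> I (Suc j) s'')"
    proof (cases "N ! b = cur \<and> ?l \<in> R")
      case True
      then show ?thesis using regs j m mark hit unfolding s' by (simp add: upd flip: bx(3))
    next
      case False
      then show ?thesis using regs j m mark miss[OF False] unfolding s' by (simp add: upd flip: bx(3))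
    qed
  next
    fix s' assume "I (length K * d) s'" then show "\<not> expr_val (Reg 19) s' < expr_val (Reg 10) s'"
      using regs by (auto simp: I_def)
  qed
  then show ?thesis by (rule wp_mono) (auto simp: I_def)
qed

definition stores :: "nat \<Rightarrow> nat \<Rightarrow> nat \<Rightarrow> nat list list \<Rightarrow> nat list \<Rightarrow> state \<Rightarrow> bool" where
  "stores d m root K N s \<longleftrightarrow>
     (\<exists>core. petal_tree d m root K N core) \<and>
     (\<forall>b<length K. \<forall>x<d. snd s 1 (adr d root b x) = K ! b ! x \<and> snd s 2 (adr d root b x) = N ! b) \<and>
     (\<forall>i\<ge>root. snd s 3 i = card {b. b < length K \<and> N ! b = i}) \<and>
     (\<forall>y. snd s 4 y \<le> fst s 11) \<and>
     fst s 2 = d \<and> fst s 4 = m \<and> fst s 10 = root + 1 + length K * d \<and> fst s 15 = root"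

text \<open>The frame of an insertion. Earlier trees lie below \<open>root\<close>; their literals
  and petal counters must survive, since they are copied and tested later. Array 2 is absent because
  finished trees are not searched again.\<close>

definition same_outside :: "nat \<Rightarrow> state \<Rightarrow> state \<Rightarrow> bool" where
  "same_outside root s s' \<longleftrightarrow>
     (\<forall>r\<in>{0, 1, 2, 3, 4, 5, 12, 13, 14, 15, 16, 17, 20}. fst s' r = fst s r) \<and>
     (\<forall>a\<in>{0, 5, 6}. snd s' a = snd s a) \<and>
     (\<forall>i<root. snd s' 1 i = snd s 1 i \<and> snd s' 3 i = snd s 3 i)"

lemma same_outside_refl: "same_outside root s s"
  by (simp add: same_outside_def)

lemma same_outside_trans: "same_outside root s s' \<Longrightarrow> same_outside root s' s'' \<Longrightarrow> same_outside root s s''"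
  by (simp add: same_outside_def)

definition attach_clause :: com where
  "attach_clause = IfLess (Arr 3 (Reg 18)) (Reg 4)
     (Seq (Store 3 (Reg 18) (Plus (Arr 3 (Reg 18)) (Num 1)))
     (Seq (Assign 6 (Num 0))
          append_clause))
     skip"

text \<open>The first test turns clauses away in constant time once the root is full. So the pass of
  \<open>descend\<close> only runs over trees to which \<open>length_less\<close> applies.\<close>

definition insert_clause :: com where
  "insert_clause = IfLess (Arr 3 (Reg 15)) (Reg 4)
     (Seq (Assign 11 (Plus (Reg 11) (Num 1)))
     (Seq (Assign 6 (Num 0))
     (Seq mark_clause
     (Seq (Assign 18 (Reg 15))
     (Seq (Assign 19 (Plus (Reg 15) (Num 1)))
     (Seq descend
          attach_clause)))))) skip"

lemma wp_insert_clause: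
  assumes st: "stores d m root K N s" and "1 \<le> d" "1 \<le> m"
    and c: "length c = d" "distinct c" "set c \<notin> set ` set K"
      "\<And>x. x < d \<Longrightarrow> snd s 0 (fst s 16 + 1 + x) = c ! x"
  shows "wp insert_clause s (\<lambda>t s'. t \<le> 150 * (d * (fact d * m ^ d)) \<and>
    (\<exists>K' N'. stores d m root K' N' s' \<and> (K' = K \<or> K' = K @ [c]) \<and>
      represents m {set c} (set ` set K') \<and> same_outside root s s'))"
proof -
  obtain core where "petal_tree d m root K N core" using st unfolding stores_def by blast
  then interpret petal_tree d m root K N core .
  have regs: "fst s 2 = d" "fst s 4 = m" "fst s 10 = root + 1 + length K * d" "fst s 15 = root"
    and mem: "\<And>b x. b < length K \<Longrightarrow> x < d \<Longrightarrow>
      snd s 1 (adr d root b x) = K ! b ! x \<and> snd s 2 (adr d root b x) = N ! b"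
    and cnt: "\<And>i. root \<le> i \<Longrightarrow> snd s 3 i = card {b. b < length K \<and> N ! b = i}"
    and marks: "\<And>y. snd s 4 y \<le> fst s 11"
    using st unfolding stores_def by auto
  \<comment> \<open>All costs are multiples of \<open>B\<close>: it dominates d, the constants and,
    while the root is not full, the number of cells read in a descent.\<close>
  define B where "B = d * (fact d * m ^ d)"
  have D: "d \<le> B" "1 \<le> B" using assms(2,3) by (simp_all add: Suc_le_eq B_def)
  \<comment> \<open>A dropped clause contains the core of the full node at which it stopped. So a
    set \<open>Y\<close> that misses the clause misses this core, and \<open>full_node\<close> gives
    a petal that misses \<open>Y\<close>.\<close>
  have rep: "represents m {set c} (set ` set K)"
    if full: "m \<le> card {b. b < length K \<and> N ! b = i}" and sub: "core i \<subseteq> set c" for i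
  proof -
    have "\<exists>c'\<in>set ` set K. c' \<inter> Y = {}" if Y: "finite Y" "card Y < m" "set c \<inter> Y = {}" for Y
    proof -
      have "core i \<inter> Y = {}" using sub Y(3) by blast
      from full_node[OF full Y(1,2) this] show ?thesis by auto
    qed
    then show ?thesis unfolding represents_def by simp
  qed
  have "wp insert_clause s (\<lambda>t s'. t \<le> 150 * B \<and>
    (\<exists>K' N'. stores d m root K' N' s' \<and> (K' = K \<or> K' = K @ [c]) \<and>
      represents m {set c} (set ` set K') \<and> same_outside root s s'))"
    (is ?goal)
  proof (cases "snd s 3 root < m")
    case False
    have "stores d m root K N ((fst s)(9 := 0), snd s)" using st unfolding stores_def by simp
    moreover have "same_outside root s ((fst s)(9 := 0), snd s)" by (simp add: same_outside_def)
    moreover have "represents m {set c} (set ` set K)"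
      using rep[of root] cnt[of root] core_root False by simp
    ultimately show ?goal using False regs D unfolding insert_clause_def by auto
  next
    case True
    have K: "length K * d \<le> B"
    proof -
      have "length K < fact d * m ^ d" using length_less[OF assms(2)] True cnt[of root] by simp
      then have "length K * d \<le> (fact d * m ^ d) * d" by (intro mult_le_mono1) simp
      then show ?thesis by (simp add: mult.commute B_def)
    qed
    define s1 where "s1 = ((fst s)(11 := fst s 11 + 1, 6 := 0), snd s)"
    define s2 where "s2 = ((fst s1)(6 := d, 18 := root, 19 := root + 1), (snd s1)(4 := \<lambda>y. if \<exists>x<d. y = c ! x then fst s1 11 else snd s1 4 y))"
    have marked: "wp mark_clause s1 (\<lambda>t s'. t \<le> 17 * B \<and> s' =
       ((fst s1)(6 := d), (snd s1)(4 := \<lambda>y. if \<exists>x<d. y = c ! x then fst s1 11 else snd s1 4 y)))"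
    proof (rule wp_mono[OF wp_mark_clause])
      show "fst s1 6 = 0" by (simp add: s1_def)
      have "(\<exists>x<d. y = snd s1 0 (fst s1 16 + 1 + x)) \<longleftrightarrow> (\<exists>x<d. y = c ! x)" for y
        using c(4) by (auto simp: s1_def)
      moreover have "fst s1 2 = d" using regs by (simp add: s1_def)
      ultimately show "t \<le> 17 * B \<and> s' =
          ((fst s1)(6 := d), (snd s1)(4 := \<lambda>y. if \<exists>x<d. y = c ! x then fst s1 11 else snd s1 4 y))"
        if "t \<le> 14 * fst s1 2 + 3 \<and> s' = ((fst s1)(6 := fst s1 2),
          (snd s1)(4 := \<lambda>y. if \<exists>x<fst s1 2. y = snd s1 0 (fst s1 16 + 1 + x) then fst s1 11 else snd s1 4 y))"
        for t s' using that D by auto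
    qed
    have descended: "wp descend s2 (\<lambda>t s'. t \<le> 33 * B \<and>
      (\<exists>x9 cur M. s' = ((fst s2)(9 := x9, 18 := cur, 19 := root + 1 + length K * d), (snd s2)(4 := M)) \<and>
        (\<forall>y. M y \<le> fst s2 11) \<and> (\<exists>R. descent c (root + 1 + length K * d) cur R)))"
    proof (rule wp_mono[OF wp_descend[of id]])
      show "{y. snd s2 4 y = fst s2 11} = id ` set c"
        using marks c(1) by (auto simp: s1_def s2_def in_set_conv_nth Suc_n_not_le_n)
           (metis Suc_n_not_le_n)
      show "snd s2 4 y \<le> fst s2 11" for y using marks[of y] by (simp add: s1_def s2_def)
    qed (use mem regs K D in \<open>auto simp: s1_def s2_def\<close>)
    have finish: "wp attach_clause
        ((fst s2)(9 := x9, 18 := cur, 19 := root + 1 + length K * d), (snd s2)(4 := M))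
        (\<lambda>t s'. t \<le> 50 * B \<and>
        (\<exists>K' N'. stores d m root K' N' s' \<and> (K' = K \<or> K' = K @ [c]) \<and>
          represents m {set c} (set ` set K') \<and> same_outside root s s'))"
      (is "wp _ ?s3 ?Q")
      if M: "\<forall>y. M y \<le> fst s2 11" and des: "descent c (root + 1 + length K * d) cur R" for x9 cur M R
    proof (cases "snd s 3 cur < m")
      case False
      have "core cur \<subseteq> set c" "root \<le> cur" using des unfolding descent_def by auto
      then have "represents m {set c} (set ` set K)" using rep[of cur] cnt[of cur] False by simp
      moreover have "stores d m root K N ((fst ?s3)(9 := 0), snd ?s3)"
        using st M unfolding stores_def by (simp add: s1_def s2_def)
      moreover have "same_outside root s ((fst ?s3)(9 := 0), snd ?s3)"
        by (simp add: same_outside_def s1_def s2_def)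
      ultimately show ?thesis using False regs D by (auto simp: attach_clause_def s1_def s2_def)
    next
      case True
      have rc: "root \<le> cur" using des unfolding descent_def by auto
      let ?e = "root + 1 + length K * d"
      define s4 where "s4 = ((fst ?s3)(6 := 0), (snd ?s3)(3 := (snd ?s3 3)(cur := snd ?s3 3 cur + 1)))"
      define s5 where "s5 = ((fst s4)(6 := d, 10 := ?e + d),
         (snd s4)(1 := \<lambda>a. if ?e \<le> a \<and> a < ?e + d then snd s4 0 (fst s4 16 + 1 + (a - ?e)) else snd s4 1 a,
            2 := \<lambda>a. if ?e \<le> a \<and> a < ?e + d then cur else snd s4 2 a))"
      have "wp append_clause s4 (\<lambda>t s'. t \<le> 23 * B \<and> s' = s5)"
      proof (rule wp_mono[OF wp_append_clause])
        show "fst s4 6 = 0" by (simp add: s4_def)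
        have r4: "fst s4 2 = d" "fst s4 10 = ?e" "fst s4 18 = cur" using regs by (simp_all add: s4_def s2_def s1_def)
        then show "t \<le> 23 * B \<and> s' = s5" if "t \<le> 20 * fst s4 2 + 3 \<and>
          s' = ((fst s4)(6 := fst s4 2, 10 := fst s4 10 + fst s4 2),
          (snd s4)(1 := \<lambda>a. if fst s4 10 \<le> a \<and> a < fst s4 10 + fst s4 2 then snd s4 0 (fst s4 16 + 1 + (a - fst s4 10)) else snd s4 1 a,
            2 := \<lambda>a. if fst s4 10 \<le> a \<and> a < fst s4 10 + fst s4 2 then fst s4 18 else snd s4 2 a))" for t s'
          using that D unfolding r4 s5_def by simp
      qed
      then have w: "wp append_clause s4 (\<lambda>t s'. ?Q (20 + t) s')"
      proof (rule wp_mono)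
        fix t s' assume ts: "t \<le> 23 * B \<and> s' = s5"
        have "card {b. b < length K \<and> N ! b = cur} < m" using True cnt[OF rc] by simp
        then obtain core' where tree: "petal_tree d m root (K @ [c]) (N @ [cur]) core'"
          using append_clause[OF des c(1-3)] by blast
        have old: "adr d root b x < ?e" if "b < length K" "x < d" for b x using adr_bound[OF that] .
        have new: "adr d root (length K) x = ?e + x" for x by (simp add: adr_def)
        have "stores d m root (K @ [c]) (N @ [cur]) s5"
          unfolding stores_def
        proof (intro conjI allI impI)
          show "\<exists>core. petal_tree d m root (K @ [c]) (N @ [cur]) core" using tree by blast
          fix b x assume b: "b < length (K @ [c])" and x: "x < d"
          have "snd s5 1 (adr d root b x) = (K @ [c]) ! b ! x \<and> snd s5 2 (adr d root b x) = (N @ [cur]) ! b"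
          proof (cases "b < length K")
            case True
            then show ?thesis
              using mem[OF True x] old[OF True x] len by (simp add: s5_def s4_def s2_def s1_def nth_append)
          next
            case False
            then have "b = length K" using b by simp
            then show ?thesis
              using new x c(4)[OF x] len by (simp add: s5_def s4_def s2_def s1_def nth_append)
          qed
          then show "snd s5 1 (adr d root b x) = (K @ [c]) ! b ! x"
            "snd s5 2 (adr d root b x) = (N @ [cur]) ! b" by simp_all
        next
          fix i assume i: "root \<le> i"
          have "{b. b < length (K @ [c]) \<and> (N @ [cur]) ! b = i} =
            {b. b < length K \<and> N ! b = i} \<union> (if i = cur then {length K} else {})"
            using len by (auto simp: nth_append less_Suc_eq)
          moreover have "{b. b < length K \<and> N ! b = i} \<inter> {length K} = {}" by auto
          ultimately have "card {b. b < length (K @ [c]) \<and> (N @ [cur]) ! b = i} =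
            card {b. b < length K \<and> N ! b = i} + (if i = cur then 1 else 0)"
            by (simp add: card_Un_disjoint)
          then show "snd s5 3 i = card {b. b < length (K @ [c]) \<and> (N @ [cur]) ! b = i}"
            using cnt[OF i] by (auto simp: s5_def s4_def s2_def s1_def)
        qed (use M regs in \<open>simp_all add: s5_def s4_def s2_def s1_def\<close>)
        moreover have "same_outside root s s5"
          using rc by (simp add: same_outside_def s5_def s4_def s2_def s1_def)
        moreover have "represents m {set c} (set ` set (K @ [c]))" by (auto simp: represents_def)
        ultimately show "?Q (20 + t) s'" using ts D by auto
      qed
      have "wp append_clause s4 (\<lambda>t s'. ?Q (14 + t) s')"
        using w by (rule wp_mono) auto
      moreover have "expr_val (Arr 3 (Reg 18)) ?s3 < expr_val (Reg 4) ?s3"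
        using True regs by (simp add: s1_def s2_def)
      ultimately show ?thesis by (simp add: attach_clause_def s4_def) (erule wp_mono, auto)
    qed
    let ?R = "\<lambda>s'. \<exists>K' N'. stores d m root K' N' s' \<and> (K' = K \<or> K' = K @ [c]) \<and>
      represents m {set c} (set ` set K') \<and> same_outside root s s'"
    have rest: "wp descend s2 (\<lambda>t s'. wp attach_clause s' (\<lambda>t' s''. t + t' \<le> 90 * B \<and> ?R s''))"
    proof (rule wp_mono[OF descended], elim conjE exE)
      fix t s' x9 cur M R
      assume t: "t \<le> 33 * B" and s': "s' = ((fst s2)(9 := x9, 18 := cur, 19 := root + 1 + length K * d), (snd s2)(4 := M))"
        and M: "\<forall>y. M y \<le> fst s2 11" and des: "descent c (root + 1 + length K * d) cur R"
      show "wp attach_clause s' (\<lambda>t' s''. t + t' \<le> 90 * B \<and> ?R s'')"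
        unfolding s' using finish[OF M des] by (rule wp_mono) (use t in auto)
    qed
    have "wp mark_clause s1 (\<lambda>t s'. wp descend ((fst s')(18 := fst s' 15, 19 := fst s' 15 + 1), snd s')
        (\<lambda>t' s''. wp attach_clause s'' (\<lambda>u r. 40 + t + t' + u \<le> 150 * B \<and> ?R r)))"
    proof (rule wp_mono[OF marked])
      fix t s' assume ts: "t \<le> 17 * B \<and> s' =
       ((fst s1)(6 := d), (snd s1)(4 := \<lambda>y. if \<exists>x<d. y = c ! x then fst s1 11 else snd s1 4 y))"
      then have "((fst s')(18 := fst s' 15, 19 := fst s' 15 + 1), snd s') = s2"
        using regs by (simp add: s1_def s2_def)
      then show "wp descend ((fst s')(18 := fst s' 15, 19 := fst s' 15 + 1), snd s')
        (\<lambda>t' s''. wp attach_clause s'' (\<lambda>u r. 40 + t + t' + u \<le> 150 * B \<and> ?R r))"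
        using rest by simp (erule wp_mono, erule wp_mono, use ts D in auto)
    qed
    then show ?goal unfolding insert_clause_def using True regs
      by (simp add: s1_def) (erule wp_mono, erule wp_mono, erule wp_mono, auto)
  qed
  then show ?thesis by (simp only: B_def)
qed

text \<open>Equivalently \<open>represents m {{}} H\<close>: the empty clause is a demand that
  nothing can block. This is the property of a free part.\<close>

definition covers :: "nat \<Rightarrow> 'a set set \<Rightarrow> bool" where
  "covers m H \<longleftrightarrow> (\<forall>Y. finite Y \<and> card Y < m \<longrightarrow> (\<exists>c\<in>H. c \<inter> Y = {}))"

definition part_clauses :: "nat \<Rightarrow> (nat \<times> 'a list) list \<Rightarrow> 'a list set" where
  "part_clauses i es = {c. (i, c) \<in> set es}"

text \<open>The second condition is the injectivity of labels on each part. It compares sets,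
  because listing the literals in another order gives the same clause; different parts may share a
  clause.\<close>

definition clause_list :: "nat \<Rightarrow> (nat \<times> 'a list) list \<Rightarrow> bool" where
  "clause_list d es \<longleftrightarrow> (\<forall>(p, c)\<in>set es. length c = d \<and> distinct c) \<and>
     distinct (map (\<lambda>(p, c). (p, set c)) es)"

definition input_mem :: "nat \<Rightarrow> (nat \<times> nat list) list \<Rightarrow> state \<Rightarrow> bool" where
  "input_mem d es s \<longleftrightarrow> fst s 2 = d \<and> fst s 3 = length es \<and>
     (\<forall>v<length es. snd s 0 (3 + v * (d + 1)) = fst (es ! v) \<and>
       (\<forall>x<d. snd s 0 (3 + v * (d + 1) + 1 + x) = snd (es ! v) ! x))"

text \<open>Trees only grow, so a clause that was dropped or kept earlier remains
  represented.\<close>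

lemma represents_mono: "represents m F K \<Longrightarrow> K \<subseteq> K' \<Longrightarrow> represents m F K'"
  unfolding represents_def by (meson subsetD)

lemma represents_insert: "represents m (insert c F) K \<longleftrightarrow> represents m {c} K \<and> represents m F K"
  by (auto simp: represents_def)

lemma part_clauses_take_Suc:
  assumes "v < length es"
  shows "part_clauses i (take (Suc v) es) =
    (if fst (es ! v) = i then insert (snd (es ! v)) (part_clauses i (take v es)) else part_clauses i (take v es))"
  using assms by (cases "es ! v") (auto simp: part_clauses_def take_Suc_conv_app_nth)

lemma clause_list_fresh:
  assumes "clause_list d es" "v < length es" "fst (es ! v) = i"
  shows "set (snd (es ! v)) \<notin> set ` part_clauses i (take v es)"
proof
  assume "set (snd (es ! v)) \<in> set ` part_clauses i (take v es)"
  then obtain c where c: "(i, c) \<in> set (take v es)" "set c = set (snd (es ! v))"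
    by (auto simp: part_clauses_def)
  from c(1) obtain v' where v': "v' < v" "es ! v' = (i, c)" using assms(2)
    by (auto simp: in_set_conv_nth)
  let ?f = "\<lambda>(p, c). (p, set c)"
  have "distinct (map ?f es)" using assms(1) by (simp add: clause_list_def)
  then have inj: "inj_on ((!) (map ?f es)) {..<length es}" by (intro inj_on_nth) auto
  have "map ?f es ! v = map ?f es ! v'"
    using assms c v' by (cases "es ! v") auto
  then have "v = v'" by (rule inj_onD[OF inj]) (use v' assms(2) in auto)
  then show False using v' by simp
qed

text \<open>What is used of a tree after its scan. The last claim says that the counters behind the
  tree are still 0, so the next tree can start there without initialization.\<close>

lemma stores_cases:
  assumes "stores d m root K N s" "1 \<le> d"
  shows "distinct (map set K)" "snd s 3 root < m \<Longrightarrow> length K < fact d * m ^ d"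
    "\<not> snd s 3 root < m \<Longrightarrow> covers m (set ` set K)" "fst s 10 \<le> a \<Longrightarrow> snd s 3 a = 0"
proof -
  obtain core where "petal_tree d m root K N core" using assms unfolding stores_def by blast
  then interpret petal_tree d m root K N core .
  have cnt: "\<And>i. root \<le> i \<Longrightarrow> snd s 3 i = card {b. b < length K \<and> N ! b = i}"
    and e: "fst s 10 = root + 1 + length K * d"
    using assms(1) unfolding stores_def by auto
  show "distinct (map set K)" by (rule dist)
  show "length K < fact d * m ^ d" if "snd s 3 root < m"
    using length_less[OF assms(2)] that cnt by simp
  show "covers m (set ` set K)" if "\<not> snd s 3 root < m"
    unfolding covers_def
  proof (intro allI impI)
    fix Y :: "nat set" assume "finite Y \<and> card Y < m"
    then have "\<exists>b<length K. set (K ! b) \<inter> Y = {}"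
      using full_node[of root Y] that cnt core_root by simp
    then show "\<exists>c\<in>set ` set K. c \<inter> Y = {}" by auto
  qed
  show "snd s 3 a = 0" if a: "fst s 10 \<le> a"
  proof -
    have "N ! b \<noteq> a" if "b < length K" for b
      using node_bounds[OF that, of 0] adr_bound[OF that, of 0 d root] assms(2) a e by simp
    then have "{b. b < length K \<and> N ! b = a} = {}" by auto
    then show ?thesis using cnt[of a] a e by simp
  qed
qed

text \<open>Vertices may come in any order, so the whole input is read again for each part; vertices
  of other parts cost constant time. The pointer advances by d + 1, which avoids a
  multiplication.\<close>

definition scan_part :: com where
  "scan_part = WhileLess (Reg 17) (Reg 3)
     (Seq (Assign 17 (Plus (Reg 17) (Num 1)))
     (Seq (IfLess (Arr 0 (Reg 16)) (Reg 12) skip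
          (IfLess (Reg 12) (Arr 0 (Reg 16)) skip
            insert_clause))
          (Assign 16 (Plus (Plus (Reg 16) (Reg 2)) (Num 1)))))"

lemma wp_scan_part:
  assumes "clause_list d es" "1 \<le> d" "1 \<le> m"
    and "stores d m root [] [] s" "input_mem d es s" "fst s 12 = i" "fst s 16 = 3" "fst s 17 = 0"
  shows "wp scan_part s (\<lambda>t s'.
    t \<le> (\<Sum>v<length es. 30 + (if fst (es ! v) = i then 150 * (d * (fact d * m ^ d)) else 0)) + 3 \<and>
    (\<exists>K N. stores d m root K N s' \<and> set K \<subseteq> part_clauses i es \<and>
      represents m (set ` part_clauses i es) (set ` set K) \<and>
      same_outside root ((fst s)(16 := fst s' 16, 17 := fst s' 17), snd s) s'))"
proof -
  define B where "B = d * (fact d * m ^ d)"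
  \<comment> \<open>The loop itself moves registers 16 and 17. Setting them to their present values
    in the initial state lets the frame condition of an insertion be reused for the scan.\<close>
  define I where "I = (\<lambda>v s'. fst s' 17 = v \<and> fst s' 16 = 3 + v * (d + 1) \<and>
    (\<exists>K N. stores d m root K N s' \<and> set K \<subseteq> part_clauses i (take v es) \<and>
      represents m (set ` part_clauses i (take v es)) (set ` set K) \<and>
      same_outside root ((fst s)(16 := fst s' 16, 17 := fst s' 17), snd s) s'))"
  have "wp scan_part s (\<lambda>t s'.
    t \<le> (\<Sum>v<length es. 30 + (if fst (es ! v) = i then 150 * B else 0)) +
      (1 + expr_cost (Reg 17) + expr_cost (Reg 3)) \<and> I (length es) s')"
    unfolding scan_part_def
  proof (rule wp_While)
    have "same_outside root ((fst s)(16 := fst s 16, 17 := fst s 17), snd s) s"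
      using same_outside_refl[of root s] by simp
    then show "I 0 s" unfolding I_def using assms
      by (auto simp: part_clauses_def represents_def intro!: exI[of _ "[]"])
  next
    fix s' assume I: "I (length es) s'"
    then have "fst s' 3 = length es" using assms(5) by (auto simp: I_def same_outside_def input_mem_def)
    then show "\<not> expr_val (Reg 17) s' < expr_val (Reg 3) s'" using I by (simp add: I_def)
  next
    fix v s' assume v: "v < length es" and I: "I v s'"
    then obtain K N where r: "fst s' 17 = v" "fst s' 16 = 3 + v * (d + 1)"
      and st: "stores d m root K N s'" and K: "set K \<subseteq> part_clauses i (take v es)"
        "represents m (set ` part_clauses i (take v es)) (set ` set K)"
      and so: "same_outside root ((fst s)(16 := fst s' 16, 17 := fst s' 17), snd s) s'"
      unfolding I_def by blast
    have r': "fst s' 2 = d" "fst s' 3 = length es" "fst s' 12 = i"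
      "snd s' 0 (3 + v * (d + 1)) = fst (es ! v)"
      "\<And>x. x < d \<Longrightarrow> snd s' 0 (3 + v * (d + 1) + 1 + x) = snd (es ! v) ! x"
      using so assms(5,6) v by (auto simp: same_outside_def input_mem_def)
    define s1 where "s1 = ((fst s')(17 := Suc v), snd s')"
    have st1: "stores d m root K N s1" using st by (simp add: stores_def s1_def)
    have so1: "same_outside root ((fst s)(16 := fst s' 16, 17 := Suc v), snd s) s1"
      using so by (auto simp: same_outside_def s1_def)
    have next_I: "I (Suc v) ((fst s2)(16 := fst s2 16 + fst s2 2 + 1), snd s2)"
      if s2: "stores d m root K' N' s2" "set K' \<subseteq> part_clauses i (take (Suc v) es)"
        "represents m (set ` part_clauses i (take (Suc v) es)) (set ` set K')"
        "same_outside root s1 s2" for K' N' s2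
    proof -
      have f: "fst s2 16 = 3 + v * (d + 1)" "fst s2 17 = Suc v" "fst s2 2 = d"
        using s2(4) r r' by (simp_all add: same_outside_def s1_def)
      have st2: "stores d m root K' N' ((fst s2)(16 := x), snd s2)" for x
        using s2(1) by (simp add: stores_def)
      have so2: "same_outside root ((fst s)(16 := x, 17 := Suc v), snd s) ((fst s2)(16 := x), snd s2)" for x
        using same_outside_trans[OF so1 s2(4)] by (auto simp: same_outside_def)
      show ?thesis unfolding I_def using st2 so2 s2(2,3) f by auto
    qed
    have so_skip: "same_outside root s1 ((fst s1)(9 := 0), snd s1)" by (simp add: same_outside_def)
    have st_skip: "stores d m root K N ((fst s1)(9 := 0), snd s1)" using st1 by (simp add: stores_def)
    note nI = next_I[OF st_skip _ _ so_skip]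
    have "wp (IfLess (Arr 0 (Reg 16)) (Reg 12) skip (IfLess (Reg 12) (Arr 0 (Reg 16)) skip insert_clause)) s1
      (\<lambda>t s2. t \<le> 10 + (if fst (es ! v) = i then 150 * B else 0) \<and>
        I (Suc v) ((fst s2)(16 := fst s2 16 + fst s2 2 + 1), snd s2))"
    proof (cases "fst (es ! v) = i")
      case False
      then have "I (Suc v) ((fst ((fst s1)(9 := 0), snd s1))(16 := fst ((fst s1)(9 := 0), snd s1) 16 + fst ((fst s1)(9 := 0), snd s1) 2 + 1), snd ((fst s1)(9 := 0), snd s1))"
        using nI part_clauses_take_Suc[OF v, of i] K by simp
      then show ?thesis using False r r' by (auto simp: s1_def)
    next
      case True
      have mem: "(i, snd (es ! v)) \<in> set es" using True v by (metis nth_mem prod.collapse)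
      have "wp insert_clause s1 (\<lambda>t s2. t \<le> 150 * (d * (fact d * m ^ d)) \<and>
        (\<exists>K' N'. stores d m root K' N' s2 \<and> (K' = K \<or> K' = K @ [snd (es ! v)]) \<and>
        represents m {set (snd (es ! v))} (set ` set K') \<and> same_outside root s1 s2))"
      proof (rule wp_insert_clause[OF st1 assms(2,3)])
        show "length (snd (es ! v)) = d" "distinct (snd (es ! v))"
          using assms(1) mem by (auto simp: clause_list_def)
        show "set (snd (es ! v)) \<notin> set ` set K"
          using clause_list_fresh[OF assms(1) v True] K(1) by blast
        show "snd s1 0 (fst s1 16 + 1 + x) = snd (es ! v) ! x" if "x < d" for x
          using r' r that by (simp add: s1_def)
      qed
      then have "wp insert_clause s1 (\<lambda>t s2. t \<le> 150 * B \<and>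
        I (Suc v) ((fst s2)(16 := fst s2 16 + fst s2 2 + 1), snd s2))"
      proof (rule wp_mono, elim conjE exE, intro conjI)
        fix t s2 K' N' assume *: "stores d m root K' N' s2" "K' = K \<or> K' = K @ [snd (es ! v)]"
          "represents m {set (snd (es ! v))} (set ` set K')" "same_outside root s1 s2"
        show "I (Suc v) ((fst s2)(16 := fst s2 16 + fst s2 2 + 1), snd s2)"
        proof (rule next_I[OF *(1) _ _ *(4)])
          show "set K' \<subseteq> part_clauses i (take (Suc v) es)"
            using * K True part_clauses_take_Suc[OF v, of i] by auto
          have "represents m (set ` part_clauses i (take v es)) (set ` set K')"
            by (rule represents_mono[OF K(2)]) (use *(2) in auto)
          with *(3) have "represents m (insert (set (snd (es ! v))) (set ` part_clauses i (take v es))) (set ` set K')"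
            using represents_insert by blast
          then show "represents m (set ` part_clauses i (take (Suc v) es)) (set ` set K')"
            using True part_clauses_take_Suc[OF v, of i] by simp
        qed
      qed (simp add: B_def)
      then show ?thesis using True r r' by (simp add: s1_def) (erule wp_mono, auto)
    qed
    then show "expr_val (Reg 17) s' < expr_val (Reg 3) s' \<and>
      wp (Seq (Assign 17 (Plus (Reg 17) (Num 1)))
         (Seq (IfLess (Arr 0 (Reg 16)) (Reg 12) skip (IfLess (Reg 12) (Arr 0 (Reg 16)) skip insert_clause))
          (Assign 16 (Plus (Plus (Reg 16) (Reg 2)) (Num 1))))) s'
       (\<lambda>t s''. t + (1 + expr_cost (Reg 17) + expr_cost (Reg 3)) \<le> 30 + (if fst (es ! v) = i then 150 * B else 0) \<and> I (Suc v) s'')"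
      using v r r' unfolding wp_Seq wp_Assign
      by (cases "fst (es ! v) = i") (simp add: s1_def del: wp_IfLess, erule wp_mono, simp)+
  qed
  then show ?thesis unfolding B_def[symmetric] by (rule wp_mono) (auto simp: I_def)
qed

section \<open>The trees of all parts\<close>

definition part_done :: "nat \<Rightarrow> nat \<Rightarrow> (nat \<times> nat list) list \<Rightarrow> nat list list \<Rightarrow> nat \<Rightarrow> state \<Rightarrow> bool" where
  "part_done d m es K i s \<longleftrightarrow>
     snd s 6 i = snd s 5 i + 1 + length K * d \<and> snd s 6 i \<le> fst s 10 \<and>
     (\<forall>b<length K. \<forall>x<d. snd s 1 (adr d (snd s 5 i) b x) = K ! b ! x) \<and>
     set K \<subseteq> part_clauses i es \<and> distinct (map set K) \<and>
     (if snd s 3 (snd s 5 i) < m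
      then length K < fact d * m ^ d \<and> represents m (set ` part_clauses i es) (set ` set K)
      else covers m (set ` set K))"

text \<open>The petal counter of the root, compared with m, serves as the flag for free parts.
  Registers 13 and 14 enclose the cells to be copied into free parts: a whole tree that is not free
  or, while all parts are free, just the d cells of the first clause of a tree.\<close>

definition reference :: "nat \<Rightarrow> nat \<Rightarrow> nat \<Rightarrow> state \<Rightarrow> bool" where
  "reference d m i s \<longleftrightarrow> (\<exists>r\<in>{1..i}. fst s 13 = snd s 5 r \<and>
     (snd s 3 (snd s 5 r) < m \<and> fst s 14 = snd s 6 r \<or>
      (\<forall>j\<in>{1..i}. \<not> snd s 3 (snd s 5 j) < m) \<and> fst s 14 = fst s 13 + 1 + d))"

text \<open>Register 14 is 0 until a first part has been processed, as end addresses are positive. A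
  part that is not free always becomes the reference, a free one only if there is none yet.\<close>

definition reduce_parts :: com where
  "reduce_parts = WhileLess (Reg 12) (Reg 1)
     (Seq (Assign 12 (Plus (Reg 12) (Num 1)))
     (Seq (Assign 15 (Reg 10))
     (Seq (Assign 10 (Plus (Reg 10) (Num 1)))
     (Seq (Assign 16 (Num 3))
     (Seq (Assign 17 (Num 0))
     (Seq scan_part
     (Seq (Store 5 (Reg 12) (Reg 15))
     (Seq (Store 6 (Reg 12) (Reg 10))
     (IfLess (Arr 3 (Reg 15)) (Reg 4)
        (Seq (Assign 13 (Reg 15)) (Assign 14 (Reg 10)))
        (IfLess (Num 0) (Reg 14) skip
          (Seq (Assign 13 (Reg 15)) (Assign 14 (Plus (Plus (Reg 15) (Num 1)) (Reg 2))))))))))))))"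

text \<open>Later trees change literals and counters only from the first free address on, which lies
  behind every finished tree.\<close>

lemma part_done_transfer:
  assumes "part_done d m es K i s" "1 \<le> d"
    and "snd s' 5 i = snd s 5 i" "snd s' 6 i = snd s 6 i" "fst s 10 \<le> fst s' 10"
    and "\<And>a. a < fst s 10 \<Longrightarrow> snd s' 1 a = snd s 1 a \<and> snd s' 3 a = snd s 3 a"
  shows "part_done d m es K i s'"
proof -
  have e: "snd s 5 i + 1 + length K * d \<le> fst s 10" using assms(1) by (auto simp: part_done_def)
  have "adr d (snd s 5 i) b x < fst s 10" if "b < length K" "x < d" for b x
    using adr_bound[OF that, of "snd s 5 i"] e by simp
  moreover have "snd s 5 i < fst s 10" using e by simp
  ultimately show ?thesis using assms unfolding part_done_def by (auto split: if_splits)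
qed

lemma wp_reduce_parts:
  assumes "clause_list d es" "1 \<le> d" "1 \<le> m" "1 \<le> k"
    and "input_mem d es s" "fst s 1 = k" "fst s 4 = m"
    and "fst s 10 = 0" "fst s 11 = 0" "fst s 12 = 0" "fst s 14 = 0"
    and "\<And>a. snd s 3 a = 0" "\<And>a. snd s 4 a = 0"
  shows "wp reduce_parts s (\<lambda>t s'.
    t \<le> (\<Sum>i<k. \<Sum>v<length es. 30 + (if fst (es ! v) = Suc i then 150 * (d * (fact d * m ^ d)) else 0)) + 60 * k + 3 \<and>
    (\<exists>K. (\<forall>i\<in>{1..k}. part_done d m es (K i) i s') \<and> reference d m k s') \<and>
    snd s' 0 = snd s 0 \<and> fst s' 1 = k \<and> fst s' 2 = d \<and> fst s' 3 = length es \<and> fst s' 4 = m)"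
proof -
  define T where "T = (\<lambda>i. \<Sum>v<length es. 30 + (if fst (es ! v) = i then 150 * (d * (fact d * m ^ d)) else 0))"
  define I where "I = (\<lambda>i s'. (\<exists>K. \<forall>j\<in>{1..i}. part_done d m es (K j) j s') \<and>
     (if i = 0 then fst s' 14 = 0 else 0 < fst s' 14 \<and> reference d m i s') \<and>
     (\<forall>a\<ge>fst s' 10. snd s' 3 a = 0) \<and> (\<forall>y. snd s' 4 y \<le> fst s' 11) \<and> snd s' 0 = snd s 0 \<and>
     fst s' 1 = k \<and> fst s' 2 = d \<and> fst s' 3 = length es \<and> fst s' 4 = m \<and> fst s' 12 = i)"
  have "wp reduce_parts s (\<lambda>t s'. t \<le> (\<Sum>i<k. T (Suc i) + 60) + (1 + expr_cost (Reg 12) + expr_cost (Reg 1)) \<and> I k s')"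
    unfolding reduce_parts_def
  proof (rule wp_While)
    show "I 0 s" using assms by (simp add: I_def input_mem_def)
  next
    fix s' assume "I k s'" then show "\<not> expr_val (Reg 12) s' < expr_val (Reg 1) s'" by (simp add: I_def)
  next
    fix i s' assume i: "i < k" and I: "I i s'"
    then obtain K where K: "\<forall>j\<in>{1..i}. part_done d m es (K j) j s'"
      and ref: "if i = 0 then fst s' 14 = 0 else 0 < fst s' 14 \<and> reference d m i s'"
      and zero: "\<And>a. fst s' 10 \<le> a \<Longrightarrow> snd s' 3 a = 0" and stamp: "\<And>y. snd s' 4 y \<le> fst s' 11"
      and r: "snd s' 0 = snd s 0" "fst s' 1 = k" "fst s' 2 = d" "fst s' 3 = length es" "fst s' 4 = m" "fst s' 12 = i"
      unfolding I_def by blast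
    define root where "root = fst s' 10"
    define s1 where "s1 = ((fst s')(12 := Suc i, 15 := root, 10 := Suc root, 16 := 3, 17 := 0), snd s')"
    have st: "stores d m root [] [] s1"
      unfolding stores_def using petal_tree_Nil[of d m root] zero stamp r by (auto simp: s1_def root_def)
    have inp: "input_mem d es s1" using assms(5) r by (simp add: input_mem_def s1_def)
    have scanned: "wp scan_part s1 (\<lambda>t s2. t \<le> T (Suc i) + 3 \<and>
      (\<exists>K N. stores d m root K N s2 \<and> set K \<subseteq> part_clauses (Suc i) es \<and>
      represents m (set ` part_clauses (Suc i) es) (set ` set K) \<and>
      same_outside root ((fst s1)(16 := fst s2 16, 17 := fst s2 17), snd s1) s2))"
      unfolding T_def by (rule wp_scan_part[OF assms(1-3) st inp]) (simp_all add: s1_def)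
    have I_next: "I (Suc i) ((fst s2)(9 := x9, 13 := x13, 14 := x14), (snd s2)(5 := (snd s2 5)(Suc i := root), 6 := (snd s2 6)(Suc i := fst s2 10)))"
      (is "I (Suc i) ?s3")
      if K': "stores d m root K' N s2" "set K' \<subseteq> part_clauses (Suc i) es"
        "represents m (set ` part_clauses (Suc i) es) (set ` set K')"
        "same_outside root ((fst s1)(16 := fst s2 16, 17 := fst s2 17), snd s1) s2"
        and x: "if snd s2 3 root < m then x13 = root \<and> x14 = fst s2 10
          else if 0 < fst s2 14 then x13 = fst s2 13 \<and> x14 = fst s2 14
          else x13 = root \<and> x14 = root + 1 + d"
      for s2 K' N x9 x13 x14
    proof -
      have e: "fst s2 10 = root + 1 + length K' * d" using K'(1) unfolding stores_def by blast
      have f: "fst s2 1 = k" "fst s2 2 = d" "fst s2 3 = length es" "fst s2 4 = m" "fst s2 12 = Suc i"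
        "fst s2 13 = fst s' 13" "fst s2 14 = fst s' 14" "snd s2 0 = snd s 0" "snd s2 5 = snd s' 5" "snd s2 6 = snd s' 6"
        "\<And>a. a < root \<Longrightarrow> snd s2 1 a = snd s' 1 a \<and> snd s2 3 a = snd s' 3 a"
        using K'(4) r by (simp_all add: same_outside_def s1_def)
      have old: "part_done d m es (K j) j ?s3" if "j \<in> {1..i}" for j
        using K that f e by (intro part_done_transfer[of d m es "K j" j s' ?s3] assms) (auto simp: root_def)
      have new: "part_done d m es K' (Suc i) ?s3"
        using K'(1-3) stores_cases[OF K'(1) assms(2)] e unfolding part_done_def stores_def by auto
      have parts: "\<forall>j\<in>{1..Suc i}. part_done d m es ((K(Suc i := K')) j) j ?s3"
        using old new by (auto simp: le_Suc_eq)
      have S: "snd s' 5 j < root" if "j \<in> {1..i}" for j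
      proof -
        have "part_done d m es (K j) j s'" using K that by blast
        then show ?thesis unfolding part_done_def root_def by auto
      qed
      have "reference d m (Suc i) ?s3 \<and> 0 < x14"
      proof (cases "snd s2 3 root < m")
        case True
        then show ?thesis using x e unfolding reference_def by (auto intro!: bexI[of _ "Suc i"])
      next
        case nfree: False
        show ?thesis
        proof (cases "i = 0")
          case True
          then have "fst s2 14 = 0" using ref f by simp
          then show ?thesis using x nfree True unfolding reference_def by simp
        next
          case False
          then have r': "reference d m i s'" "0 < fst s' 14" using ref by simp_all
          then obtain q where q: "q \<in> {1..i}" "fst s' 13 = snd s' 5 q"
            "snd s' 3 (snd s' 5 q) < m \<and> fst s' 14 = snd s' 6 q \<or>
              (\<forall>j\<in>{1..i}. \<not> snd s' 3 (snd s' 5 j) < m) \<and> fst s' 14 = fst s' 13 + 1 + d"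
            unfolding reference_def by blast
          have xs: "x13 = fst s' 13" "x14 = fst s' 14" using x nfree f r' by simp_all
          have Sj: "snd ?s3 5 j = snd s' 5 j" "snd ?s3 6 j = snd s' 6 j" "snd ?s3 3 (snd s' 5 j) = snd s' 3 (snd s' 5 j)"
            if "j \<in> {1..i}" for j using f S[OF that] that by auto
          have SS: "snd ?s3 5 (Suc i) = root" "snd ?s3 3 root = snd s2 3 root" by simp_all
          have all: "(\<forall>j\<in>{1..Suc i}. \<not> snd ?s3 3 (snd ?s3 5 j) < m)" if "\<forall>j\<in>{1..i}. \<not> snd s' 3 (snd s' 5 j) < m"
          proof
            fix j assume "j \<in> {1..Suc i}"
            then consider "j \<in> {1..i}" | "j = Suc i" by fastforce
            then show "\<not> snd ?s3 3 (snd ?s3 5 j) < m"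
            proof cases
              case 1 then show ?thesis using that Sj[OF 1] by simp
            next
              case 2 then show ?thesis using nfree by simp
            qed
          qed
          have "q \<in> {1..Suc i}" "fst ?s3 13 = snd ?s3 5 q" using q Sj[OF q(1)] xs by auto
          moreover have "snd ?s3 3 (snd ?s3 5 q) < m \<and> fst ?s3 14 = snd ?s3 6 q \<or>
              (\<forall>j\<in>{1..Suc i}. \<not> snd ?s3 3 (snd ?s3 5 j) < m) \<and> fst ?s3 14 = fst ?s3 13 + 1 + d"
            using q(3)
          proof
            assume "snd s' 3 (snd s' 5 q) < m \<and> fst s' 14 = snd s' 6 q"
            then show ?thesis using Sj[OF q(1)] xs by simp
          next
            assume a: "(\<forall>j\<in>{1..i}. \<not> snd s' 3 (snd s' 5 j) < m) \<and> fst s' 14 = fst s' 13 + 1 + d"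
            then have "fst ?s3 14 = fst ?s3 13 + 1 + d" using xs by simp
            then show ?thesis using all a by blast
          qed
          ultimately have "reference d m (Suc i) ?s3" unfolding reference_def by blast
          then show ?thesis using xs r'(2) by simp
        qed
      qed
      moreover have "\<forall>a\<ge>fst ?s3 10. snd ?s3 3 a = 0" using stores_cases(4)[OF K'(1) assms(2)] by simp
      moreover have "\<forall>y. snd ?s3 4 y \<le> fst ?s3 11" using K'(1) unfolding stores_def by simp
      moreover have "\<exists>K. \<forall>j\<in>{1..Suc i}. part_done d m es (K j) j ?s3" using parts by blast
      ultimately show ?thesis unfolding I_def using f by simp
    qed
    let ?end = "IfLess (Arr 3 (Reg 15)) (Reg 4)
        (Seq (Assign 13 (Reg 15)) (Assign 14 (Reg 10)))
        (IfLess (Num 0) (Reg 14) skip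
          (Seq (Assign 13 (Reg 15)) (Assign 14 (Plus (Plus (Reg 15) (Num 1)) (Reg 2)))))"
    have "wp scan_part s1 (\<lambda>t s2. wp (Seq (Store 5 (Reg 12) (Reg 15)) (Seq (Store 6 (Reg 12) (Reg 10)) ?end)) s2
        (\<lambda>t' s3. t + t' \<le> T (Suc i) + 40 \<and> I (Suc i) s3))"
    proof (rule wp_mono[OF scanned], elim conjE exE)
      fix t s2 K' N assume t: "t \<le> T (Suc i) + 3" and K': "stores d m root K' N s2" "set K' \<subseteq> part_clauses (Suc i) es"
        "represents m (set ` part_clauses (Suc i) es) (set ` set K')"
        "same_outside root ((fst s1)(16 := fst s2 16, 17 := fst s2 17), snd s1) s2"
      have f: "fst s2 2 = d" "fst s2 4 = m" "fst s2 12 = Suc i" "fst s2 15 = root"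
        using K'(4) r by (simp_all add: same_outside_def s1_def)
      note n = I_next[OF K']
      have tw: "g(9 := a, 13 := g 13, 14 := g 14) = g(9 := a)" "g(9 := g 9, 13 := b, 14 := c) = g(13 := b, 14 := c)"
        for g :: "nat \<Rightarrow> nat" and a b c by (auto simp: fun_eq_iff)
      show "wp (Seq (Store 5 (Reg 12) (Reg 15)) (Seq (Store 6 (Reg 12) (Reg 10)) ?end)) s2
        (\<lambda>t' s3. t + t' \<le> T (Suc i) + 40 \<and> I (Suc i) s3)"
      proof (cases "snd s2 3 root < m")
        case True
        then show ?thesis using t f n[of root "fst s2 10" "fst s2 9"] by (simp add: tw)
      next
        case nfree: False
        show ?thesis
        proof (cases "0 < fst s2 14")
          case True
          then show ?thesis using t f nfree n[of "fst s2 13" "fst s2 14" 0] by (simp add: tw)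
        next
          case False
          then show ?thesis using t f nfree n[of root "root + 1 + d" "fst s2 9"] by (simp add: tw)
        qed
      qed
    qed
    then show "expr_val (Reg 12) s' < expr_val (Reg 1) s' \<and>
      wp (Seq (Assign 12 (Plus (Reg 12) (Num 1)))
     (Seq (Assign 15 (Reg 10))
     (Seq (Assign 10 (Plus (Reg 10) (Num 1)))
     (Seq (Assign 16 (Num 3))
     (Seq (Assign 17 (Num 0))
     (Seq scan_part
     (Seq (Store 5 (Reg 12) (Reg 15))
     (Seq (Store 6 (Reg 12) (Reg 10)) ?end)))))))) s'
       (\<lambda>t s''. t + (1 + expr_cost (Reg 12) + expr_cost (Reg 1)) \<le> T (Suc i) + 60 \<and> I (Suc i) s'')"
      using i r by (simp add: s1_def root_def del: wp_IfLess) (erule wp_mono, erule wp_mono, simp)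
  qed
  then show ?thesis by (rule wp_mono) (use \<open>1 \<le> k\<close> in \<open>auto simp: I_def T_def sum.distrib\<close>)
qed

section \<open>Writing the output word\<close>

definition flat :: "(nat \<times> nat list) list \<Rightarrow> nat list" where
  "flat es = concat (map (\<lambda>(p, c). p # c) es)"

lemma flat_simps [simp]:
  "flat [] = []" "flat (e # es) = fst e # snd e @ flat es" "flat (es @ es') = flat es @ flat es'"
  by (simp_all add: flat_def split: prod.split)

lemma length_flat: "\<forall>(p, c)\<in>set es. length c = d \<Longrightarrow> length (flat es) = length es * (d + 1)"
  by (induction es) auto

lemma nth_flat:
  assumes "\<forall>(p, c)\<in>set es. length c = d" "v < length es"
  shows "flat es ! (v * (d + 1)) = fst (es ! v)"
    and "x < d \<Longrightarrow> flat es ! (v * (d + 1) + 1 + x) = snd (es ! v) ! x"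
proof -
  let ?l = "flat (take v es)" and ?e = "es ! v"
  have "es = take v es @ ?e # drop (Suc v) es" using assms(2) by (rule id_take_nth_drop)
  then have "flat es = flat (take v es @ ?e # drop (Suc v) es)" by simp
  then have f: "flat es = ?l @ fst ?e # snd ?e @ flat (drop (Suc v) es)" by simp
  have "length ?l = length (take v es) * (d + 1)"
    using assms(1) by (intro length_flat) (auto dest: in_set_takeD)
  then have l: "length ?l = v * (d + 1)" using assms(2) by simp
  have "?e \<in> set es" using assms(2) by simp
  then have "length (snd ?e) = d" using assms(1) by auto
  then show "flat es ! (v * (d + 1)) = fst ?e"
    and "x < d \<Longrightarrow> flat es ! (v * (d + 1) + 1 + x) = snd ?e ! x"
    unfolding f l[symmetric] by (simp_all add: nth_append)
qed

text \<open>Only a prefix of the array is described, because remains of the input may follow the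
  output.\<close>

definition holds :: "(nat \<Rightarrow> nat) \<Rightarrow> nat list \<Rightarrow> bool" where
  "holds A w \<longleftrightarrow> (\<forall>i<length w. A i = w ! i)"

lemma holds_snoc: "holds A w \<Longrightarrow> holds (A(length w := x)) (w @ [x])"
  by (auto simp: holds_def nth_append less_Suc_eq)

definition copy_clause :: com where
  "copy_clause = WhileLess (Reg 6) (Reg 2)
     (Seq (Store 0 (Reg 0) (Arr 1 (Reg 19)))
     (Seq (Assign 0 (Plus (Reg 0) (Num 1)))
     (Seq (Assign 19 (Plus (Reg 19) (Num 1)))
          (Assign 6 (Plus (Reg 6) (Num 1))))))"

lemma wp_copy_clause:
  assumes "fst s 6 = 0" "length c = fst s 2" "\<And>x. x < fst s 2 \<Longrightarrow> snd s 1 (fst s 19 + x) = c ! x"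
    and "holds (snd s 0) w" "fst s 0 = length w"
  shows "wp copy_clause s (\<lambda>t s'. t \<le> 25 * fst s 2 + 3 \<and>
    (\<exists>A. s' = ((fst s)(0 := length w + fst s 2, 6 := fst s 2, 19 := fst s 19 + fst s 2), (snd s)(0 := A)) \<and>
      holds A (w @ c)))"
proof -
  define I where "I = (\<lambda>j s'. \<exists>A. s' = ((fst s)(0 := length w + j, 6 := j, 19 := fst s 19 + j), (snd s)(0 := A)) \<and>
      holds A (w @ take j c))"
  have "wp copy_clause s (\<lambda>t s'. t \<le> (\<Sum>j<fst s 2. 25) + (1 + expr_cost (Reg 6) + expr_cost (Reg 2)) \<and> I (fst s 2) s')"
    unfolding copy_clause_def
  proof (rule wp_While)
    have "s = ((fst s)(0 := length w + 0, 6 := 0, 19 := fst s 19 + 0), (snd s)(0 := snd s 0))"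
      using assms by (simp add: prod_eq_iff fun_eq_iff)
    moreover have "holds (snd s 0) (w @ take 0 c)" using assms(4) by simp
    ultimately show "I 0 s" unfolding I_def by blast
  next
    fix j s' assume j: "j < fst s 2" and "I j s'"
    then obtain A where s': "s' = ((fst s)(0 := length w + j, 6 := j, 19 := fst s 19 + j), (snd s)(0 := A))"
      and A: "holds A (w @ take j c)" unfolding I_def by blast
    have len: "length (w @ take j c) = length w + j" using j assms(2) by simp
    have "holds (A(length w + j := c ! j)) (w @ take (Suc j) c)"
      using holds_snoc[OF A, of "c ! j"] j assms(2) unfolding len by (simp add: take_Suc_conv_app_nth)
    moreover have "(fst s)(0 := x, 6 := y, 19 := z, 0 := x', 19 := z', 6 := y') = (fst s)(0 := x', 6 := y', 19 := z')"
      for x y z x' y' z' by (auto simp: fun_eq_iff)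
    ultimately have "I (Suc j) ((fst s)(0 := length w + j, 6 := j, 19 := fst s 19 + j, 0 := length w + Suc j, 19 := fst s 19 + Suc j, 6 := Suc j),
        (snd s)(0 := A, 0 := A(length w + j := c ! j)))"
      unfolding I_def by auto
    then show "expr_val (Reg 6) s' < expr_val (Reg 2) s' \<and>
      wp (Seq (Store 0 (Reg 0) (Arr 1 (Reg 19)))
     (Seq (Assign 0 (Plus (Reg 0) (Num 1)))
     (Seq (Assign 19 (Plus (Reg 19) (Num 1)))
          (Assign 6 (Plus (Reg 6) (Num 1)))))) s'
       (\<lambda>t s''. t + (1 + expr_cost (Reg 6) + expr_cost (Reg 2)) \<le> 25 \<and> I (Suc j) s'')"
      using j assms(3) unfolding s' by simp
  qed (auto simp: I_def)
  then show ?thesis by (rule wp_mono) (use assms(2) in \<open>auto simp: I_def\<close>)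
qed

definition write_part :: com where
  "write_part = WhileLess (Reg 19) (Reg 21)
     (Seq (Store 0 (Reg 0) (Reg 12))
     (Seq (Assign 0 (Plus (Reg 0) (Num 1)))
     (Seq (Assign 20 (Plus (Reg 20) (Num 1)))
     (Seq (Assign 6 (Num 0))
          copy_clause))))"

lemma wp_write_part:
  assumes "fst s 21 = fst s 19 + length K * d" "1 \<le> d" "fst s 2 = d"
    and K: "\<And>b. b < length K \<Longrightarrow> length (K ! b) = d"
      "\<And>b x. b < length K \<Longrightarrow> x < d \<Longrightarrow> snd s 1 (fst s 19 + b * d + x) = K ! b ! x"
    and "holds (snd s 0) w" "fst s 0 = length w" "fst s 12 = i"
  shows "wp write_part s (\<lambda>t s'. t \<le> length K * (65 * d) + 3 \<and>
    (\<exists>A x6. s' = ((fst s)(0 := length w + length K * (d + 1), 6 := x6, 19 := fst s 21, 20 := fst s 20 + length K), (snd s)(0 := A)) \<and>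
      holds A (w @ flat (map (Pair i) K))))"
proof -
  define I where "I = (\<lambda>b s'. \<exists>A x6. s' = ((fst s)(0 := length w + b * (d + 1), 6 := x6, 19 := fst s 19 + b * d, 20 := fst s 20 + b), (snd s)(0 := A)) \<and>
      holds A (w @ flat (map (Pair i) (take b K))))"
  have "wp write_part s (\<lambda>t s'. t \<le> (\<Sum>b<length K. 65 * d) + (1 + expr_cost (Reg 19) + expr_cost (Reg 21)) \<and> I (length K) s')"
    unfolding write_part_def
  proof (rule wp_While)
    have "s = ((fst s)(0 := length w + 0 * (d + 1), 6 := fst s 6, 19 := fst s 19 + 0 * d, 20 := fst s 20 + 0), (snd s)(0 := snd s 0))"
      using assms by (simp add: prod_eq_iff fun_eq_iff)
    moreover have "holds (snd s 0) (w @ flat (map (Pair i) (take 0 K)))" using assms(6) by simp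
    ultimately show "I 0 s" unfolding I_def by blast
  next
    fix b s' assume b: "b < length K" and "I b s'"
    then obtain A x6 where s': "s' = ((fst s)(0 := length w + b * (d + 1), 6 := x6, 19 := fst s 19 + b * d, 20 := fst s 20 + b), (snd s)(0 := A))"
      and A: "holds A (w @ flat (map (Pair i) (take b K)))" unfolding I_def by blast
    let ?w = "w @ flat (map (Pair i) (take b K))"
    have "length (flat (map (Pair i) (take b K))) = length (map (Pair i) (take b K)) * (d + 1)"
      using K(1) by (intro length_flat) (auto simp: in_set_conv_nth)
    then have lw: "length ?w = length w + b * (d + 1)" using b by simp
    define s1 where "s1 = ((fst s')(0 := length ?w + 1, 20 := fst s 20 + Suc b, 6 := 0), (snd s)(0 := A(length ?w := i)))"
    have s1: "fst s1 2 = d" "fst s1 19 = fst s 19 + b * d" using assms(3) by (simp_all add: s1_def s')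
    have flat_Suc: "?w @ [i] @ K ! b = w @ flat (map (Pair i) (take (Suc b) K))"
      using b by (simp add: take_Suc_conv_app_nth)
    have "wp copy_clause s1 (\<lambda>t s2. t \<le> 25 * d + 3 \<and> I (Suc b) s2)"
    proof (rule wp_mono[OF wp_copy_clause[where c = "K ! b" and w = "?w @ [i]"]])
      show "holds (snd s1 0) (?w @ [i])" using holds_snoc[OF A, of i] by (simp add: s1_def)
      show "length (K ! b) = fst s1 2" using K(1) b s1 by simp
      show "snd s1 1 (fst s1 19 + x) = K ! b ! x" if "x < fst s1 2" for x
        using K(2)[OF b] that s1 by (simp add: s1_def)
    next
      fix t s2 assume *: "t \<le> 25 * fst s1 2 + 3 \<and> (\<exists>A. s2 = ((fst s1)(0 := length (?w @ [i]) + fst s1 2, 6 := fst s1 2,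
        19 := fst s1 19 + fst s1 2), (snd s1)(0 := A)) \<and> holds A ((?w @ [i]) @ K ! b))"
      then obtain A' where s2: "s2 = ((fst s1)(0 := length (?w @ [i]) + fst s1 2, 6 := fst s1 2,
        19 := fst s1 19 + fst s1 2), (snd s1)(0 := A'))" and A': "holds A' (?w @ [i] @ K ! b)" by auto
      have "s2 = ((fst s)(0 := length w + Suc b * (d + 1), 6 := d, 19 := fst s 19 + Suc b * d, 20 := fst s 20 + Suc b), (snd s)(0 := A'))"
        using lw s1 by (auto simp: s2 s1_def s' fun_eq_iff)
      then have "I (Suc b) s2" using A' unfolding I_def flat_Suc by blast
      then show "t \<le> 25 * d + 3 \<and> I (Suc b) s2" using * s1 by simp
    qed (simp_all add: s1_def)
    \<comment> \<open>The loop is controlled by addresses, not by a count of clauses;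
      \<open>1 <= d\<close> ensures that a remaining clause leaves a nonempty range.\<close>
    moreover have "fst s 19 + b * d < fst s 21"
      using b assms(1,2) by simp
    ultimately show "expr_val (Reg 19) s' < expr_val (Reg 21) s' \<and>
      wp (Seq (Store 0 (Reg 0) (Reg 12))
     (Seq (Assign 0 (Plus (Reg 0) (Num 1)))
     (Seq (Assign 20 (Plus (Reg 20) (Num 1)))
     (Seq (Assign 6 (Num 0))
          copy_clause)))) s'
       (\<lambda>t s''. t + (1 + expr_cost (Reg 19) + expr_cost (Reg 21)) \<le> 65 * d \<and> I (Suc b) s'')"
      using assms(8) lw by (simp add: s' s1_def) (erule wp_mono, use assms(2) in simp)
  qed (use assms(1) in \<open>auto simp: I_def\<close>)
  then show ?thesis by (rule wp_mono) (use assms(1) in \<open>auto simp: I_def\<close>)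
qed

definition write_parts :: com where
  "write_parts = WhileLess (Reg 12) (Reg 1)
     (Seq (Assign 12 (Plus (Reg 12) (Num 1)))
     (Seq (IfLess (Arr 3 (Arr 5 (Reg 12))) (Reg 4)
        (Seq (Assign 19 (Plus (Arr 5 (Reg 12)) (Num 1))) (Assign 21 (Arr 6 (Reg 12))))
        (Seq (Assign 19 (Plus (Reg 13) (Num 1))) (Assign 21 (Reg 14))))
      write_part))"

definition listing :: "nat \<Rightarrow> (nat \<Rightarrow> 'a list) \<Rightarrow> (nat \<times> 'a) list" where
  "listing k G = concat (map (\<lambda>i. map (Pair i) (G i)) [1..<Suc k])"

lemma listing_0: "listing 0 G = []" by (simp add: listing_def)

lemma listing_Suc: "listing (Suc k) G = listing k G @ map (Pair (Suc k)) (G (Suc k))"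
  by (simp add: listing_def)

lemma set_listing: "(i, c) \<in> set (listing k G) \<longleftrightarrow> i \<in> {1..k} \<and> c \<in> set (G i)"
  by (auto simp: listing_def)

text \<open>\<open>lo i\<close> is the root of the tree that part \<open>i\<close> is copied from,
  its own or that of the reference, and \<open>G i\<close> lists the clauses in the copied
  range.\<close>

lemma wp_write_parts:
  assumes "fst s 12 = 0" "fst s 20 = 0" "fst s 1 = k" "fst s 2 = d" "1 \<le> d"
    and lo: "\<And>i. lo i = (if snd s 3 (snd s 5 i) < fst s 4 then snd s 5 i else fst s 13)"
    and hi: "\<And>i. i \<in> {1..k} \<Longrightarrow> (if snd s 3 (snd s 5 i) < fst s 4 then snd s 6 i else fst s 14) = lo i + 1 + length (G i) * d"
    and G: "\<And>i b. i \<in> {1..k} \<Longrightarrow> b < length (G i) \<Longrightarrow> length (G i ! b) = d"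
      "\<And>i b x. i \<in> {1..k} \<Longrightarrow> b < length (G i) \<Longrightarrow> x < d \<Longrightarrow> snd s 1 (lo i + 1 + b * d + x) = G i ! b ! x"
    and "holds (snd s 0) w" "fst s 0 = length w"
  shows "wp write_parts s (\<lambda>t s'. t \<le> (\<Sum>i<k. length (G (Suc i)) * (65 * d) + 40) + 3 \<and>
    fst s' 0 = length w + length (flat (listing k G)) \<and> fst s' 20 = length (listing k G) \<and>
    holds (snd s' 0) (w @ flat (listing k G)))"
proof -
  define I where "I = (\<lambda>i s'. fst s' 12 = i \<and> (\<forall>r\<in>{1, 2, 4, 13, 14}. fst s' r = fst s r) \<and>
    (\<forall>a\<in>{1, 3, 5, 6}. snd s' a = snd s a) \<and>
    fst s' 0 = length w + length (flat (listing i G)) \<and> fst s' 20 = length (listing i G) \<and>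
    holds (snd s' 0) (w @ flat (listing i G)))"
  have "wp write_parts s (\<lambda>t s'. t \<le> (\<Sum>i<k. length (G (Suc i)) * (65 * d) + 40) +
     (1 + expr_cost (Reg 12) + expr_cost (Reg 1)) \<and> I k s')"
    unfolding write_parts_def
  proof (rule wp_While)
    show "I 0 s" using assms by (simp add: I_def listing_0)
  next
    fix s' assume "I k s'" then show "\<not> expr_val (Reg 12) s' < expr_val (Reg 1) s'" using assms(3) by (simp add: I_def)
  next
    fix i s' assume i: "i < k" and I: "I i s'"
    let ?i = "Suc i" let ?w = "w @ flat (listing i G)"
    have ik: "?i \<in> {1..k}" using i by simp
    define s1 where "s1 = ((fst s')(12 := ?i, 19 := lo ?i + 1, 21 := lo ?i + 1 + length (G ?i) * d), snd s')"
    have "wp write_part s1 (\<lambda>t s2. t \<le> length (G ?i) * (65 * d) + 3 \<and> I ?i s2)"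
    proof (rule wp_mono[OF wp_write_part[where K = "G ?i" and d = d and w = ?w and i = ?i]])
      show "length (G ?i ! b) = d" if "b < length (G ?i)" for b using G(1)[OF ik that] .
      show "snd s1 1 (fst s1 19 + b * d + x) = G ?i ! b ! x" if "b < length (G ?i)" "x < d" for b x
        using G(2)[OF ik that] I by (simp add: s1_def I_def)
    next
      fix t s2 assume *: "t \<le> length (G ?i) * (65 * d) + 3 \<and>
        (\<exists>A x6. s2 = ((fst s1)(0 := length ?w + length (G ?i) * (d + 1), 6 := x6, 19 := fst s1 21,
          20 := fst s1 20 + length (G ?i)), (snd s1)(0 := A)) \<and> holds A (?w @ flat (map (Pair ?i) (G ?i))))"
      have "length (flat (map (Pair ?i) (G ?i))) = length (map (Pair ?i) (G ?i)) * (d + 1)"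
        using G(1)[OF ik] by (intro length_flat) (auto simp: in_set_conv_nth)
      then have "I ?i s2" using * I unfolding I_def by (auto simp: listing_Suc s1_def)
      then show "t \<le> length (G ?i) * (65 * d) + 3 \<and> I ?i s2" using * by simp
    qed (use I assms in \<open>auto simp: s1_def I_def\<close>)
    then have w: "wp write_part s1 (\<lambda>t s2. 37 + t \<le> length (G ?i) * (65 * d) + 40 \<and> I ?i s2)"
      by (rule wp_mono) simp
    have "s1 = ((fst s')(12 := ?i, 19 := (if snd s 3 (snd s 5 ?i) < fst s 4 then snd s 5 ?i else fst s 13) + 1,
        21 := (if snd s 3 (snd s 5 ?i) < fst s 4 then snd s 6 ?i else fst s 14)), snd s')"
      using hi[OF ik] lo[of ?i] by (simp add: s1_def)
    then show "expr_val (Reg 12) s' < expr_val (Reg 1) s' \<and>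
      wp (Seq (Assign 12 (Plus (Reg 12) (Num 1)))
     (Seq (IfLess (Arr 3 (Arr 5 (Reg 12))) (Reg 4)
        (Seq (Assign 19 (Plus (Arr 5 (Reg 12)) (Num 1))) (Assign 21 (Arr 6 (Reg 12))))
        (Seq (Assign 19 (Plus (Reg 13) (Num 1))) (Assign 21 (Reg 14))))
      write_part)) s'
       (\<lambda>t s''. t + (1 + expr_cost (Reg 12) + expr_cost (Reg 1)) \<le> length (G ?i) * (65 * d) + 40 \<and> I ?i s'')"
      using w i I assms(3) by (cases "snd s 3 (snd s 5 ?i) < fst s 4") (simp add: I_def, erule wp_mono, simp)+
  qed
  then show ?thesis by (rule wp_mono) (auto simp: I_def)
qed

section \<open>Computing the bounds m and D by addition only\<close>

definition multiply :: "nat \<Rightarrow> nat \<Rightarrow> nat \<Rightarrow> com" where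
  "multiply x y z = WhileLess (Reg 8) (Reg y)
     (Seq (Assign x (Plus (Reg x) (Reg z))) (Assign 8 (Plus (Reg 8) (Num 1))))"

lemma wp_multiply:
  assumes "distinct [x, y, z, 8]" "fst s 8 = 0" "fst s x = 0"
  shows "wp (multiply x y z) s (\<lambda>t s'. t \<le> 11 * fst s y + 3 \<and>
    s' = ((fst s)(x := fst s y * fst s z, 8 := fst s y), snd s))"
proof -
  define I where "I = (\<lambda>j s'. s' = ((fst s)(x := j * fst s z, 8 := j), snd s))"
  have "wp (multiply x y z) s (\<lambda>t s'. t \<le> (\<Sum>j<fst s y. 11) + (1 + expr_cost (Reg 8) + expr_cost (Reg y)) \<and> I (fst s y) s')"
    unfolding multiply_def
  proof (rule wp_While)
    show "I 0 s" using assms by (simp add: I_def prod_eq_iff fun_eq_iff)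
  next
    fix j s' assume "j < fst s y" "I j s'"
    then show "expr_val (Reg 8) s' < expr_val (Reg y) s' \<and>
      wp (Seq (Assign x (Plus (Reg x) (Reg z))) (Assign 8 (Plus (Reg 8) (Num 1)))) s'
       (\<lambda>t s''. t + (1 + expr_cost (Reg 8) + expr_cost (Reg y)) \<le> 11 \<and> I (Suc j) s'')"
      using assms(1) by (auto simp: I_def fun_eq_iff)
  qed (use assms(1) in \<open>auto simp: I_def\<close>)
  then show ?thesis by (rule wp_mono) (simp add: I_def)
qed

text \<open>The number (k - 1) d + 1 arises from 1 by k - 1 additions. This takes time O(k), so it
  is started only after k <= n has been tested.\<close>

definition petal_bound :: com where
  "petal_bound = Seq (Assign 4 (Num 1)) (Seq (Assign 6 (Num 1))
     (WhileLess (Reg 6) (Reg 1)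
       (Seq (Assign 4 (Plus (Reg 4) (Reg 2))) (Assign 6 (Plus (Reg 6) (Num 1))))))"

lemma wp_petal_bound:
  assumes "1 \<le> fst s 1"
  shows "wp petal_bound s (\<lambda>t s'. t \<le> 11 * fst s 1 + 10 \<and>
    s' = ((fst s)(4 := (fst s 1 - 1) * fst s 2 + 1, 6 := fst s 1), snd s))"
proof -
  define s1 where "s1 = ((fst s)(4 := 1, 6 := 1), snd s)"
  define I where "I = (\<lambda>j s'. s' = ((fst s)(4 := j * fst s 2 + 1, 6 := Suc j), snd s))"
  have "wp (WhileLess (Reg 6) (Reg 1)
       (Seq (Assign 4 (Plus (Reg 4) (Reg 2))) (Assign 6 (Plus (Reg 6) (Num 1))))) s1
     (\<lambda>t s'. t \<le> (\<Sum>j<fst s 1 - 1. 11) + (1 + expr_cost (Reg 6) + expr_cost (Reg 1)) \<and> I (fst s 1 - 1) s')"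
  proof (rule wp_While)
    show "I 0 s1" by (simp add: I_def s1_def)
  next
    fix j s' assume "j < fst s 1 - 1" "I j s'"
    then show "expr_val (Reg 6) s' < expr_val (Reg 1) s' \<and>
      wp (Seq (Assign 4 (Plus (Reg 4) (Reg 2))) (Assign 6 (Plus (Reg 6) (Num 1)))) s'
       (\<lambda>t s''. t + (1 + expr_cost (Reg 6) + expr_cost (Reg 1)) \<le> 11 \<and> I (Suc j) s'')"
      by (auto simp: I_def fun_eq_iff)
  qed (use assms in \<open>auto simp: I_def\<close>)
  then show ?thesis unfolding petal_bound_def
    by (simp add: s1_def) (erule wp_mono, use assms in \<open>auto simp: I_def\<close>)
qed

text \<open>Once the product exceeds the number of vertices it is left alone, which keeps the running time
  linear in \<open>d * n\<close>; register 5 then only holds a lower bound of \<open>D\<close>.\<close>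

definition part_bound :: com where
  "part_bound = Seq (Assign 5 (Num 1)) (Seq (Assign 6 (Num 0))
     (WhileLess (Reg 6) (Reg 2)
       (Seq (Assign 6 (Plus (Reg 6) (Num 1)))
       (IfLess (Reg 3) (Reg 5) skip
         (Seq (Assign 7 (Num 0)) (Seq (Assign 8 (Num 0)) (Seq (multiply 7 6 5)
         (Seq (Assign 5 (Num 0)) (Seq (Assign 8 (Num 0)) (multiply 5 4 7))))))))))"

text \<open>Each multiplication loops over its small factor, j + 1 or m. Here m <= n by assumption,
  and j <= j! m^j <= n as long as the product is maintained. So each of the d rounds costs O(n),
  however large the product of the last round becomes.\<close>

lemma wp_part_bound:
  assumes "1 \<le> fst s 4" "fst s 4 \<le> fst s 3"
  shows "wp part_bound s (\<lambda>t s'. t \<le> 120 * (fst s 2 * fst s 3) + 10 \<and>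
    (\<exists>x5 x6 x7 x8 x9. s' = ((fst s)(5 := x5, 6 := x6, 7 := x7, 8 := x8, 9 := x9), snd s) \<and>
      (if x5 \<le> fst s 3 then x5 = fact (fst s 2) * fst s 4 ^ fst s 2
       else fst s 3 < fact (fst s 2) * fst s 4 ^ fst s 2)))"
proof -
  define n where "n = fst s 3"
  define m where "m = fst s 4"
  define f where "f = (\<lambda>j::nat. fact j * m ^ j :: nat)"
  have m: "1 \<le> m" "m \<le> n" using assms by (simp_all add: m_def n_def)
  have f_Suc: "f (Suc j) = m * (Suc j * f j)" for j by (simp add: f_def algebra_simps)
  \<comment> \<open>A partial product above n stays above n, so an abandoned register still
    certifies n < D.\<close>
  have f_mono: "f j \<le> f (Suc j)" for j
  proof -
    have "1 * f j \<le> (m * Suc j) * f j" using m by (intro mult_le_mono1) (simp add: Suc_le_eq)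
    then show ?thesis by (simp only: f_Suc mult.assoc mult_1)
  qed
  have j_le: "j \<le> f j" for j
  proof -
    have "j * 1 \<le> fact j * m ^ j" using m fact_ge_self[of j] by (intro mult_le_mono) (simp_all add: Suc_le_eq)
    then show ?thesis by (simp add: f_def)
  qed
  define s1 where "s1 = ((fst s)(5 := 1, 6 := 0), snd s)"
  define I where "I = (\<lambda>j s'. \<exists>x5 x7 x8 x9. s' = ((fst s)(5 := x5, 6 := j, 7 := x7, 8 := x8, 9 := x9), snd s) \<and>
    (if x5 \<le> n then x5 = f j else n < f j))"
  let ?body = "Seq (Assign 6 (Plus (Reg 6) (Num 1)))
       (IfLess (Reg 3) (Reg 5) skip
         (Seq (Assign 7 (Num 0)) (Seq (Assign 8 (Num 0)) (Seq (multiply 7 6 5)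
         (Seq (Assign 5 (Num 0)) (Seq (Assign 8 (Num 0)) (multiply 5 4 7)))))))"
  have "wp (WhileLess (Reg 6) (Reg 2) ?body) s1
     (\<lambda>t s'. t \<le> (\<Sum>j<fst s 2. 120 * n) + (1 + expr_cost (Reg 6) + expr_cost (Reg 2)) \<and> I (fst s 2) s')"
  proof (rule wp_While)
    have "s1 = ((fst s)(5 := 1, 6 := 0, 7 := fst s 7, 8 := fst s 8, 9 := fst s 9), snd s)"
      by (simp add: s1_def prod_eq_iff fun_eq_iff)
    moreover have "if 1 \<le> n then 1 = f 0 else n < f 0" using m by (simp add: f_def)
    ultimately show "I 0 s1" unfolding I_def by blast
  next
    fix j s' assume j: "j < fst s 2" and "I j s'"
    then obtain x5 x7 x8 x9 where s': "s' = ((fst s)(5 := x5, 6 := j, 7 := x7, 8 := x8, 9 := x9), snd s)"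
      and x5: "if x5 \<le> n then x5 = f j else n < f j" unfolding I_def by blast
    have "wp ?body s' (\<lambda>t s''. t \<le> 100 * n \<and> I (Suc j) s'')"
    proof (cases "x5 \<le> n")
      case False
      have "((fst s')(6 := Suc j, 9 := 0), snd s) = ((fst s)(5 := x5, 6 := Suc j, 7 := x7, 8 := x8, 9 := 0), snd s)"
        by (auto simp: s' fun_eq_iff)
      moreover have "n < f (Suc j)" using x5 False f_mono[of j] by simp
      ultimately have "I (Suc j) ((fst s')(6 := Suc j, 9 := 0), snd s)" using False unfolding I_def by auto
      then show ?thesis using False m j by (simp add: s' n_def)
    next
      case True
      then have xf: "x5 = f j" using x5 by simp
      have jn: "j \<le> n" using j_le[of j] xf True by simp
      define s2 where "s2 = ((fst s')(6 := Suc j, 7 := 0, 8 := 0), snd s)"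
      define s3 where "s3 = ((fst s2)(7 := Suc j * x5, 5 := 0, 8 := 0), snd s)"
      have 1: "wp (multiply 7 6 5) s2 (\<lambda>t s'. t \<le> 11 * Suc n + 3 \<and> s' = ((fst s2)(7 := Suc j * x5, 8 := Suc j), snd s2))"
        by (rule wp_mono[OF wp_multiply]) (use jn in \<open>auto simp: s2_def s'\<close>)
      have 2: "wp (multiply 5 4 7) s3 (\<lambda>t s'. t \<le> 11 * n + 3 \<and> s' = ((fst s3)(5 := m * (Suc j * x5), 8 := m), snd s3))"
        by (rule wp_mono[OF wp_multiply]) (use m in \<open>auto simp: s3_def s2_def s' m_def\<close>)
      have "((fst s3)(5 := m * (Suc j * x5), 8 := m), snd s3) =
        ((fst s)(5 := f (Suc j), 6 := Suc j, 7 := Suc j * x5, 8 := m, 9 := x9), snd s)"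
        by (auto simp: s3_def s2_def s' xf f_Suc fun_eq_iff)
      then have I: "I (Suc j) ((fst s3)(5 := m * (Suc j * x5), 8 := m), snd s3)" unfolding I_def by force
      have "wp (multiply 7 6 5) s2 (\<lambda>t s''. wp (multiply 5 4 7) ((fst s'')(5 := 0, 8 := 0), snd s'')
        (\<lambda>t' s3. 30 + t + t' \<le> 100 * n \<and> I (Suc j) s3))"
      proof (rule wp_mono[OF 1], elim conjE)
        fix t s'' assume t: "t \<le> 11 * Suc n + 3" and s'': "s'' = ((fst s2)(7 := Suc j * x5, 8 := Suc j), snd s2)"
        have "((fst s'')(5 := 0, 8 := 0), snd s'') = s3"
          by (auto simp: s'' s3_def s2_def fun_eq_iff)
        then show "wp (multiply 5 4 7) ((fst s'')(5 := 0, 8 := 0), snd s'') (\<lambda>t' s3. 30 + t + t' \<le> 100 * n \<and> I (Suc j) s3)"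
          using 2 by simp (erule wp_mono, use t m I in auto)
      qed
      then show ?thesis using True by (simp add: s2_def s' n_def) (erule wp_mono, erule wp_mono, auto)
    qed
    then have "wp ?body s' (\<lambda>t s''. t + (1 + expr_cost (Reg 6) + expr_cost (Reg 2)) \<le> 120 * n \<and> I (Suc j) s'')"
      by (rule wp_mono) (use m in auto)
    then show "expr_val (Reg 6) s' < expr_val (Reg 2) s' \<and> wp ?body s'
      (\<lambda>t s''. t + (1 + expr_cost (Reg 6) + expr_cost (Reg 2)) \<le> 120 * n \<and> I (Suc j) s'')"
      using j by (simp only: expr_val.simps s' fst_conv) simp
  qed (auto simp: I_def)
  then have "wp part_bound s (\<lambda>t s'. t \<le> 120 * (fst s 2 * n) + 10 \<and> I (fst s 2) s')"
    unfolding part_bound_def by (simp add: s1_def) (erule wp_mono, simp)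
  then show ?thesis
  proof (rule wp_mono)
    fix t s' assume *: "t \<le> 120 * (fst s 2 * n) + 10 \<and> I (fst s 2) s'"
    then obtain x5 x7 x8 x9 where "s' = ((fst s)(5 := x5, 6 := fst s 2, 7 := x7, 8 := x8, 9 := x9), snd s)"
      "if x5 \<le> n then x5 = f (fst s 2) else n < f (fst s 2)" unfolding I_def by blast
    then show "t \<le> 120 * (fst s 2 * fst s 3) + 10 \<and>
      (\<exists>x5 x6 x7 x8 x9. s' = ((fst s)(5 := x5, 6 := x6, 7 := x7, 8 := x8, 9 := x9), snd s) \<and>
      (if x5 \<le> fst s 3 then x5 = fact (fst s 2) * fst s 4 ^ fst s 2
       else fst s 3 < fact (fst s 2) * fst s 4 ^ fst s 2))"
      using * unfolding f_def m_def n_def by blast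
  qed
qed

section \<open>The complete program and its running time\<close>

definition kernel_parts :: "nat \<Rightarrow> nat \<Rightarrow> nat \<Rightarrow> (nat \<times> 'a list) list \<Rightarrow> (nat \<Rightarrow> 'a list list) \<Rightarrow> bool" where
  "kernel_parts k m D es G \<longleftrightarrow> (\<exists>K free r R.
     (\<forall>i\<in>{1..k}. set (K i) \<subseteq> part_clauses i es \<and> distinct (map set (K i)) \<and>
       (if free i then covers m (set ` set (K i))
        else length (K i) < D \<and> represents m (set ` part_clauses i es) (set ` set (K i)))) \<and>
     r \<in> {1..k} \<and> (\<not> free r \<and> R = K r \<or> (\<forall>i\<in>{1..k}. free i) \<and> R = [hd (K r)] \<and> K r \<noteq> []) \<and>
     G = (\<lambda>i. if free i then R else K i))"

text \<open>The output overwrites the input from cell 3 on; the kept clauses have been saved in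
  array 1. Cells 0 and 1 already contain k and d, and cell 2 receives the number of vertices once it
  has been counted.\<close>

definition reduce_instance :: com where
  "reduce_instance = Seq reduce_parts
     (Seq (Assign 12 (Num 0)) (Seq (Assign 20 (Num 0)) (Seq (Assign 0 (Num 3))
     (Seq write_parts (Store 0 (Num 2) (Reg 20))))))"

text \<open>Because k <= m <= D, each test stops only on inputs with n < D. Passing it also pays for
  the next step: k <= n for computing m, m <= n for computing D, and D <= n for building the
  trees.\<close>

definition kernelize :: com where
  "kernelize = Seq (Assign 1 (Arr 0 (Num 0))) (Seq (Assign 2 (Arr 0 (Num 1))) (Seq (Assign 3 (Arr 0 (Num 2)))
     (IfLess (Reg 3) (Reg 1) skip
     (Seq petal_bound
     (IfLess (Reg 3) (Reg 4) skip
     (Seq part_bound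
     (IfLess (Reg 3) (Reg 5) skip
       reduce_instance)))))))"

text \<open>A vertex is inserted only in the scan of its own part, so after exchanging the sums the
  cost \<open>X\<close> occurs at most once per vertex.\<close>

lemma sum_part_costs_le:
  "(\<Sum>i<k. \<Sum>v<n. 30 + (if f v = Suc i then X else 0)) \<le> 30 * (k * n) + n * (X::nat)"
proof -
  have inner: "(\<Sum>i<k. if p = Suc i then X else 0) \<le> X" for p
    by (cases p) (simp_all add: sum.delta')
  have "(\<Sum>i<k. \<Sum>v<n. 30 + (if f v = Suc i then X else 0)) =
      30 * (k * n) + (\<Sum>i<k. \<Sum>v<n. if f v = Suc i then X else 0)"
    by (simp add: sum.distrib)
  also have "(\<Sum>i<k. \<Sum>v<n. if f v = Suc i then X else 0) = (\<Sum>v<n. \<Sum>i<k. if f v = Suc i then X else 0)"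
    by (rule sum.swap)
  also have "\<dots> \<le> (\<Sum>v<n. X)" by (intro sum_mono inner)
  finally show ?thesis by simp
qed

text \<open>Three costs add up: O(d D) for each of the n insertions, k n for the scans, and O(d D)
  for writing each of the k parts. Since k <= D <= n, all of them are O(D d n).\<close>

lemma wp_reduce_instance:
  assumes "clause_list d es" "1 \<le> d" "1 \<le> m" "1 \<le> k"
    and "fst s 1 = k" "fst s 2 = d" "fst s 3 = length es" "fst s 4 = m"
    and "fst s 10 = 0" "fst s 11 = 0" "fst s 12 = 0" "fst s 14 = 0"
    and "\<And>a. snd s 3 a = 0" "\<And>a. snd s 4 a = 0"
    and mem: "holds (snd s 0) (k # d # length es # flat es)"
    and D: "D = fact d * m ^ d" "k \<le> D" "D \<le> length es"
  shows "wp reduce_instance s (\<lambda>t s'. t \<le> 500 * (D * d * length es) \<and>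
    (\<exists>G. kernel_parts k m D es G \<and> fst s' 0 = 3 + length (flat (listing k G)) \<and>
      holds (snd s' 0) (k # d # length (listing k G) # flat (listing k G))))"
proof -
  define n where "n = length es"
  have lens: "\<forall>(p, c)\<in>set es. length c = d" using assms(1) by (auto simp: clause_list_def)
  have "input_mem d es s"
    unfolding input_mem_def
  proof (intro conjI allI impI)
    fix v assume v: "v < length es"
    have "(v + 1) * (d + 1) \<le> length es * (d + 1)" using v by (intro mult_le_mono1) simp
    then have b: "v * (d + 1) + (d + 1) \<le> length (flat es)" using length_flat[OF lens] by simp
    have f: "snd s 0 (3 + j) = flat es ! j" if "j < length (flat es)" for j
      using mem that by (auto simp: holds_def numeral_3_eq_3 dest!: spec[of _ "Suc (Suc (Suc j))"])
    show "snd s 0 (3 + v * (d + 1)) = fst (es ! v)"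
      using f[of "v * (d + 1)"] b nth_flat(1)[OF lens v] by simp
    show "snd s 0 (3 + v * (d + 1) + 1 + x) = snd (es ! v) ! x" if "x < d" for x
      using f[of "v * (d + 1) + 1 + x"] b nth_flat(2)[OF lens v that] that by (simp add: add.assoc)
  qed (use assms in auto)
  note parts = wp_reduce_parts[OF assms(1-4) this assms(5,8-14)]
  have "wp reduce_parts s (\<lambda>t s1. wp write_parts ((fst s1)(12 := 0, 20 := 0, 0 := 3), snd s1) (\<lambda>t' s2.
     20 + t + t' \<le> 500 * (D * d * n) \<and> (\<exists>G. kernel_parts k m D es G \<and> fst s2 0 = 3 + length (flat (listing k G)) \<and>
      holds ((snd s2 0)(2 := fst s2 20)) (k # d # length (listing k G) # flat (listing k G)))))"
  proof (rule wp_mono[OF parts], elim conjE exE)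
    fix t s1 K
    assume t: "t \<le> (\<Sum>i<k. \<Sum>v<length es. 30 + (if fst (es ! v) = Suc i then 150 * (d * (fact d * m ^ d)) else 0)) + 60 * k + 3"
      and K: "\<forall>i\<in>{1..k}. part_done d m es (K i) i s1" and ref: "reference d m k s1"
      and s1: "snd s1 0 = snd s 0" "fst s1 1 = k" "fst s1 2 = d" "fst s1 3 = length es" "fst s1 4 = m"
    define free where "free = (\<lambda>i. \<not> snd s1 3 (snd s1 5 i) < m)"
    obtain r where r: "r \<in> {1..k}" "fst s1 13 = snd s1 5 r"
      "\<not> free r \<and> fst s1 14 = snd s1 6 r \<or> (\<forall>i\<in>{1..k}. free i) \<and> fst s1 14 = fst s1 13 + 1 + d"
      using ref unfolding reference_def free_def by blast
    define R where "R = (if free r then [hd (K r)] else K r)"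
    define G where "G = (\<lambda>i. if free i then R else K i)"
    have Kp: "snd s1 6 i = snd s1 5 i + 1 + length (K i) * d"
      "\<And>b x. b < length (K i) \<Longrightarrow> x < d \<Longrightarrow> snd s1 1 (snd s1 5 i + 1 + b * d + x) = K i ! b ! x"
      "set (K i) \<subseteq> part_clauses i es" "distinct (map set (K i))"
      "free i \<Longrightarrow> covers m (set ` set (K i))"
      "\<not> free i \<Longrightarrow> length (K i) < D \<and> represents m (set ` part_clauses i es) (set ` set (K i))"
      "c \<in> set (K i) \<Longrightarrow> length c = d"
      if "i \<in> {1..k}" for i c
    proof -
      have *: "part_done d m es (K i) i s1" using K that by blast
      then show "snd s1 6 i = snd s1 5 i + 1 + length (K i) * d"
        "\<And>b x. b < length (K i) \<Longrightarrow> x < d \<Longrightarrow> snd s1 1 (snd s1 5 i + 1 + b * d + x) = K i ! b ! x"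
        "set (K i) \<subseteq> part_clauses i es" "distinct (map set (K i))"
        "free i \<Longrightarrow> covers m (set ` set (K i))"
        "\<not> free i \<Longrightarrow> length (K i) < D \<and> represents m (set ` part_clauses i es) (set ` set (K i))"
        unfolding part_done_def free_def D(1) adr_def by (simp_all split: if_splits)
      then show "c \<in> set (K i) \<Longrightarrow> length c = d" using lens by (auto simp: part_clauses_def)
    qed
    \<comment> \<open>\<open>covers\<close> applied to the empty \<open>Y\<close> yields a clause,
      so in a free part \<open>hd\<close> refers to a genuine clause.\<close>
    have ne: "K i \<noteq> []" if "i \<in> {1..k}" "free i" for i
    proof -
      have "\<exists>c\<in>set ` set (K i). c \<inter> {} = {}"
        using Kp(5)[OF that] assms(3) unfolding covers_def by (metis card.empty finite.emptyI less_le_trans zero_less_one)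
      then show ?thesis by auto
    qed
    have rR: "\<not> free r \<and> R = K r \<or> (\<forall>i\<in>{1..k}. free i) \<and> R = [hd (K r)] \<and> K r \<noteq> []"
      using r ne[OF r(1)] unfolding R_def by auto
    have G: "kernel_parts k m D es G"
      unfolding kernel_parts_def
    proof (intro exI conjI ballI)
      show "G = (\<lambda>i. if free i then R else K i)" by (rule G_def)
    qed (use Kp rR r in auto)
    have R_le: "set R \<subseteq> set (K r)" using rR by (auto simp: R_def)
    have D1: "1 \<le> D" using D(2) assms(4) by simp
    have R_len: "length R \<le> D" using rR Kp(6)[OF r(1)] D1 by auto
    have G_len: "length (G i) \<le> D" if "i \<in> {1..k}" for i
      using R_len Kp(6)[OF that] unfolding G_def by auto
    have G_d: "length (G i ! b) = d" if "i \<in> {1..k}" "b < length (G i)" for i b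
    proof -
      have "set (G i) \<subseteq> set (K r) \<union> set (K i)" using R_le unfolding G_def by auto
      then have "G i ! b \<in> set (K r) \<or> G i ! b \<in> set (K i)" using nth_mem[OF that(2)] by blast
      then show ?thesis using Kp(7)[OF r(1)] Kp(7)[OF that(1)] by blast
    qed
    define lo where "lo = (\<lambda>i. if free i then snd s1 5 r else snd s1 5 i)"
    define s2 where "s2 = ((fst s1)(12 := 0, 20 := 0, 0 := 3), snd s1)"
    have "wp write_parts s2 (\<lambda>t s'. t \<le> (\<Sum>i<k. length (G (Suc i)) * (65 * d) + 40) + 3 \<and>
      fst s' 0 = length [k, d, length es] + length (flat (listing k G)) \<and> fst s' 20 = length (listing k G) \<and>
      holds (snd s' 0) ([k, d, length es] @ flat (listing k G)))"
    proof (rule wp_write_parts[where lo = lo])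
      show "lo i = (if snd s2 3 (snd s2 5 i) < fst s2 4 then snd s2 5 i else fst s2 13)" for i
        using r(2) s1 by (simp add: lo_def s2_def free_def)
      show "(if snd s2 3 (snd s2 5 i) < fst s2 4 then snd s2 6 i else fst s2 14) = lo i + 1 + length (G i) * d"
        if i: "i \<in> {1..k}" for i
      proof (cases "free i")
        case True
        have "fst s1 14 = snd s1 5 r + 1 + length R * d"
          using r(2,3) Kp(1)[OF r(1)] r(1) unfolding R_def by auto
        then show ?thesis using True s1 unfolding lo_def s2_def G_def free_def by simp
      next
        case False
        then show ?thesis using Kp(1)[OF i] s1 unfolding lo_def s2_def G_def free_def by simp
      qed
      show "length (G i ! b) = d" if "i \<in> {1..k}" "b < length (G i)" for i b using G_d[OF that] .
      show "snd s2 1 (lo i + 1 + b * d + x) = G i ! b ! x" if i: "i \<in> {1..k}" "b < length (G i)" "x < d" for i b x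
      proof (cases "free i")
        case False
        then show ?thesis using Kp(2)[OF i(1)] i unfolding lo_def s2_def G_def by simp
      next
        case True
        have "b < length R" using i(2) True by (simp add: G_def)
        then have "b < length (K r) \<and> R ! b = K r ! b" using rR ne[OF r(1)] by (auto simp: hd_conv_nth)
        then show ?thesis using Kp(2)[OF r(1), of b x] i(3) True unfolding lo_def s2_def G_def by simp
      qed
      show "holds (snd s2 0) [k, d, length es]"
        using mem s1(1) unfolding holds_def s2_def by (auto simp: less_Suc_eq_0_disj)
    qed (use assms s1 in \<open>auto simp: s2_def\<close>)
    then show "wp write_parts ((fst s1)(12 := 0, 20 := 0, 0 := 3), snd s1) (\<lambda>t' s2.
      20 + t + t' \<le> 500 * (D * d * n) \<and> (\<exists>G. kernel_parts k m D es G \<and> fst s2 0 = 3 + length (flat (listing k G)) \<and>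
      holds ((snd s2 0)(2 := fst s2 20)) (k # d # length (listing k G) # flat (listing k G))))"
      unfolding s2_def
    proof (rule wp_mono, elim conjE)
      fix t' s3
      assume t': "t' \<le> (\<Sum>i<k. length (G (Suc i)) * (65 * d) + 40) + 3"
        and s3: "fst s3 0 = length [k, d, length es] + length (flat (listing k G))" "fst s3 20 = length (listing k G)"
          "holds (snd s3 0) ([k, d, length es] @ flat (listing k G))"
      have "holds ((snd s3 0)(2 := fst s3 20)) (k # d # length (listing k G) # flat (listing k G))"
        using s3(2,3) unfolding holds_def by (auto simp: nth_Cons numeral_2_eq_2 split: nat.splits)
      moreover have "20 + t + t' \<le> 500 * (D * d * n)"
      proof -
        have "n \<ge> 1" using D(3) D1 unfolding n_def by linarith
        have 1: "k * n \<le> D * d * n" "D * d * k \<le> D * d * n" "1 \<le> D * d * n" "k \<le> D * d * n"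
        proof -
          show "k * n \<le> D * d * n" using D(2) assms(2) by (intro mult_le_mono1) (metis le_trans mult_le_mono nat_mult_1_right)
          show "D * d * k \<le> D * d * n" using D(2,3) by (intro mult_le_mono2) (simp add: n_def)
          show "1 \<le> D * d * n" using D1 assms(2) \<open>n \<ge> 1\<close> by (simp add: Suc_le_eq)
          show "k \<le> D * d * n" using \<open>k * n \<le> D * d * n\<close> \<open>n \<ge> 1\<close> by (metis le_trans mult_le_mono2 nat_mult_1_right)
        qed
        have "t \<le> 30 * (k * n) + n * (150 * (d * D)) + 60 * k + 3"
          using t sum_part_costs_le[where k = k and n = n and f = "\<lambda>v. fst (es ! v)" and X = "150 * (d * D)"]
          unfolding D(1) n_def by linarith
        then have a: "t \<le> 30 * (k * n) + 150 * (D * d * n) + 60 * k + 3" by (simp add: algebra_simps)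
        have "(\<Sum>i<k. length (G (Suc i)) * (65 * d) + 40) \<le> (\<Sum>i<k. D * (65 * d) + 40)"
          by (intro sum_mono add_mono mult_le_mono1 G_len) auto
        also have "\<dots> = 65 * (D * d * k) + 40 * k" by (simp add: algebra_simps)
        finally have "t' \<le> 65 * (D * d * k) + 40 * k + 3" using t' by simp
        then show ?thesis using a 1 by linarith
      qed
      ultimately show "20 + t + t' \<le> 500 * (D * d * n) \<and> (\<exists>G. kernel_parts k m D es G \<and> fst s3 0 = 3 + length (flat (listing k G)) \<and>
        holds ((snd s3 0)(2 := fst s3 20)) (k # d # length (listing k G) # flat (listing k G)))"
        using G s3(1) by auto
    qed
  qed
  then show ?thesis unfolding reduce_instance_def n_def[symmetric]
    by (simp del: fun_upd_apply) (erule wp_mono, erule wp_mono, auto)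
qed

text \<open>If n < D, the time is constant or O(d n), and d n lies below both entries of the minimum
  when n > 0. If D <= n, the minimum is D d n, which pays for the reduction. The added 1 pays for
  the constant number of steps on very small inputs.\<close>

lemma wp_kernelize:
  assumes "clause_list d es" "1 \<le> d" "1 \<le> k"
    and m: "m = (k - 1) * d + 1" and D: "D = fact d * m ^ d" and n: "n = length es"
    and w: "w = k # d # n # flat es"
  shows "wp kernelize (input_state w) (\<lambda>t s'. t \<le> 1000 * (min (D * d * n) (d * n ^ 2) + 1) \<and>
    (\<exists>w'. fst s' 0 = length w' \<and> holds (snd s' 0) w' \<and>
      (n < D \<and> w' = w \<or>
       D \<le> n \<and> (\<exists>G. kernel_parts k m D es G \<and> w' = k # d # length (listing k G) # flat (listing k G)))))"
proof -
  define Q where "Q s' \<longleftrightarrow> (\<exists>w'. fst s' 0 = length w' \<and> holds (snd s' 0) w' \<and>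
      (n < D \<and> w' = w \<or>
       D \<le> n \<and> (\<exists>G. kernel_parts k m D es G \<and> w' = k # d # length (listing k G) # flat (listing k G))))"
    for s' :: state
  define X where "X = min (D * d * n) (d * n ^ 2)"
  have "k - 1 \<le> (k - 1) * d" using mult_le_mono2[OF assms(2), of "k - 1"] by (simp only: mult_1_right)
  then have m1: "1 \<le> m" "k \<le> m" unfolding m using assms(3) by linarith+
  have "m ^ 1 \<le> m ^ d" using m1 assms(2) by (intro power_increasing) auto
  then have "1 * m \<le> fact d * m ^ d" by (intro mult_le_mono) (simp_all add: Suc_le_eq)
  then have mD: "m \<le> D" "k \<le> D" "1 \<le> D" using m1 by (simp_all add: D)
  define s1 where "s1 = ((fst (input_state w))(1 := k, 2 := d, 3 := n), snd (input_state w))"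
  have A0: "holds (snd s1 0) w" "fst s1 0 = length w"
    by (simp_all add: s1_def input_state_def holds_def)
  have zero: "fst s1 r = 0" if "r \<notin> {0, 1, 2, 3}" for r using that by (simp add: s1_def input_state_def)
  have zero': "snd s1 a i = 0" if "a \<noteq> 0" for a i using that by (simp add: s1_def input_state_def)
  have unchanged: "Q s'" if "n < D" "fst s' 0 = fst s1 0" "snd s' = snd s1" for s'
    unfolding Q_def using that A0 by auto
  have "wp (IfLess (Reg 3) (Reg 1) skip
     (Seq petal_bound
     (IfLess (Reg 3) (Reg 4) skip
     (Seq part_bound
     (IfLess (Reg 3) (Reg 5) skip
       reduce_instance))))) s1 (\<lambda>t s'. 9 + t \<le> 1000 * (X + 1) \<and> Q s')"
  proof (cases "n < k")
    case True
    then have "n < D" using mD by simp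
    then show ?thesis using True unchanged[of "((fst s1)(9 := 0), snd s1)"] by (simp add: s1_def)
  next
    case nk: False
    have n1: "1 \<le> n" "k \<le> n" using nk assms(3) by simp_all
    have dn: "d * n \<le> X"
      using mD(3) n1 by (simp add: X_def power2_eq_square Suc_le_eq)
    have kdn: "k \<le> d * n" "1 \<le> d * n" using n1 assms(2) mult_le_mono[of 1 d k n] by (simp_all add: Suc_le_eq)
    define s2 where "s2 = ((fst s1)(4 := m, 6 := k), snd s1)"
    have petal: "wp petal_bound s1 (\<lambda>t s'. t \<le> 11 * k + 10 \<and> s' = s2)"
      by (rule wp_mono[OF wp_petal_bound]) (use assms(3) in \<open>auto simp: s1_def s2_def m\<close>)
    have "wp (IfLess (Reg 3) (Reg 4) skip (Seq part_bound (IfLess (Reg 3) (Reg 5) skip reduce_instance))) s2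
      (\<lambda>t s'. 30 + 11 * k + t \<le> 1000 * (X + 1) \<and> Q s')"
    proof (cases "n < m")
      case True
      then have "n < D" using mD by simp
      then show ?thesis using True unchanged[of "((fst s2)(9 := 0), snd s2)"] dn kdn by (simp add: s2_def s1_def)
    next
      case nm: False
      have r2: "fst s2 2 = d" "fst s2 3 = n" "fst s2 4 = m" by (simp_all add: s1_def s2_def)
      have "wp part_bound s2 (\<lambda>t s'. t \<le> 120 * (d * n) + 10 \<and>
        (\<exists>x5 x6 x7 x8 x9. s' = ((fst s2)(5 := x5, 6 := x6, 7 := x7, 8 := x8, 9 := x9), snd s2) \<and>
        (if x5 \<le> n then x5 = D else n < D)))"
        using wp_part_bound[of s2] nm m1 unfolding r2 D by (simp only: not_less)
      then have "wp part_bound s2 (\<lambda>t s'. wp (IfLess (Reg 3) (Reg 5) skip reduce_instance) s'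
        (\<lambda>t' s''. 40 + 11 * k + t + t' \<le> 1000 * (X + 1) \<and> Q s''))"
      proof (rule wp_mono, elim conjE exE)
        fix t s' x5 x6 x7 x8 x9
        assume t: "t \<le> 120 * (d * n) + 10"
          and s': "s' = ((fst s2)(5 := x5, 6 := x6, 7 := x7, 8 := x8, 9 := x9), snd s2)"
          and x5: "if x5 \<le> n then x5 = D else n < D"
        show "wp (IfLess (Reg 3) (Reg 5) skip reduce_instance) s' (\<lambda>t' s''. 40 + 11 * k + t + t' \<le> 1000 * (X + 1) \<and> Q s'')"
        proof (cases "x5 \<le> n")
          case False
          then have "n < D" using x5 by simp
          then show ?thesis using False unchanged[of "((fst s')(9 := 0), snd s')"] t dn kdn
            by (simp add: s' s2_def s1_def)
        next
          case True
          then have Dn: "D \<le> n" using x5 by simp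
          have min: "X = D * d * n"
            using mult_le_mono1[OF Dn, of "d * n"] by (simp add: X_def power2_eq_square min_def mult.commute mult.left_commute)
          have "wp reduce_instance s' (\<lambda>t s'. t \<le> 500 * (D * d * length es) \<and>
            (\<exists>G. kernel_parts k m D es G \<and> fst s' 0 = 3 + length (flat (listing k G)) \<and>
            holds (snd s' 0) (k # d # length (listing k G) # flat (listing k G))))"
            by (rule wp_reduce_instance[OF assms(1,2) m1(1) assms(3)])
               (use D mD Dn n A0 w zero zero' in \<open>simp_all add: s' s2_def s1_def\<close>)
          then have "wp reduce_instance s' (\<lambda>t' s''. 50 + 11 * k + t + t' \<le> 1000 * (X + 1) \<and> Q s'')"
          proof (rule wp_mono, elim conjE exE)
            fix t' G and s'' :: state assume t': "t' \<le> 500 * (D * d * length es)" and G: "kernel_parts k m D es G"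
              "fst s'' 0 = 3 + length (flat (listing k G))"
              "holds (snd s'' 0) (k # d # length (listing k G) # flat (listing k G))"
            have "fst s'' 0 = length (k # d # length (listing k G) # flat (listing k G))" using G(2) by simp
            then have "Q s''" unfolding Q_def using G(1,3) Dn by blast
            moreover have "t' \<le> 500 * X" using t' by (simp add: min n)
            then have "50 + 11 * k + t + t' \<le> 631 * X + 60" using t dn kdn by linarith
            then have "50 + 11 * k + t + t' \<le> 1000 * (X + 1)" by simp
            ultimately show "50 + 11 * k + t + t' \<le> 1000 * (X + 1) \<and> Q s''" by (intro conjI)
          qed
          then show ?thesis using True by (simp add: s' s2_def s1_def) (erule wp_mono, simp)
        qed
      qed
      then show ?thesis using nm by (simp add: s2_def s1_def) (erule wp_mono, auto elim!: wp_mono)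
    qed
    then have "wp petal_bound s1 (\<lambda>t s'. wp (IfLess (Reg 3) (Reg 4) skip (Seq part_bound (IfLess (Reg 3) (Reg 5) skip reduce_instance))) s'
       (\<lambda>t' s''. 20 + t + t' \<le> 1000 * (X + 1) \<and> Q s''))"
      by (intro wp_mono[OF petal]) (elim conjE, simp del: wp_IfLess, erule wp_mono, simp)
    then show ?thesis using nk by (simp add: s1_def) (erule wp_mono, auto elim!: wp_mono)
  qed
  moreover have "snd (input_state w) 0 0 = k" "snd (input_state w) 0 1 = d" "snd (input_state w) 0 2 = n"
    by (simp_all add: w input_state_def)
  ultimately show ?thesis unfolding kernelize_def X_def[symmetric] Q_def[symmetric] by (simp add: s1_def del: wp_IfLess)
qed

section \<open>Independent sets and choices of clauses\<close>

lemma opposite_opposite [simp]: "opposite (opposite l) = l"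
  by (cases l) simp_all

text \<open>Not clashing with a clause means missing the set of opposites of its literals. In this
  form the demands of the other parts become the set \<open>Y\<close> of \<open>represents\<close>
  and \<open>covers\<close>.\<close>

lemma clash_iff: "clash c c' \<longleftrightarrow> c \<inter> opposite ` c' \<noteq> {}"
proof
  assume "clash c c'"
  then obtain l where "l \<in> c" "opposite l \<in> c'" by (auto simp: clash_def)
  then have "l \<in> c \<inter> opposite ` c'" by (metis IntI image_eqI opposite_opposite)
  then show "c \<inter> opposite ` c' \<noteq> {}" by blast
next
  assume "c \<inter> opposite ` c' \<noteq> {}"
  then obtain l where "l \<in> c'" "opposite l \<in> c" by blast
  then show "clash c c'" unfolding clash_def by (metis opposite_opposite)
qed

lemma clash_sym: "clash c c' \<longleftrightarrow> clash c' c"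
  unfolding clash_def by (metis opposite_opposite)

lemma not_clash_self: "c \<in> clauses d X \<Longrightarrow> \<not> clash c c"
  by (auto simp: clauses_def clash_def)

definition compatible :: "nat \<Rightarrow> (nat \<Rightarrow> 'x clause) \<Rightarrow> bool" where
  "compatible k f \<longleftrightarrow> (\<forall>i\<in>{1..k}. \<forall>j\<in>{1..k}. i \<noteq> j \<longrightarrow> \<not> clash (f i) (f j))"

lemma compatibleD:
  "compatible k f \<Longrightarrow> i \<in> {1..k} \<Longrightarrow> j \<in> {1..k} \<Longrightarrow> i \<noteq> j \<Longrightarrow> \<not> clash (f i) (f j)"
  by (simp add: compatible_def)

text \<open>Adjacency depends only on parts and labels, so a CGIS instance can be replaced by the
  sets of clauses of its parts, and the vertices disappear from the argument.\<close>

definition choosable :: "nat \<Rightarrow> (nat \<Rightarrow> 'x clause set) \<Rightarrow> bool" where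
  "choosable k F \<longleftrightarrow> (\<exists>f. (\<forall>i\<in>{1..k}. f i \<in> F i) \<and> compatible k f)"

lemma choosable_mono:
  assumes "choosable k F" "\<And>i. i \<in> {1..k} \<Longrightarrow> F i \<subseteq> F' i"
  shows "choosable k F'"
proof -
  obtain f where f: "\<forall>i\<in>{1..k}. f i \<in> F i" "compatible k f"
    using assms(1) unfolding choosable_def by (elim exE conjE)
  have "\<forall>i\<in>{1..k}. f i \<in> F' i" using f(1) subsetD[OF assms(2)] by simp
  then show ?thesis unfolding choosable_def using f(2) by (intro exI[of _ f] conjI)
qed

lemma CGIS_iff_choosable:
  assumes "partite_clause_graph k d X G"
  shows "CGIS k G \<longleftrightarrow> choosable k (\<lambda>i. label G ` part G i)"
proof
  assume "CGIS k G"
  then obtain S where S: "independent_set G S" "\<forall>i\<in>{1..k}. card (S \<inter> part G i) = 1"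
    unfolding CGIS_def by blast
  have "\<exists>v. v \<in> S \<inter> part G i" if "i \<in> {1..k}" for i
  proof -
    have "card (S \<inter> part G i) \<noteq> 0" using S(2) that by simp
    then have "S \<inter> part G i \<noteq> {}" by force
    then show ?thesis by blast
  qed
  then obtain v where v: "\<And>i. i \<in> {1..k} \<Longrightarrow> v i \<in> S \<inter> part G i" by metis
  have "compatible k (\<lambda>i. label G (v i))"
    unfolding compatible_def
  proof (intro ballI impI)
    fix i j assume ij: "i \<in> {1..k}" "j \<in> {1..k}" "i \<noteq> j"
    then have "{v i, v j} \<notin> edges G" using S(1) v by (auto simp: independent_set_def)
    then show "\<not> clash (label G (v i)) (label G (v j))"
      using assms ij v[of i] v[of j] unfolding partite_clause_graph_def by blast
  qed
  moreover have "label G (v i) \<in> label G ` part G i" if "i \<in> {1..k}" for i using v[OF that] by simp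
  ultimately show "choosable k (\<lambda>i. label G ` part G i)"
    unfolding choosable_def by (intro exI[of _ "\<lambda>i. label G (v i)"]) simp
next
  assume "choosable k (\<lambda>i. label G ` part G i)"
  then obtain f where f: "\<forall>i\<in>{1..k}. f i \<in> label G ` part G i" "compatible k f"
    unfolding choosable_def by blast
  have "\<exists>u. u \<in> part G i \<and> label G u = f i" if "i \<in> {1..k}" for i
    using f(1)[rule_format, OF that] by (metis imageE)
  then obtain v where v: "\<And>i. i \<in> {1..k} \<Longrightarrow> v i \<in> part G i \<and> label G (v i) = f i" by metis
  let ?S = "v ` {1..k}"
  have "\<not> {v i, v j} \<in> edges G" if ij: "i \<in> {1..k}" "j \<in> {1..k}" for i j
  proof
    assume "{v i, v j} \<in> edges G"
    then have "i \<noteq> j \<and> clash (label G (v i)) (label G (v j))"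
      using assms ij v[of i] v[of j] unfolding partite_clause_graph_def by blast
    then show False using f(2) ij v unfolding compatible_def by auto
  qed
  moreover have "?S \<subseteq> verts G" using assms v unfolding partite_clause_graph_def by auto
  ultimately have "independent_set G ?S" unfolding independent_set_def by auto
  moreover have "?S \<inter> part G i = {v i}" if "i \<in> {1..k}" for i
  proof -
    have "j = i" if "j \<in> {1..k}" "v j \<in> part G i" for j
    proof (rule ccontr)
      assume "j \<noteq> i"
      then have "part G j \<inter> part G i = {}" using assms that(1) \<open>i \<in> {1..k}\<close>
        unfolding partite_clause_graph_def disjoint_family_on_def by blast
      then show False using v[OF that(1)] that(2) by blast
    qed
    then have "u = v i" if "u \<in> ?S \<inter> part G i" for u using that by blast
    moreover have "v i \<in> ?S \<inter> part G i" using v[OF that] that by blast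
    ultimately show ?thesis by blast
  qed
  ultimately show "CGIS k G" unfolding CGIS_def by (intro exI[of _ ?S]) simp
qed

text \<open>The choices are exchanged one part at a time; the other \<open>k - 1\<close> chosen clauses block at most
  \<open>(k - 1) * d\<close> literals.\<close>

lemma choosable_exchange:
  assumes f: "compatible k f" "\<And>i. i \<in> {1..k} \<Longrightarrow> f i \<in> clauses d X"
    and H: "\<And>i c. i \<in> {1..k} \<Longrightarrow> c \<in> H i \<Longrightarrow> c \<in> clauses d X"
    and exchange: "\<And>i Y. i \<in> {1..k} \<Longrightarrow> finite Y \<Longrightarrow> card Y < (k - 1) * d + 1 \<Longrightarrow> f i \<inter> Y = {} \<Longrightarrow>
      \<exists>c\<in>H i. c \<inter> Y = {}"
  shows "choosable k H"
proof -
  \<comment> \<open>\<open>J\<close> is the set of parts already exchanged. The mixed choice stays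
    within \<open>clauses d X\<close>, so every chosen clause still blocks only d literals in the
    next step.\<close>
  have "\<exists>g. compatible k g \<and> (\<forall>i\<in>J. g i \<in> H i) \<and> (\<forall>i\<in>{1..k} - J. g i = f i)"
    if "finite J" "J \<subseteq> {1..k}" for J
    using that
  proof (induction J rule: finite_induct)
    case empty
    then show ?case using f(1) by auto
  next
    case (insert i J)
    then obtain g where g: "compatible k g" "\<forall>i\<in>J. g i \<in> H i" "\<forall>i\<in>{1..k} - J. g i = f i" by auto
    have i: "i \<in> {1..k}" "g i = f i" using insert g(3) by auto
    have cl: "finite (g j) \<and> card (g j) = d" if "j \<in> {1..k}" for j
    proof -
      have "g j \<in> clauses d X" using that f(2) H g by (cases "j \<in> J") auto
      then show ?thesis by (simp add: clauses_def)
    qed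
    define Y where "Y = opposite ` (\<Union>j\<in>{1..k} - {i}. g j)"
    have "finite (\<Union>j\<in>{1..k} - {i}. g j)" using cl by auto
    then have Y: "finite Y" and "card Y \<le> card (\<Union>j\<in>{1..k} - {i}. g j)"
      unfolding Y_def by (simp_all add: card_image_le)
    note this(2)
    also have "card (\<Union>j\<in>{1..k} - {i}. g j) \<le> (\<Sum>j\<in>{1..k} - {i}. card (g j))"
      by (rule card_UN_le) simp
    also have "\<dots> = (\<Sum>j\<in>{1..k} - {i}. d)" using cl by (intro sum.cong) auto
    also have "\<dots> = (k - 1) * d" using i(1) by simp
    finally have cY: "card Y < (k - 1) * d + 1" by simp
    have "g i \<inter> opposite ` g j = {}" if "j \<in> {1..k} - {i}" for j
    proof -
      have "\<not> clash (g i) (g j)" using compatibleD[OF g(1) i(1)] that by auto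
      then show ?thesis by (simp add: clash_iff)
    qed
    moreover have "Y = (\<Union>j\<in>{1..k} - {i}. opposite ` g j)" unfolding Y_def by (rule image_UN)
    ultimately have gY: "g i \<inter> Y = {}" by (simp add: Int_UN_distrib)
    then obtain c where c: "c \<in> H i" "c \<inter> Y = {}" using exchange[OF i(1) Y cY gY[unfolded i(2)]] by blast
    have nc: "\<not> clash c (g j)" if "j \<in> {1..k}" "j \<noteq> i" for j
    proof -
      have "opposite ` g j \<subseteq> Y" unfolding Y_def using that by (intro image_mono) auto
      then show ?thesis using c(2) unfolding clash_iff by blast
    qed
    have "compatible k (g(i := c))"
      unfolding compatible_def
    proof (intro ballI impI)
      fix p q assume "p \<in> {1..k}" "q \<in> {1..k}" "p \<noteq> q"
      then show "\<not> clash ((g(i := c)) p) ((g(i := c)) q)"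
        using compatibleD[OF g(1), of p q] nc[of p] nc[of q] clash_sym[of "g p" c] by (auto split: if_splits)
    qed
    moreover have "\<forall>p\<in>insert i J. (g(i := c)) p \<in> H p" "\<forall>p\<in>{1..k} - insert i J. (g(i := c)) p = f p"
      using g c insert.hyps by auto
    ultimately show ?case by (intro exI[of _ "g(i := c)"] conjI)
  qed
  from this[of "{1..k}"] show ?thesis unfolding choosable_def by auto
qed

section \<open>Equivalence and size of the reduced instance\<close>

definition clause_instance :: "nat \<Rightarrow> nat \<Rightarrow> 'x set \<Rightarrow> (nat \<times> 'x literal list) list \<Rightarrow> bool" where
  "clause_instance k d X es \<longleftrightarrow>
     (\<forall>(p, c)\<in>set es. p \<in> {1..k} \<and> distinct c \<and> set c \<in> clauses d X) \<and>
     distinct (map (\<lambda>(p, c). (p, set c)) es)"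

text \<open>Both directions pass through the trees \<open>K\<close> before replacement. By exchange
  a choice from either side becomes a choice from \<open>K\<close>: free parts meet any demand, and
  the others represent their clauses or are unchanged. From \<open>K\<close> to \<open>G\<close>,
  every free part repeats the choice of part \<open>r\<close>, which clashes neither with itself nor
  with the remaining choices.\<close>

lemma kernel_parts_choosable:
  assumes ker: "kernel_parts k m D es G" and m: "m = (k - 1) * d + 1"
    and es: "clause_instance k d X es"
  shows "choosable k (\<lambda>i. set ` part_clauses i es) \<longleftrightarrow> choosable k (\<lambda>i. set ` set (G i))"
proof -
  obtain K free r R where K: "\<And>i. i \<in> {1..k} \<Longrightarrow> set (K i) \<subseteq> part_clauses i es"
    and cov: "\<And>i. i \<in> {1..k} \<Longrightarrow> free i \<Longrightarrow> covers m (set ` set (K i))"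
    and rep: "\<And>i. i \<in> {1..k} \<Longrightarrow> \<not> free i \<Longrightarrow> represents m (set ` part_clauses i es) (set ` set (K i))"
    and r: "r \<in> {1..k}" "\<not> free r \<and> R = K r \<or> (\<forall>i\<in>{1..k}. free i) \<and> R = [hd (K r)] \<and> K r \<noteq> []"
    and G: "G = (\<lambda>i. if free i then R else K i)"
    using ker unfolding kernel_parts_def by (smt (verit))
  have part: "set c \<in> clauses d X" if "c \<in> part_clauses i es" for i c
    using es that unfolding clause_instance_def part_clauses_def by auto
  have KX: "c \<in> clauses d X" if "i \<in> {1..k}" "c \<in> set ` set (K i)" for i c
    using K[OF that(1)] part that(2) by blast
  have R: "set R \<subseteq> set (K r)" using r(2) by (auto simp: hd_in_set)
  show ?thesis
  proof
    assume "choosable k (\<lambda>i. set ` part_clauses i es)"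
    then obtain f where f: "\<And>i. i \<in> {1..k} \<Longrightarrow> f i \<in> set ` part_clauses i es" "compatible k f"
      unfolding choosable_def by blast
    have "choosable k (\<lambda>i. set ` set (K i))"
    proof (rule choosable_exchange[OF f(2)])
      show "f i \<in> clauses d X" if "i \<in> {1..k}" for i using f(1)[OF that] part by auto
      show "\<exists>c\<in>set ` set (K i). c \<inter> Y = {}"
        if "i \<in> {1..k}" "finite Y" "card Y < (k - 1) * d + 1" "f i \<inter> Y = {}" for i Y
      proof (cases "free i")
        case True
        then show ?thesis using cov[OF that(1)] that(2,3) unfolding covers_def m by blast
      next
        case False
        then show ?thesis using rep[OF that(1)] f(1)[OF that(1)] that(2-4) unfolding represents_def m by blast
      qed
    qed (use KX in blast)
    then obtain g where g: "\<And>i. i \<in> {1..k} \<Longrightarrow> g i \<in> set ` set (K i)" "compatible k g"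
      unfolding choosable_def by blast
    have gX: "g i \<in> clauses d X" if "i \<in> {1..k}" for i using KX[OF that g(1)[OF that]] .
    have nc: "\<not> clash (g i) (g j)" if "i \<in> {1..k}" "j \<in> {1..k}" for i j
      using g(2) that not_clash_self[OF gX[OF that(1)]] unfolding compatible_def by (cases "i = j") auto
    from r(2) show "choosable k (\<lambda>i. set ` set (G i))"
    proof
      assume nr: "\<not> free r \<and> R = K r"
      define h where "h = (\<lambda>i. g (if free i then r else i))"
      have "compatible k h"
        unfolding compatible_def
      proof (intro ballI impI)
        fix i j assume "i \<in> {1..k}" "j \<in> {1..k}" "i \<noteq> j"
        then show "\<not> clash (h i) (h j)" using nc r(1) unfolding h_def by (cases "free i"; cases "free j") simp_all
      qed
      moreover have "h i \<in> set ` set (G i)" if "i \<in> {1..k}" for i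
        using g(1)[OF that] g(1)[OF r(1)] nr unfolding h_def G by auto
      ultimately show ?thesis unfolding choosable_def by blast
    next
      \<comment> \<open>Here every part of \<open>G\<close> consists of the same single clause, so
        the choice \<open>g\<close> is replaced by this clause throughout.\<close>
      assume all: "(\<forall>i\<in>{1..k}. free i) \<and> R = [hd (K r)] \<and> K r \<noteq> []"
      have "set (hd (K r)) \<in> clauses d X" using KX[OF r(1)] all by simp
      then have "compatible k (\<lambda>_. set (hd (K r)))" unfolding compatible_def using not_clash_self by blast
      then show ?thesis unfolding choosable_def G using all by auto
    qed
  next
    assume "choosable k (\<lambda>i. set ` set (G i))"
    then obtain f where f: "\<And>i. i \<in> {1..k} \<Longrightarrow> f i \<in> set ` set (G i)" "compatible k f"
      unfolding choosable_def by blast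
    have "choosable k (\<lambda>i. set ` set (K i))"
    proof (rule choosable_exchange[OF f(2)])
      show "f i \<in> clauses d X" if "i \<in> {1..k}" for i
        using f(1)[OF that] KX[OF that] KX[OF r(1)] R unfolding G by (auto split: if_splits)
      show "\<exists>c\<in>set ` set (K i). c \<inter> Y = {}"
        if "i \<in> {1..k}" "finite Y" "card Y < (k - 1) * d + 1" "f i \<inter> Y = {}" for i Y
      proof (cases "free i")
        case True
        then show ?thesis using cov[OF that(1)] that(2,3) unfolding covers_def m by blast
      next
        case False
        then show ?thesis using f(1)[OF that(1)] that(4) unfolding G by auto
      qed
    qed (use KX in blast)
    then show "choosable k (\<lambda>i. set ` part_clauses i es)"
      by (rule choosable_mono) (use K in \<open>intro image_mono\<close>)
  qed
qed

text \<open>Each part of \<open>G\<close> is a tree that is not free, which has fewer than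
  \<open>D\<close> clauses, or the single clause of the case where all parts are free;
  \<open>2 <= D\<close> makes room for the latter.\<close>

lemma kernel_parts_bounds:
  assumes ker: "kernel_parts k m D es G" and es: "clause_instance k d X es" and D: "2 \<le> D"
    and i: "i \<in> {1..k}"
  shows "length (G i) \<le> D - 1" "distinct (map set (G i))"
    "c \<in> set (G i) \<Longrightarrow> distinct c \<and> set c \<in> clauses d X"
proof -
  obtain K free r R where K: "\<And>i. i \<in> {1..k} \<Longrightarrow> set (K i) \<subseteq> part_clauses i es \<and> distinct (map set (K i)) \<and>
      (\<not> free i \<longrightarrow> length (K i) < D)"
    and r: "r \<in> {1..k}" "\<not> free r \<and> R = K r \<or> (\<forall>i\<in>{1..k}. free i) \<and> R = [hd (K r)] \<and> K r \<noteq> []"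
    and G: "G = (\<lambda>i. if free i then R else K i)"
    using ker unfolding kernel_parts_def by (smt (verit))
  have R: "length R < D" "distinct (map set R)" "set R \<subseteq> set (K r)" using r K[OF r(1)] D by (auto simp: hd_in_set)
  show "length (G i) \<le> D - 1" using R K[OF i] D by (auto simp: G)
  show "distinct (map set (G i))" using R K[OF i] by (simp add: G)
  show "distinct c \<and> set c \<in> clauses d X" if "c \<in> set (G i)"
  proof -
    have "c \<in> set (K i) \<or> c \<in> set (K r)" using that R(3) unfolding G by (auto split: if_splits)
    then have "\<exists>p. (p, c) \<in> set es" using K[OF i] K[OF r(1)] by (auto simp: part_clauses_def)
    then show ?thesis using es unfolding clause_instance_def by auto
  qed
qed

section \<open>Passing between literals and their codes\<close>

lemma inj_literal_code: "inj literal_code"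
proof (rule injI)
  fix l l' assume eq: "literal_code l = literal_code l'"
  have "odd (2 * x + 1)" "even (2 * x)" for x :: nat by simp_all
  then show "l = l'" using eq by (cases l; cases l') (simp, metis literal_code.simps, metis literal_code.simps, simp)
qed

definition codes :: "(nat \<times> nat literal list) list \<Rightarrow> (nat \<times> nat list) list" where
  "codes es = map (\<lambda>(p, c). (p, map literal_code c)) es"

lemma length_codes [simp]: "length (codes es) = length es"
  by (simp add: codes_def)

lemma flat_codes: "flat (codes es) = concat (map (\<lambda>(p, c). p # map literal_code c) es)"
  by (simp add: flat_def codes_def comp_def split_def)

lemma codes_listing:
  assumes "\<And>i. i \<in> {1..k} \<Longrightarrow> H i = map (map literal_code) (G i)"
  shows "listing k H = codes (listing k G)"
  using assms
proof (induction k)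
  case (Suc k)
  have "listing k H = codes (listing k G)" using Suc by simp
  then show ?case using Suc.prems[of "Suc k"] by (simp add: listing_Suc codes_def comp_def)
qed (simp add: listing_0 codes_def)

lemma part_clauses_codes: "part_clauses i (codes es) = map literal_code ` part_clauses i es"
  by (force simp: part_clauses_def codes_def)

lemma clause_list_codes:
  assumes "clause_instance k d X es"
  shows "clause_list d (codes es)"
proof -
  have "length (map literal_code c) = d \<and> distinct (map literal_code c)" if "(p, c) \<in> set es" for p c
  proof -
    have "distinct c" "card (set c) = d" using assms that by (auto simp: clause_instance_def clauses_def)
    then show ?thesis using inj_literal_code by (simp add: distinct_card distinct_map inj_on_subset[OF _ subset_UNIV])
  qed
  then have len: "\<forall>(p, c)\<in>set (codes es). length c = d \<and> distinct c" by (auto simp: codes_def)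
  have "inj (\<lambda>(p :: nat, s). (p, literal_code ` s))"
    using inj_literal_code by (auto simp: inj_def inj_image_eq_iff)
  moreover have "distinct (map (\<lambda>(p, c). (p, set c)) es)" using assms by (simp add: clause_instance_def)
  ultimately have "distinct (map (\<lambda>(p, s). (p, literal_code ` s)) (map (\<lambda>(p, c). (p, set c)) es))"
    by (subst distinct_map) (auto intro: inj_on_subset)
  moreover have "map (\<lambda>(p, c). (p, set c)) (codes es) =
      map (\<lambda>(p, s). (p, literal_code ` s)) (map (\<lambda>(p, c). (p, set c)) es)"
    by (simp add: codes_def comp_def split_def)
  ultimately show ?thesis using len unfolding clause_list_def by simp
qed

lemma covers_codes: "covers m ((`) literal_code ` H) \<Longrightarrow> covers m H"
  unfolding covers_def
proof (intro allI impI)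
  fix Y :: "nat literal set"
  assume *: "\<forall>Y. finite Y \<and> card Y < m \<longrightarrow> (\<exists>c\<in>(`) literal_code ` H. c \<inter> Y = {})" "finite Y \<and> card Y < m"
  have "finite (literal_code ` Y) \<and> card (literal_code ` Y) < m"
    using *(2) card_image_le[of Y literal_code] by auto
  then obtain c where "c \<in> H" "literal_code ` c \<inter> literal_code ` Y = {}" using *(1) by blast
  then show "\<exists>c\<in>H. c \<inter> Y = {}" by blast
qed

text \<open>A blocking set \<open>Y\<close> is translated into the set of its codes, which is no
  larger and, by injectivity, still disjoint from the code of \<open>c\<close>.\<close>

lemma represents_codes:
  "represents m ((`) literal_code ` F) ((`) literal_code ` K) \<Longrightarrow> represents m F K"
  unfolding represents_def
proof (intro ballI allI impI)
  fix c Y assume *: "\<forall>c\<in>(`) literal_code ` F. \<forall>Y. finite Y \<and> card Y < m \<and> c \<inter> Y = {} \<longrightarrow>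
      (\<exists>c'\<in>(`) literal_code ` K. c' \<inter> Y = {})"
    "c \<in> F" "finite Y \<and> card Y < m \<and> c \<inter> Y = {}"
  have "finite (literal_code ` Y) \<and> card (literal_code ` Y) < m"
    using *(3) card_image_le[of Y literal_code] by auto
  moreover have "literal_code ` c \<inter> literal_code ` Y = {}"
    using *(3) image_Int[OF inj_literal_code, of c Y] by simp
  ultimately obtain c' where "c' \<in> K" "literal_code ` c' \<inter> literal_code ` Y = {}" using *(1,2) by blast
  then show "\<exists>c'\<in>K. c' \<inter> Y = {}" by blast
qed

text \<open>The kept clauses are clauses of the input, hence in the range of the coding, where
  \<open>inv literal_code\<close> recovers literals. This turns a statement about the numbers that
  the program handles into one about clauses.\<close>

lemma kernel_parts_codes:
  assumes "kernel_parts k m D (codes es) H"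
  obtains G where "kernel_parts k m D es G" "\<And>i. i \<in> {1..k} \<Longrightarrow> H i = map (map literal_code) (G i)"
proof -
  obtain K free r R where K: "\<And>i. i \<in> {1..k} \<Longrightarrow> set (K i) \<subseteq> part_clauses i (codes es) \<and> distinct (map set (K i)) \<and>
       (if free i then covers m (set ` set (K i))
        else length (K i) < D \<and> represents m (set ` part_clauses i (codes es)) (set ` set (K i)))"
    and r: "r \<in> {1..k}" "\<not> free r \<and> R = K r \<or> (\<forall>i\<in>{1..k}. free i) \<and> R = [hd (K r)] \<and> K r \<noteq> []"
    and H: "H = (\<lambda>i. if free i then R else K i)"
    using assms unfolding kernel_parts_def by (elim exE conjE) blast
  define dec where "dec = map (map (inv literal_code))"
  define K' where "K' = (\<lambda>i. dec (K i))"
  have dec: "map (map literal_code) (K' i) = K i" if "i \<in> {1..k}" for i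
  proof -
    have "map literal_code (map (inv literal_code) c) = c" if "c \<in> set (K i)" for c
      using K[OF \<open>i \<in> {1..k}\<close>] that unfolding part_clauses_codes
      by (auto simp: inj_literal_code comp_def dest!: subsetD)
    then show ?thesis by (simp add: K'_def dec_def comp_def map_idI)
  qed
  have sets: "set ` set (K i) = (`) literal_code ` set ` set (K' i)" if "i \<in> {1..k}" for i
  proof -
    have "set ` set (K i) = set ` set (map (map literal_code) (K' i))" using dec[OF that] by simp
    then show ?thesis by (simp add: image_image)
  qed
  have pc: "set ` part_clauses i (codes es) = (`) literal_code ` set ` part_clauses i es" for i
    by (simp add: part_clauses_codes image_image)
  have injm: "inj (map literal_code)" using inj_literal_code by simp
  have dR: "map (map literal_code) (dec R) = R"
    using r dec[OF r(1)] unfolding K'_def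
    by (auto simp: dec_def map_eq_Cons_conv) (metis (no_types, lifting) hd_map list.map_disc_iff list.simps(9))
  show ?thesis
  proof (rule that[of "\<lambda>i. if free i then dec R else K' i"])
    show "kernel_parts k m D es (\<lambda>i. if free i then dec R else K' i)"
      unfolding kernel_parts_def
    proof (intro exI conjI)
      show "r \<in> {1..k}" by (rule r(1))
      show "\<not> free r \<and> dec R = K' r \<or> (\<forall>i\<in>{1..k}. free i) \<and> dec R = [hd (K' r)] \<and> K' r \<noteq> []"
        using r(2) by (auto simp: K'_def dec_def hd_map)
      show "\<forall>i\<in>{1..k}. set (K' i) \<subseteq> part_clauses i es \<and> distinct (map set (K' i)) \<and>
       (if free i then covers m (set ` set (K' i))
        else length (K' i) < D \<and> represents m (set ` part_clauses i es) (set ` set (K' i)))"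
      proof (intro ballI conjI)
        fix i assume i: "i \<in> {1..k}"
        have "map literal_code ` set (K' i) \<subseteq> map literal_code ` part_clauses i es"
          using K[OF i] dec[OF i] unfolding part_clauses_codes by (metis set_map)
        then show "set (K' i) \<subseteq> part_clauses i es" using inj_image_subset_iff[OF injm] by blast
        have "distinct (map set (map (map literal_code) (K' i)))" using K[OF i] dec[OF i] by simp
        then have "distinct (map ((`) literal_code) (map set (K' i)))" by (simp add: comp_def)
        then show "distinct (map set (K' i))" using distinct_map by blast
        show "if free i then covers m (set ` set (K' i))
          else length (K' i) < D \<and> represents m (set ` part_clauses i es) (set ` set (K' i))"
          using K[OF i] covers_codes represents_codes unfolding sets[OF i] pc by (auto simp: K'_def dec_def split: if_splits)
      qed
    qed simp
    show "H i = map (map literal_code) (if free i then dec R else K' i)" if "i \<in> {1..k}" for i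
      using dec[OF that] dR by (simp add: H)
  qed
qed

section \<open>Instances as lists\<close>

text \<open>Vertices are positions in the list. This gives the output word an actual graph that it
  encodes.\<close>

definition list_graph :: "(nat \<times> 'x literal list) list \<Rightarrow> (nat, 'x) clause_graph" where
  "list_graph es = \<lparr>verts = {..<length es},
     edges = {{u, v} |u v. u < length es \<and> v < length es \<and> fst (es ! u) \<noteq> fst (es ! v) \<and>
       clash (set (snd (es ! u))) (set (snd (es ! v)))},
     part = (\<lambda>i. {u. u < length es \<and> fst (es ! u) = i}), label = (\<lambda>v. set (snd (es ! v)))\<rparr>"

lemma clause_instance_nth:
  assumes "clause_instance k d X es" "v < length es"
  shows "fst (es ! v) \<in> {1..k}" "distinct (snd (es ! v))" "set (snd (es ! v)) \<in> clauses d X"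
proof -
  have "(fst (es ! v), snd (es ! v)) \<in> set es" using assms(2) by simp
  then show "fst (es ! v) \<in> {1..k}" "distinct (snd (es ! v))" "set (snd (es ! v)) \<in> clauses d X"
    using assms(1) unfolding clause_instance_def by blast+
qed

lemma list_graph_partite:
  assumes "clause_instance k d X es"
  shows "partite_clause_graph k d X (list_graph es)"
  unfolding partite_clause_graph_def
proof (intro conjI ballI)
  show "finite (verts (list_graph es))" by (simp add: list_graph_def)
  show "edges (list_graph es) \<subseteq> {{u, v} |u v. u \<in> verts (list_graph es) \<and> v \<in> verts (list_graph es) \<and> u \<noteq> v}"
    by (auto simp: list_graph_def)
  show "verts (list_graph es) = (\<Union>i\<in>{1..k}. part (list_graph es) i)"
    using clause_instance_nth(1)[OF assms] by (auto simp: list_graph_def)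
  show "disjoint_family_on (part (list_graph es)) {1..k}"
    by (auto simp: disjoint_family_on_def list_graph_def)
  show "label (list_graph es) v \<in> clauses d X" if "v \<in> verts (list_graph es)" for v
    using clause_instance_nth(3)[OF assms] that by (simp add: list_graph_def)
  show "inj_on (label (list_graph es)) (part (list_graph es) i)" for i
  proof (rule inj_onI)
    fix u v assume *: "u \<in> part (list_graph es) i" "v \<in> part (list_graph es) i"
      "label (list_graph es) u = label (list_graph es) v"
    let ?f = "\<lambda>(p, c). (p, set c)"
    have "inj_on ((!) (map ?f es)) {..<length es}"
      using assms unfolding clause_instance_def by (intro inj_on_nth) auto
    moreover have "map ?f es ! u = map ?f es ! v" using * by (auto simp: list_graph_def split_def)
    ultimately show "u = v" by (rule inj_onD) (use * in \<open>auto simp: list_graph_def\<close>)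
  qed
  show "({u, v} \<in> edges (list_graph es)) = (i \<noteq> j \<and> clash (label (list_graph es) u) (label (list_graph es) v))"
    if "u \<in> part (list_graph es) i" "v \<in> part (list_graph es) j" for i j u v
    using that clash_sym[of "set (snd (es ! u))"] by (auto simp: list_graph_def doubleton_eq_iff)
qed

lemma list_graph_encodes:
  assumes "clause_instance k d X es"
  shows "encodes k d (list_graph es) (k # d # length es # flat (codes es))"
  unfolding encodes_def
proof (intro exI conjI)
  show "\<forall>v\<in>verts (list_graph es). fst (es ! v) \<in> {1..k} \<and> v \<in> part (list_graph es) (fst (es ! v))"
    using clause_instance_nth(1)[OF assms] by (simp add: list_graph_def)
  show "\<forall>v\<in>verts (list_graph es). distinct (snd (es ! v)) \<and> set (snd (es ! v)) = label (list_graph es) v"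
    using clause_instance_nth(2)[OF assms] by (simp add: list_graph_def)
  have "map (\<lambda>v. fst (es ! v) # map literal_code (snd (es ! v))) [0..<length es] =
      map (\<lambda>(p, c). p # map literal_code c) es"
    by (rule nth_equalityI) (simp_all add: split_def)
  then show "k # d # length es # flat (codes es) = k # d # length [0..<length es] #
      concat (map (\<lambda>v. fst (es ! v) # map literal_code (snd (es ! v))) [0..<length es])"
    by (simp add: flat_codes)
qed (auto simp: list_graph_def)

lemma list_graph_labels: "label (list_graph es) ` part (list_graph es) i = set ` part_clauses i es"
  by (force simp: list_graph_def part_clauses_def in_set_conv_nth image_iff)

text \<open>By disjointness of the parts, the index listed with a vertex is that of the only part
  containing it. So the list has exactly the clauses of each part, and injectivity of the labels
  makes its entries distinct.\<close>

lemma encodes_list: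
  assumes G: "partite_clause_graph k d X G" and "encodes k d G w"
  obtains es where "clause_instance k d X es" "w = k # d # length es # flat (codes es)"
    "length es = card (verts G)" "\<And>i. i \<in> {1..k} \<Longrightarrow> label G ` part G i = set ` part_clauses i es"
proof -
  obtain vs p ls where vs: "distinct vs" "set vs = verts G"
    and p: "\<And>v. v \<in> verts G \<Longrightarrow> p v \<in> {1..k} \<and> v \<in> part G (p v)"
    and ls: "\<And>v. v \<in> verts G \<Longrightarrow> distinct (ls v) \<and> set (ls v) = label G v"
    and w: "w = k # d # length vs # concat (map (\<lambda>v. p v # map literal_code (ls v)) vs)"
    using assms(2) unfolding encodes_def by blast
  let ?es = "map (\<lambda>v. (p v, ls v)) vs"
  have inj: "inj_on (label G) (part G i)" if "i \<in> {1..k}" for i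
    using G that unfolding partite_clause_graph_def by blast
  have lab: "label G v \<in> clauses d X" if "v \<in> verts G" for v
    using G that unfolding partite_clause_graph_def by blast
  have "inj_on (\<lambda>v. (p v, set (ls v))) (set vs)"
  proof (rule inj_onI)
    fix u v assume "u \<in> set vs" "v \<in> set vs" and eq: "(p u, set (ls u)) = (p v, set (ls v))"
    then have uv: "u \<in> verts G" "v \<in> verts G" using vs(2) by simp_all
    have "label G u = label G v" "p u = p v" using eq ls[OF uv(1)] ls[OF uv(2)] by auto
    then show "u = v" using inj_onD[OF inj[of "p v"]] p[OF uv(1)] p[OF uv(2)] by metis
  qed
  then have "distinct (map (\<lambda>v. (p v, set (ls v))) vs)" using vs(1) by (simp add: distinct_map)
  then have inst: "clause_instance k d X ?es"
    unfolding clause_instance_def using p ls lab vs(2) by (auto simp: comp_def)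
  have words: "w = k # d # length ?es # flat (codes ?es)" unfolding w flat_codes by (simp add: comp_def)
  have card: "length ?es = card (verts G)" using vs distinct_card by fastforce
  have "label G ` part G i = set ` part_clauses i ?es" if i: "i \<in> {1..k}" for i
  proof -
    have sub: "v \<in> verts G" if "v \<in> part G i" for v
      using G i that unfolding partite_clause_graph_def by auto
    have "p v = i" if "v \<in> part G i" for v
    proof (rule ccontr)
      assume "p v \<noteq> i"
      then have "part G (p v) \<inter> part G i = {}"
        using G i p[OF sub[OF that]] unfolding partite_clause_graph_def disjoint_family_on_def by blast
      then show False using p[OF sub[OF that]] that by blast
    qed
    then have "part G i = {v \<in> set vs. p v = i}" using sub vs(2) p by auto
    then have "part_clauses i ?es = ls ` part G i" by (auto simp: part_clauses_def)
    moreover have "set (ls v) = label G v" if "v \<in> part G i" for v using ls[OF sub[OF that]] by simp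
    ultimately show ?thesis by (simp add: image_image)
  qed
  then show ?thesis using that[OF inst words card] by blast
qed

lemma card_list_graph_part:
  assumes "clause_instance k d X (listing k G)" "i \<in> {1..k}" "distinct (map set (G i))"
  shows "card (part (list_graph (listing k G)) i) = length (G i)"
proof -
  let ?H = "list_graph (listing k G)"
  have "inj_on (label ?H) (part ?H i)"
    using list_graph_partite[OF assms(1)] assms(2) unfolding partite_clause_graph_def by blast
  then have "card (part ?H i) = card (set ` part_clauses i (listing k G))"
    using card_image list_graph_labels by metis
  also have "part_clauses i (listing k G) = set (G i)"
    using assms(2) by (simp add: part_clauses_def set_listing)
  also have "card (set ` set (G i)) = length (G i)" using distinct_card[OF assms(3)] by simp
  finally show ?thesis .
qed

lemma instance_size_eq:
  assumes "partite_clause_graph k d X G"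
  shows "instance_size G = d * card (verts G)"
proof -
  have "card (label G v) = d" if "v \<in> verts G" for v
    using assms that unfolding partite_clause_graph_def clauses_def by blast
  then show ?thesis by (simp add: instance_size_def mult.commute)
qed

lemma clause_instance_listing:
  assumes "\<And>i c. i \<in> {1..k} \<Longrightarrow> c \<in> set (G i) \<Longrightarrow> distinct c \<and> set c \<in> clauses d X"
    and "\<And>i. i \<in> {1..k} \<Longrightarrow> distinct (map set (G i))"
  shows "clause_instance k d X (listing k G)"
proof -
  have "distinct (map (\<lambda>(p, c). (p, set c)) (listing j G))" if "j \<le> k" for j
    using that
  proof (induction j)
    case (Suc j)
    have "distinct (map (\<lambda>(p, c). (p, set c)) (map (Pair (Suc j)) (G (Suc j))))"
      using assms(2)[of "Suc j"] Suc.prems by (auto simp: distinct_map comp_def inj_on_def)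
    moreover have "p \<le> j" if "(p, c) \<in> set (listing j G)" for p c
      using that by (simp add: set_listing)
    ultimately show ?case using Suc by (force simp: listing_Suc)
  qed (simp add: listing_0)
  then show ?thesis using assms(1) unfolding clause_instance_def by (auto simp: set_listing)
qed

text \<open>If k = 1, then d >= 2 and already d! >= 2; if k >= 2, then m >= 2. For k = d = 1 the
  value is 1.\<close>

lemma part_bound_ge_2:
  assumes "1 \<le> k" "1 \<le> d" "\<not> (k = 1 \<and> d = 1)"
  shows "2 \<le> fact d * ((k - 1) * d + 1) ^ d"
proof (cases "k = 1")
  case True
  then have "2 \<le> d" using assms by simp
  then have "2 \<le> (fact d :: nat)" using fact_ge_self[of d] by linarith
  then show ?thesis using True by simp
next
  case False
  then have "1 * 1 \<le> (k - 1) * d" using assms by (intro mult_le_mono) auto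
  then have "2 ^ 1 \<le> ((k - 1) * d + 1) ^ 1" by simp
  also have "\<dots> \<le> ((k - 1) * d + 1) ^ d" using assms by (intro power_increasing) auto
  finally have "1 * 2 \<le> fact d * ((k - 1) * d + 1) ^ d" by (intro mult_le_mono) (simp_all add: Suc_le_eq)
  then show ?thesis by simp
qed

text \<open>For k = d = 1 the bound \<open>D - 1\<close> would be 0; an instance with an empty part
  is a no-instance, so no yes-instance could be reduced. The added 1 in the time bound is for n = 0,
  where the minimum vanishes although reading the header takes steps.\<close>

theorem theorem6:
  "\<exists>(P :: com) (C :: nat). \<forall>(k :: nat) (d :: nat) (X :: nat set)
      (G :: (nat, nat) clause_graph) (w :: nat list).
     1 \<le> k \<and> 1 \<le> d \<and> \<not> (k = 1 \<and> d = 1) \<and>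
     partite_clause_graph k d X G \<and> encodes k d G w \<longrightarrow>
     (let s = (k - 1) * d + 2;
          D = fact d * (s - 1) ^ d;
          n = card (verts G)
      in \<exists>(w' :: nat list) (t :: nat) (G' :: (nat, nat) clause_graph).
           computes_in P w w' t \<and>
           t \<le> C * (min (D * d * n) (d * n ^ 2) + 1) \<and>
           partite_clause_graph k d X G' \<and> encodes k d G' w' \<and>
           equivalent_instances k G G' \<and>
           (\<forall>i\<in>{1..k}. card (part G' i) \<le> D - 1) \<and>
           instance_size G' \<le> d * k * D)"
proof (intro exI[of _ kernelize] exI[of _ 1000] allI impI, elim conjE)
  fix k d :: nat and X :: "nat set" and G :: "(nat, nat) clause_graph" and w :: "nat list"
  assume k: "1 \<le> k" and d: "1 \<le> d" and kd: "\<not> (k = 1 \<and> d = 1)"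
    and G: "partite_clause_graph k d X G" and enc: "encodes k d G w"
  define m where "m = (k - 1) * d + 1"
  define D where "D = fact d * m ^ d"
  define n where "n = card (verts G)"
  have D2: "2 \<le> D" unfolding D_def m_def by (rule part_bound_ge_2[OF k d kd])
  obtain es where es: "clause_instance k d X es" and w: "w = k # d # length es # flat (codes es)"
    and n: "length es = n" and labels: "\<And>i. i \<in> {1..k} \<Longrightarrow> label G ` part G i = set ` part_clauses i es"
    using encodes_list[OF G enc] unfolding n_def by blast
  have "wp kernelize (input_state w) (\<lambda>t s'. t \<le> 1000 * (min (D * d * n) (d * n ^ 2) + 1) \<and>
    (\<exists>w'. fst s' 0 = length w' \<and> holds (snd s' 0) w' \<and>
      (n < D \<and> w' = w \<or> D \<le> n \<and> (\<exists>H. kernel_parts k m D (codes es) H \<and>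
        w' = k # d # length (listing k H) # flat (listing k H)))))"
    by (rule wp_kernelize[OF clause_list_codes[OF es] d k m_def D_def]) (simp_all add: n w)
  then obtain t s' w' where run: "exec kernelize (input_state w) t s'"
    and t: "t \<le> 1000 * (min (D * d * n) (d * n ^ 2) + 1)"
    and out: "fst s' 0 = length w'" "holds (snd s' 0) w'"
    and cases: "n < D \<and> w' = w \<or> D \<le> n \<and> (\<exists>H. kernel_parts k m D (codes es) H \<and>
        w' = k # d # length (listing k H) # flat (listing k H))"
    unfolding wp_def by blast
  have comp: "computes_in kernelize w w' t"
    unfolding computes_in_def using run out unfolding holds_def by blast
  have "\<exists>G' :: (nat, nat) clause_graph. partite_clause_graph k d X G' \<and> encodes k d G' w' \<and>
      equivalent_instances k G G' \<and> (\<forall>i\<in>{1..k}. card (part G' i) \<le> D - 1)"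
    using cases
  proof (elim disjE conjE exE)
    assume small: "n < D" "w' = w"
    have "card (part G i) \<le> D - 1" if "i \<in> {1..k}" for i
    proof -
      have "part G i \<subseteq> verts G" "finite (verts G)"
        using G that unfolding partite_clause_graph_def by auto
      then show ?thesis using card_mono[of "verts G" "part G i"] small(1) unfolding n_def by linarith
    qed
    then show ?thesis using G enc small(2) unfolding equivalent_instances_def by blast
  next
    fix H assume H: "kernel_parts k m D (codes es) H"
      and w': "w' = k # d # length (listing k H) # flat (listing k H)"
    obtain K where K: "kernel_parts k m D es K" and HK: "\<And>i. i \<in> {1..k} \<Longrightarrow> H i = map (map literal_code) (K i)"
      using kernel_parts_codes[OF H] by blast
    note bounds = kernel_parts_bounds[OF K es D2]
    let ?ys = "listing k K"
    have ys: "clause_instance k d X ?ys" using bounds(2,3) by (intro clause_instance_listing)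
    have "listing k H = codes ?ys" using HK by (rule codes_listing)
    then have "encodes k d (list_graph ?ys) w'" using list_graph_encodes[OF ys] w' by simp
    moreover have "equivalent_instances k G (list_graph ?ys)"
    proof -
      have "CGIS k G \<longleftrightarrow> choosable k (\<lambda>i. set ` part_clauses i es)"
        unfolding CGIS_iff_choosable[OF G] using labels by (simp add: choosable_def)
      also have "\<dots> \<longleftrightarrow> choosable k (\<lambda>i. set ` set (K i))"
        by (rule kernel_parts_choosable[OF K m_def es])
      also have "\<dots> \<longleftrightarrow> CGIS k (list_graph ?ys)"
        unfolding CGIS_iff_choosable[OF list_graph_partite[OF ys]] list_graph_labels
        by (simp add: choosable_def part_clauses_def set_listing)
      finally show ?thesis unfolding equivalent_instances_def .
    qed
    moreover have "card (part (list_graph ?ys) i) \<le> D - 1" if "i \<in> {1..k}" for i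
      using card_list_graph_part[OF ys that bounds(2)[OF that]] bounds(1)[OF that] by simp
    ultimately show ?thesis using list_graph_partite[OF ys] by blast
  qed
  then obtain G' :: "(nat, nat) clause_graph" where G': "partite_clause_graph k d X G'" "encodes k d G' w'"
      "equivalent_instances k G G'" "\<forall>i\<in>{1..k}. card (part G' i) \<le> D - 1" by blast
  have "instance_size G' \<le> d * k * D"
  proof -
    have "verts G' = (\<Union>i\<in>{1..k}. part G' i)" using G'(1) unfolding partite_clause_graph_def by blast
    then have "card (verts G') \<le> (\<Sum>i\<in>{1..k}. card (part G' i))" by (simp add: card_UN_le)
    also have "\<dots> \<le> (\<Sum>i\<in>{1..k}. D)" using G'(4) by (intro sum_mono) fastforce
    finally have "d * card (verts G') \<le> d * (k * D)" by simp
    then show ?thesis using instance_size_eq[OF G'(1)] by (simp add: mult.assoc)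
  qed
  note size = this
  have s: "(k - 1) * d + 2 - 1 = m" by (simp add: m_def)
  show "let s = (k - 1) * d + 2; D = fact d * (s - 1) ^ d; n = card (verts G)
      in \<exists>(w' :: nat list) (t :: nat) (G' :: (nat, nat) clause_graph).
           computes_in kernelize w w' t \<and>
           t \<le> 1000 * (min (D * d * n) (d * n ^ 2) + 1) \<and>
           partite_clause_graph k d X G' \<and> encodes k d G' w' \<and>
           equivalent_instances k G G' \<and>
           (\<forall>i\<in>{1..k}. card (part G' i) \<le> D - 1) \<and>
           instance_size G' \<le> d * k * D"
    unfolding Let_def s D_def[symmetric] n_def[symmetric] using comp t G' size by blast
qed

end
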